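(* Let $(M,g)$ be a semi-Riemannian manifold of dimension $n$, let $\gamma:[a,b]\to M$ be a geodesic, and let $\mathcal P\subset M$ be a smooth connected submanifold with $\gamma(a)\in\mathcal P$, $\dot\gamma(a)\in T_{\gamma(a)}\mathcal P^\perp$, and such that $g$ restricted to $T_{\gamma(a)}\mathcal P$ is nondegenerate. Let $\ell:[a,b]\to\Lambda$ be the curve of Lagrangians associated with $\gamma$ and let $L_0$, $L_{\mathcal P}$ be the Lagrangians associated with $\{\gamma(a)\}$ and $\mathcal P$ (see context). Let $\varepsilon\in\left]0,b-a\right[$ be a small positive number such that there are no conjugate or $\mathcal P$-focal instants in $\left]a,a+\varepsilon\right]$. If $\mu_{L_{\mathcal P}}\big(\ell|_{[a+\varepsilon,b]}\big)<-n_-(g,\mathcal P)$ or $\mu_{L_{\mathcal P}}\big(\ell|_{[a+\varepsilon,b]}\big)>\dim(\mathcal P)$, then there exists at least one conjugate instant in $[a+\varepsilon,b]$.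
   Context: Maslov index. Let $(V,\omega)$ be a $2n$-dimensional real symplectic space and $\Lambda$ the set of its Lagrangian subspaces. For $L_1\in\Lambda$, $\Lambda^0(L_1)$ is the set of Lagrangians transverse to $L_1$. If $L_0,L_1$ are transverse Lagrangians, $\varphi_{L_0,L_1}:\Lambda^0(L_1)\to\mathrm{B}_{\mathrm{sym}}(L_0)$ (symmetric bilinear forms on $L_0$) is $\varphi_{L_0,L_1}(L)=\omega(T\cdot,\cdot)|_{L_0\times L_0}$, where $T:L_0\to L_1$ is the linear map whose graph is $L$. For a symmetric bilinear form $B$, $n_-(B)$ is the maximal dimension of a subspace on which $B$ is negative definite and $n_+(B)=n_-(-B)$. For a continuous path $\ell:[a,b]\to\Lambda$ and $L_0\in\Lambda$, $\mu_{L_0}(\ell)\in\mathbb Z$ is characterized by: fixed-endpoint homotopy invariance; additivity under concatenation; and, if $\ell([a,b])\subset\Lambda^0(L_1)$ for some $L_1$ transverse to $L_0$, $\mu_{L_0}(\ell)=n_+[\varphi_{L_0,L_1}(\ell(b))]-n_+[\varphi_{L_0,L_1}(\ell(a))]$. Geometric setting. $\perp$ denotes $g$-orthogonality. Jacobi fields along $\gamma$ are solutions of $\frac{\mathrm D^2}{\mathrm dt^2}J-R(\dot\gamma,J)\dot\gamma=0$, with $R(X,Y)=[\nabla_X,\nabla_Y]-\nabla_{[X,Y]}$. Let $V=T_{\gamma(a)}M\oplus T_{\gamma(a)}M$ with symplectic form $\omega\big((v_1,w_1),(v_2,w_2)\big)=g(v_2,w_1)-g(v_1,w_2)$. For $(v,w)\in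 V$ let $J_{v,w}$ be the Jacobi field along $\gamma$ with $J(a)=v$, $\frac{\mathrm D}{\mathrm dt}J(a)=w$. The smooth curve $\ell:[a,b]\to\Lambda$ is $\ell(t)=\{(v,w)\in V: J_{v,w}(t)=0\}$. Set $L_0=\{0\}\oplus T_{\gamma(a)}M=\ell(a)$. Let $S:T_{\gamma(a)}\mathcal P\to T_{\gamma(a)}\mathcal P$ be the $g$-symmetric operator representing the second fundamental form of $\mathcal P$ at $\gamma(a)$ in the normal direction $\dot\gamma(a)$, i.e. $g(S(v),v')=g(\nabla_vV',\dot\gamma(a))$ for any local extension $V'$ of $v'$ to a field tangent to $\mathcal P$. Set $L_{\mathcal P}=\{(v,w)\in V: v\in T_{\gamma(a)}\mathcal P,\ w+S(v)\in T_{\gamma(a)}\mathcal P^\perp\}$, a Lagrangian subspace. An instant $t\in\left]a,b\right]$ is $\mathcal P$-focal if $\ell(t)\cap L_{\mathcal P}\ne\{0\}$, and conjugate if $\ell(t)\cap L_0\neq\{0\}$. (Such an $\varepsilon$ always exists, since the initial instant $a$ is isolated.) $n_-(g,\mathcal P)$ is the index of the restriction of $g$ to $T_{\gamma(a)}\mathcal P$. *)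

theory Defs
  imports "HOL-Analysis.Analysis"
begin

section \<open>Symplectic linear algebra and the Maslov index\<close>

text \<open>
  The symplectic space is a type \<open>'v\<close> of class \<open>euclidean_space\<close>, and \<open>\<omega>\<close> stands for an
  arbitrary symplectic form on it.  The inner product of \<open>'v\<close> is unrelated to \<open>\<omega>\<close>; it is only used to describe the
  topology of the Lagrangian Grassmannian, which does not depend on it.
\<close>

definition lagrangian :: "('v::euclidean_space \<Rightarrow> 'v \<Rightarrow> real) \<Rightarrow> 'v set \<Rightarrow> bool" where
  "lagrangian \<omega> L \<longleftrightarrow> subspace L \<and> (\<forall>x\<in>L. \<forall>y\<in>L. \<omega> x y = 0) \<and> 2 * dim L = DIM('v)"

definition transverse :: "'v::euclidean_space set \<Rightarrow> 'v set \<Rightarrow> bool" where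
  "transverse L L' \<longleftrightarrow> L \<inter> L' = {0}"

definition n_minus :: "'v::euclidean_space set \<Rightarrow> ('v \<Rightarrow> 'v \<Rightarrow> real) \<Rightarrow> nat" where
  "n_minus W B = Max {dim U | U. subspace U \<and> U \<subseteq> W \<and> (\<forall>u\<in>U. u \<noteq> 0 \<longrightarrow> B u u < 0)}"

definition n_plus :: "'v::euclidean_space set \<Rightarrow> ('v \<Rightarrow> 'v \<Rightarrow> real) \<Rightarrow> nat" where
  "n_plus W B = n_minus W (\<lambda>u v. - B u v)"

text \<open>For \<open>L\<close> transverse to \<open>L1\<close>, the linear map \<open>T : L0 \<rightarrow> L1\<close> with graph \<open>{x + T x | x \<in> L0} = L\<close>.\<close>

definition graph_map :: "'v::euclidean_space set \<Rightarrow> 'v set \<Rightarrow> 'v \<Rightarrow> 'v" where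
  "graph_map L1 L x = (THE y. y \<in> L1 \<and> x + y \<in> L)"

text \<open>The form \<open>\<phi>\<^bsub>L0,L1\<^esub>(L)\<close>; only its restriction to \<open>L0\<close> is meaningful, and \<open>L0\<close> enters
  as the set over which \<^term>\<open>n_plus\<close> is taken.\<close>

definition chart_form ::
  "('v::euclidean_space \<Rightarrow> 'v \<Rightarrow> real) \<Rightarrow> 'v set \<Rightarrow> 'v set \<Rightarrow> 'v \<Rightarrow> 'v \<Rightarrow> real" where
  "chart_form \<omega> L1 L x y = \<omega> (graph_map L1 L x) y"

text \<open>
  The usual topology of the Grassmannian: a subspace is identified with the orthogonal projection
  onto it.  The function space carries the topology of pointwise convergence, which on linear maps
  of a finite-dimensional space is the norm topology.
\<close>

definition lagrangian_grassmannian ::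
  "('v::euclidean_space \<Rightarrow> 'v \<Rightarrow> real) \<Rightarrow> 'v set topology" where
  "lagrangian_grassmannian \<omega> = pullback_topology {L. lagrangian \<omega> L} closest_point euclidean"

definition lagrangian_path ::
  "('v::euclidean_space \<Rightarrow> 'v \<Rightarrow> real) \<Rightarrow> real \<Rightarrow> real \<Rightarrow> (real \<Rightarrow> 'v set) \<Rightarrow> bool" where
  "lagrangian_path \<omega> a b l \<longleftrightarrow> continuous_map (top_of_set {a..b}) (lagrangian_grassmannian \<omega>) l"

text \<open>
  \<open>\<mu> a b l\<close> is the Maslov index of \<open>l : [a,b] \<rightarrow> \<Lambda>\<close> relative to \<open>L0\<close>; the function \<open>\<mu>\<close> is
  specified by the three properties that determine it on all continuous paths.  The values of \<open>l\<close>
  outside \<open>[a,b]\<close> are irrelevant (use the constant homotopy on \<open>[a,b]\<close>), so restricting a path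
  amounts to changing \<open>a\<close> and \<open>b\<close>, and every path on \<open>[a,b]\<close> is the concatenation of its
  restrictions to \<open>[a,c]\<close> and \<open>[c,b]\<close>.
\<close>

definition is_maslov_index ::
  "('v::euclidean_space \<Rightarrow> 'v \<Rightarrow> real) \<Rightarrow> 'v set \<Rightarrow>
     (real \<Rightarrow> real \<Rightarrow> (real \<Rightarrow> 'v set) \<Rightarrow> int) \<Rightarrow> bool" where
  "is_maslov_index \<omega> L0 \<mu> \<longleftrightarrow>
     (\<forall>a b l l'. a < b \<and> lagrangian_path \<omega> a b l \<and>
        homotopic_with (\<lambda>h. h a = l a \<and> h b = l b)
          (top_of_set {a..b}) (lagrangian_grassmannian \<omega>) l l' \<longrightarrow>
        \<mu> a b l = \<mu> a b l') \<and>
     (\<forall>a c b l. a < c \<and> c < b \<and> lagrangian_path \<omega> a b l \<longrightarrow>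
        \<mu> a b l = \<mu> a c l + \<mu> c b l) \<and>
     (\<forall>a b l L1. a < b \<and> lagrangian_path \<omega> a b l \<and>
        lagrangian \<omega> L1 \<and> transverse L0 L1 \<and> (\<forall>t\<in>{a..b}. transverse (l t) L1) \<longrightarrow>
        \<mu> a b l = int (n_plus L0 (chart_form \<omega> L1 (l b))) - int (n_plus L0 (chart_form \<omega> L1 (l a))))"


section \<open>Smooth manifolds\<close>

text \<open>\<open>C\<^sup>k\<close> maps on an open set, by iterated directional derivatives.\<close>

primrec Ck_on :: "nat \<Rightarrow> 'a::euclidean_space set \<Rightarrow> ('a \<Rightarrow> 'b::euclidean_space) \<Rightarrow> bool" where
  "Ck_on 0 S f \<longleftrightarrow> continuous_on S f"
| "Ck_on (Suc k) S f \<longleftrightarrow> (\<forall>x\<in>S. f differentiable (at x)) \<and>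
     (\<forall>v. Ck_on k S (\<lambda>x. frechet_derivative f (at x) v))"

definition smooth_on :: "'a::euclidean_space set \<Rightarrow> ('a \<Rightarrow> 'b::euclidean_space) \<Rightarrow> bool" where
  "smooth_on S f \<longleftrightarrow> (\<forall>k. Ck_on k S f)"

text \<open>A chart is its domain together with its coordinate map.  The type \<open>'e\<close> is the model space, so
  the dimension of the manifold is \<open>DIM('e)\<close>.\<close>

type_synonym ('m, 'e) chart = "'m set \<times> ('m \<Rightarrow> 'e)"

definition is_chart :: "'m topology \<Rightarrow> ('m, 'e::euclidean_space) chart \<Rightarrow> bool" where
  "is_chart X c \<longleftrightarrow> openin X (fst c) \<and> open (snd c ` fst c) \<and>
     homeomorphic_map (subtopology X (fst c)) (top_of_set (snd c ` fst c)) (snd c)"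

definition transition ::
  "('m, 'e::euclidean_space) chart \<Rightarrow> ('m, 'e) chart \<Rightarrow> 'e \<Rightarrow> 'e" where
  "transition c c' = snd c' \<circ> inv_into (fst c) (snd c)"

definition compatible :: "('m, 'e::euclidean_space) chart \<Rightarrow> ('m, 'e) chart \<Rightarrow> bool" where
  "compatible c c' \<longleftrightarrow> smooth_on (snd c ` (fst c \<inter> fst c')) (transition c c') \<and>
                    smooth_on (snd c' ` (fst c \<inter> fst c')) (transition c' c)"

definition smooth_manifold :: "'m topology \<Rightarrow> ('m, 'e::euclidean_space) chart set \<Rightarrow> bool" where
  "smooth_manifold X A \<longleftrightarrow> Hausdorff_space X \<and> second_countable X \<and>
     (\<forall>c\<in>A. is_chart X c) \<and> (\<Union>c\<in>A. fst c) = topspace X \<and> (\<forall>c\<in>A. \<forall>c'\<in>A. compatible c c')"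

definition charts_at :: "('m, 'e::euclidean_space) chart set \<Rightarrow> 'm \<Rightarrow> ('m, 'e) chart set" where
  "charts_at A p = {c \<in> A. p \<in> fst c}"

text \<open>
  A tangent vector at \<open>p\<close> is the family of its coordinate vectors in the charts at \<open>p\<close>, related by
  the derivatives of the coordinate changes (and \<open>0\<close> at the other charts, for uniqueness).
  For each \<open>c \<in> charts_at A p\<close>, evaluation at \<open>c\<close> is a linear isomorphism of the tangent space onto \<open>'e\<close>.
\<close>

type_synonym ('m, 'e) tvector = "('m, 'e) chart \<Rightarrow> 'e"

definition tangent_space ::
  "('m, 'e::euclidean_space) chart set \<Rightarrow> 'm \<Rightarrow> ('m, 'e) tvector set" where
  "tangent_space A p = {v. (\<forall>c. c \<notin> charts_at A p \<longrightarrow> v c = 0) \<and>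
     (\<forall>c\<in>charts_at A p. \<forall>c'\<in>charts_at A p.
        v c' = frechet_derivative (transition c c') (at (snd c p)) (v c))}"


section \<open>Semi-Riemannian metrics and their local expressions\<close>

text \<open>\<open>g c x\<close> is the metric at the point with coordinates \<open>x\<close> in the chart \<open>c\<close>, as a bilinear form on
  coordinate vectors.\<close>

type_synonym ('m, 'e) metric = "('m, 'e) chart \<Rightarrow> 'e \<Rightarrow> 'e \<Rightarrow> 'e \<Rightarrow> real"

definition semi_riemannian_manifold ::
  "'m topology \<Rightarrow> ('m, 'e::euclidean_space) chart set \<Rightarrow> ('m, 'e) metric \<Rightarrow> bool" where
  "semi_riemannian_manifold X A g \<longleftrightarrow> smooth_manifold X A \<and>
     (\<forall>c\<in>A. (\<forall>x\<in>snd c ` fst c. bilinear (g c x) \<and> (\<forall>u v. g c x u v = g c x v u) \<and>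
                (\<forall>u. (\<forall>v. g c x u v = 0) \<longrightarrow> u = 0)) \<and>
             (\<forall>u v. smooth_on (snd c ` fst c) (\<lambda>x. g c x u v))) \<and>
     (\<forall>c\<in>A. \<forall>c'\<in>A. \<forall>p\<in>fst c \<inter> fst c'. \<forall>u v.
        (let D = frechet_derivative (transition c c') (at (snd c p))
         in g c' (snd c' p) (D u) (D v) = g c (snd c p) u v))"

definition metric_at ::
  "('m, 'e::euclidean_space) metric \<Rightarrow> ('m, 'e) chart \<Rightarrow> 'm \<Rightarrow> 'e \<Rightarrow> 'e \<Rightarrow> real" where
  "metric_at g c p = g c (snd c p)"

text \<open>
  Below, \<open>G\<close> is the metric in one fixed chart.  \<open>christoffel G x u v\<close> is the Christoffel symbol
  \<open>\<Gamma>\<^sub>x(u,v)\<close>, given by the Koszul formula for constant vector fields; \<open>nabla G X Y x\<close> is the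
  Levi-Civita derivative \<open>(\<nabla>\<^sub>X Y)(x)\<close>.
\<close>

definition christoffel ::
  "('e::euclidean_space \<Rightarrow> 'e \<Rightarrow> 'e \<Rightarrow> real) \<Rightarrow> 'e \<Rightarrow> 'e \<Rightarrow> 'e \<Rightarrow> 'e" where
  "christoffel G x u v = (THE z. \<forall>w. 2 * G x z w =
       frechet_derivative (\<lambda>y. G y v w) (at x) u
     + frechet_derivative (\<lambda>y. G y u w) (at x) v
     - frechet_derivative (\<lambda>y. G y u v) (at x) w)"

definition nabla ::
  "('e::euclidean_space \<Rightarrow> 'e \<Rightarrow> 'e \<Rightarrow> real) \<Rightarrow> ('e \<Rightarrow> 'e) \<Rightarrow> ('e \<Rightarrow> 'e) \<Rightarrow> 'e \<Rightarrow> 'e" where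
  "nabla G X Y x = frechet_derivative Y (at x) (X x) + christoffel G x (X x) (Y x)"

definition lie_bracket :: "('e::euclidean_space \<Rightarrow> 'e) \<Rightarrow> ('e \<Rightarrow> 'e) \<Rightarrow> 'e \<Rightarrow> 'e" where
  "lie_bracket X Y x = frechet_derivative Y (at x) (X x) - frechet_derivative X (at x) (Y x)"

definition curvature_op ::
  "('e::euclidean_space \<Rightarrow> 'e \<Rightarrow> 'e \<Rightarrow> real) \<Rightarrow> ('e \<Rightarrow> 'e) \<Rightarrow> ('e \<Rightarrow> 'e) \<Rightarrow> ('e \<Rightarrow> 'e) \<Rightarrow> 'e \<Rightarrow> 'e" where
  "curvature_op G X Y Z x =
     nabla G X (nabla G Y Z) x - nabla G Y (nabla G X Z) x - nabla G (lie_bracket X Y) Z x"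

text \<open>\<open>R\<^sub>x(u,v)w\<close>; since \<open>R\<close> is a tensor, the vectors may be extended to constant fields.\<close>

definition curvature ::
  "('e::euclidean_space \<Rightarrow> 'e \<Rightarrow> 'e \<Rightarrow> real) \<Rightarrow> 'e \<Rightarrow> 'e \<Rightarrow> 'e \<Rightarrow> 'e \<Rightarrow> 'e" where
  "curvature G x u v w = curvature_op G (\<lambda>_. u) (\<lambda>_. v) (\<lambda>_. w) x"


section \<open>Geodesics and Jacobi fields\<close>

text \<open>A vector field along \<open>\<gamma> : [a,b] \<rightarrow> M\<close> is a map \<open>J\<close> with \<open>J t\<close> a tangent vector at \<open>\<gamma> t\<close>;
  derivatives at the endpoints are one-sided.\<close>

definition velocity ::
  "('m, 'e::euclidean_space) chart set \<Rightarrow> real \<Rightarrow> real \<Rightarrow> (real \<Rightarrow> 'm) \<Rightarrow> real \<Rightarrow> ('m, 'e) tvector" where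
  "velocity A a b \<gamma> t c =
     (if c \<in> charts_at A (\<gamma> t) then vector_derivative (\<lambda>s. snd c (\<gamma> s)) (at t within {a..b}) else 0)"

definition field_along ::
  "('m, 'e::euclidean_space) chart set \<Rightarrow> real \<Rightarrow> real \<Rightarrow> (real \<Rightarrow> 'm) \<Rightarrow>
     (real \<Rightarrow> ('m, 'e) tvector) \<Rightarrow> bool" where
  "field_along A a b \<gamma> J \<longleftrightarrow> (\<forall>t\<in>{a..b}. J t \<in> tangent_space A (\<gamma> t))"

definition differentiable_along ::
  "('m, 'e::euclidean_space) chart set \<Rightarrow> real \<Rightarrow> real \<Rightarrow> (real \<Rightarrow> 'm) \<Rightarrow>
     (real \<Rightarrow> ('m, 'e) tvector) \<Rightarrow> bool" where
  "differentiable_along A a b \<gamma> J \<longleftrightarrow>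
     (\<forall>t\<in>{a..b}. \<forall>c\<in>charts_at A (\<gamma> t). (\<lambda>s. J s c) differentiable (at t within {a..b}))"

definition covariant_derivative ::
  "('m, 'e::euclidean_space) chart set \<Rightarrow> ('m, 'e) metric \<Rightarrow> real \<Rightarrow> real \<Rightarrow> (real \<Rightarrow> 'm) \<Rightarrow>
     (real \<Rightarrow> ('m, 'e) tvector) \<Rightarrow> real \<Rightarrow> ('m, 'e) tvector" where
  "covariant_derivative A g a b \<gamma> J t c =
     (if c \<in> charts_at A (\<gamma> t)
      then vector_derivative (\<lambda>s. J s c) (at t within {a..b})
           + christoffel (g c) (snd c (\<gamma> t)) (velocity A a b \<gamma> t c) (J t c)
      else 0)"

text \<open>Geodesics and Jacobi fields are required to be twice differentiable; smoothness follows
  from the differential equations.\<close>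

definition geodesic ::
  "'m topology \<Rightarrow> ('m, 'e::euclidean_space) chart set \<Rightarrow> ('m, 'e) metric \<Rightarrow>
     real \<Rightarrow> real \<Rightarrow> (real \<Rightarrow> 'm) \<Rightarrow> bool" where
  "geodesic X A g a b \<gamma> \<longleftrightarrow> continuous_map (top_of_set {a..b}) X \<gamma> \<and>
     (\<forall>t\<in>{a..b}. \<forall>c\<in>charts_at A (\<gamma> t). (\<lambda>s. snd c (\<gamma> s)) differentiable (at t within {a..b})) \<and>
     differentiable_along A a b \<gamma> (velocity A a b \<gamma>) \<and>
     (\<forall>t\<in>{a..b}. \<forall>c\<in>charts_at A (\<gamma> t). covariant_derivative A g a b \<gamma> (velocity A a b \<gamma>) t c = 0)"

definition jacobi_field ::
  "('m, 'e::euclidean_space) chart set \<Rightarrow> ('m, 'e) metric \<Rightarrow> real \<Rightarrow> real \<Rightarrow> (real \<Rightarrow> 'm) \<Rightarrow>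
     (real \<Rightarrow> ('m, 'e) tvector) \<Rightarrow> bool" where
  "jacobi_field A g a b \<gamma> J \<longleftrightarrow>
     field_along A a b \<gamma> J \<and> differentiable_along A a b \<gamma> J \<and>
     differentiable_along A a b \<gamma> (covariant_derivative A g a b \<gamma> J) \<and>
     (\<forall>t\<in>{a..b}. \<forall>c\<in>charts_at A (\<gamma> t).
        covariant_derivative A g a b \<gamma> (covariant_derivative A g a b \<gamma> J) t c
        - curvature (g c) (snd c (\<gamma> t)) (velocity A a b \<gamma> t c) (J t c) (velocity A a b \<gamma> t c) = 0)"


section \<open>Submanifolds\<close>

definition embedded_submanifold ::
  "'m topology \<Rightarrow> ('m, 'e::euclidean_space) chart set \<Rightarrow> nat \<Rightarrow> 'm set \<Rightarrow> bool" where
  "embedded_submanifold X A k P \<longleftrightarrow> (\<forall>p\<in>P. \<exists>c W. is_chart X c \<and> (\<forall>c'\<in>A. compatible c c') \<and>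
     p \<in> fst c \<and> subspace W \<and> dim W = k \<and> snd c ` (P \<inter> fst c) = W \<inter> snd c ` fst c)"

text \<open>The tangent space of \<open>P\<close> at \<open>p\<close>, in the coordinates of the chart \<open>c\<close>: the velocities of
  curves in \<open>P\<close> through \<open>p\<close>.\<close>

definition submanifold_tangent ::
  "('m, 'e::euclidean_space) chart \<Rightarrow> 'm set \<Rightarrow> 'm \<Rightarrow> 'e set" where
  "submanifold_tangent c P p = {v. \<exists>\<sigma>. \<sigma> 0 = p \<and> (\<forall>\<^sub>F s in nhds (0::real). \<sigma> s \<in> P \<inter> fst c) \<and>
     ((\<lambda>s. snd c (\<sigma> s)) has_vector_derivative v) (at 0)}"

definition orthogonal_space ::
  "('e::euclidean_space \<Rightarrow> 'e \<Rightarrow> real) \<Rightarrow> 'e set \<Rightarrow> 'e set" where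
  "orthogonal_space G T = {w. \<forall>v\<in>T. G w v = 0}"

definition nondegenerate_on ::
  "'e::euclidean_space set \<Rightarrow> ('e \<Rightarrow> 'e \<Rightarrow> real) \<Rightarrow> bool" where
  "nondegenerate_on T G \<longleftrightarrow> (\<forall>v\<in>T. (\<forall>w\<in>T. G v w = 0) \<longrightarrow> v = 0)"

text \<open>
  In the chart \<open>c\<close> at \<open>p\<close>, \<open>S\<close> is the \<open>g\<close>-symmetric operator on the tangent space \<open>T\<close> of \<open>P\<close> that
  represents the second fundamental form of \<open>P\<close> in the normal direction \<open>\<nu>\<close>.  The fields \<open>V'\<close> are
  local vector fields on \<open>M\<close>, tangent to \<open>P\<close> at the points of \<open>P\<close>.
\<close>

definition second_fundamental_operator ::
  "('m, 'e::euclidean_space) metric \<Rightarrow> ('m, 'e) chart \<Rightarrow> 'm set \<Rightarrow> 'm \<Rightarrow> 'e \<Rightarrow> ('e \<Rightarrow> 'e) \<Rightarrow> bool" where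
  "second_fundamental_operator g c P p \<nu> S \<longleftrightarrow>
     (let T = submanifold_tangent c P p; G = metric_at g c p in
        (\<forall>v\<in>T. S v \<in> T) \<and>
        (\<forall>v\<in>T. \<forall>v'\<in>T. S (v + v') = S v + S v') \<and> (\<forall>r. \<forall>v\<in>T. S (r *\<^sub>R v) = r *\<^sub>R S v) \<and>
        (\<forall>v\<in>T. \<forall>v'\<in>T. G (S v) v' = G v (S v')) \<and>
        (\<forall>v\<in>T. \<forall>v'\<in>T. \<forall>U V'. open U \<and> snd c p \<in> U \<and> U \<subseteq> snd c ` fst c \<and> smooth_on U V' \<and>
           V' (snd c p) = v' \<and>
           (\<forall>q\<in>P \<inter> fst c. snd c q \<in> U \<longrightarrow> V' (snd c q) \<in> submanifold_tangent c P q) \<longrightarrow>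
           G (S v) v' = G (nabla (g c) (\<lambda>_. v) V' (snd c p)) \<nu>))"


section \<open>The Lagrangians associated with a geodesic\<close>

text \<open>
  Throughout, \<open>c\<close> is a chart at \<open>\<gamma> a\<close>, through which the tangent space at \<open>\<gamma> a\<close> is identified with
  \<open>'e\<close>; thus \<open>V\<close> becomes \<open>'e \<times> 'e\<close>.
\<close>

definition jacobi_symplectic_form ::
  "('e::euclidean_space \<Rightarrow> 'e \<Rightarrow> real) \<Rightarrow> 'e \<times> 'e \<Rightarrow> 'e \<times> 'e \<Rightarrow> real" where
  "jacobi_symplectic_form G x y = G (fst y) (snd x) - G (fst x) (snd y)"

definition jacobi_lagrangian ::
  "('m, 'e::euclidean_space) chart set \<Rightarrow> ('m, 'e) metric \<Rightarrow> real \<Rightarrow> real \<Rightarrow> (real \<Rightarrow> 'm) \<Rightarrow>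
     ('m, 'e) chart \<Rightarrow> real \<Rightarrow> ('e \<times> 'e) set" where
  "jacobi_lagrangian A g a b \<gamma> c t =
     {(v, w). \<exists>J. jacobi_field A g a b \<gamma> J \<and> J a c = v \<and> covariant_derivative A g a b \<gamma> J a c = w \<and>
        (\<forall>c'\<in>charts_at A (\<gamma> t). J t c' = 0)}"

definition point_lagrangian :: "('e::euclidean_space \<times> 'e) set" where
  "point_lagrangian = {0} \<times> UNIV"

definition submanifold_lagrangian ::
  "('e::euclidean_space \<Rightarrow> 'e \<Rightarrow> real) \<Rightarrow> 'e set \<Rightarrow> ('e \<Rightarrow> 'e) \<Rightarrow> ('e \<times> 'e) set" where
  "submanifold_lagrangian G T S = {(v, w). v \<in> T \<and> w + S v \<in> orthogonal_space G T}"

definition conjugate_instant ::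
  "real \<Rightarrow> real \<Rightarrow> (real \<Rightarrow> ('e::euclidean_space \<times> 'e) set) \<Rightarrow> real \<Rightarrow> bool" where
  "conjugate_instant a b l t \<longleftrightarrow> t \<in> {a<..b} \<and> l t \<inter> point_lagrangian \<noteq> {0}"

definition focal_instant ::
  "real \<Rightarrow> real \<Rightarrow> (real \<Rightarrow> ('e::euclidean_space \<times> 'e) set) \<Rightarrow> ('e \<times> 'e) set \<Rightarrow> real \<Rightarrow> bool" where
  "focal_instant a b l LP t \<longleftrightarrow> t \<in> {a<..b} \<and> l t \<inter> LP \<noteq> {0}"

end

theory Submission
  imports Defs
begin

text \<open>
  Suppose that there is no conjugate instant in \<open>]a, b]\<close>.  Then \<open>l t\<close> is the graph of a
  \<open>g\<close>-symmetric map \<open>B t\<close> for \<open>t \<in> ]a, b]\<close>, and \<open>(t - a) B t\<close> tends to \<open>- id\<close> as \<open>t\<close> tends to \<open>a\<close>,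
  so that no eigenvalue of any \<open>B t\<close> exceeds some constant.  Hence, for all large \<open>\<kappa>\<close>, the graph of
  \<open>\<kappa> id\<close> is a Lagrangian transverse to every \<open>l t\<close> and to \<open>LP\<close>: the whole path lies in a single chart
  and \<open>\<mu> (a + \<epsilon>) b l = n\<^sub>+(\<phi> b) - n\<^sub>+(\<phi> (a + \<epsilon>))\<close>, where \<open>\<phi> t\<close> is the chart form on \<open>LP\<close>.
  On the normal vectors of \<open>P\<close> the forms \<open>\<phi> b\<close> and \<open>\<phi> (a + \<epsilon>)\<close> have the signature of \<open>g\<close> if \<open>\<kappa>\<close> is large,
  whence \<open>\<mu> \<le> dim P\<close>.  For \<open>t\<close> near \<open>a\<close> the form \<open>\<phi> t\<close> has at least the index of \<open>- g\<close> on \<open>T\<close> plus that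
  of \<open>g\<close> on the normal vectors; since \<open>\<phi> t\<close> is nondegenerate unless \<open>t\<close> is focal, this persists up to
  \<open>a + \<epsilon>\<close>, whence \<open>\<mu> \<ge> - n\<^sub>-(g, P)\<close>.
\<close>

section \<open>Index of symmetric bilinear forms\<close>

text \<open>At \<open>t = a\<close> the Lagrangian is \<open>{0} \<times> UNIV\<close>, so
  \<open>B t\<close> blows up there and compactness alone cannot bound its eigenvalues. The blow-up
  is harmless: to first order the Jacobi field with data \<open>(0, w)\<close> is
  \<open>(t - a) w\<close>, the one with data \<open>(v, 0)\<close> tends to \<open>v\<close>, and
  \<open>B t v\<close> is the \<open>w\<close> for which the two cancel; so near \<open>a\<close>
  only large negative real eigenvalues remain possible. As \<open>G\<close> may be indefinite,
  \<open>B t\<close> need not be diagonalizable, and every spectral statement is made through the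
  equation \<open>\<kappa> v = B t v\<close>. With \<open>R = (\<kappa> - B t)^-1\<close> and
  \<open>y (v, w) = \<kappa> v - w\<close>, the chart form is
  \<open>G (R (y x) - fst x) (y x')\<close>. On a normal vector \<open>(0, u)\<close> it is
  \<open>G (R u) u\<close>, about \<open>G u u / \<kappa>\<close>, for every fixed \<open>t\<close>.
  On \<open>(v, - S v)\<close> with \<open>v\<close> in \<open>T\<close> it tends to
  \<open>G ((B t + S) v) v\<close> as \<open>\<kappa>\<close> grows, whose signature is not known at
  a given \<open>t\<close>; only near \<open>a\<close> does \<open>B t\<close> dominate
  \<open>S\<close>. That is why the index at \<open>a + \<epsilon>\<close> is transported from near
  \<open>a\<close> and not computed in place.\<close>

lemma linear_Basis_expand:
  fixes f :: "'a::euclidean_space \<Rightarrow> 'b::real_vector"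
  assumes "linear f"
  shows "f v = (\<Sum>i\<in>Basis. (v \<bullet> i) *\<^sub>R f i)"
proof -
  have "f v = f (\<Sum>i\<in>Basis. (v \<bullet> i) *\<^sub>R i)"
    by (simp add: euclidean_representation)
  also have "\<dots> = (\<Sum>i\<in>Basis. (v \<bullet> i) *\<^sub>R f i)"
    by (simp add: linear_sum[OF assms] linear_scale[OF assms])
  finally show ?thesis .
qed

lemma linear_norm_le:
  fixes f :: "'a::euclidean_space \<Rightarrow> 'b::real_normed_vector"
  assumes "linear f"
  shows "norm (f v) \<le> (\<Sum>i\<in>Basis. norm (f i)) * norm v"
proof -
  have "norm (f v) = norm (\<Sum>i\<in>Basis. (v \<bullet> i) *\<^sub>R f i)"
    by (simp only: linear_Basis_expand[OF assms, of v])
  also have "\<dots> \<le> (\<Sum>i\<in>Basis. norm v * norm (f i))"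
    by (intro order_trans[OF norm_sum] sum_mono) (simp add: mult_right_mono Basis_le_norm)
  finally show ?thesis
    by (simp add: sum_distrib_left mult.commute)
qed

lemma bilinear_Basis_expand:
  fixes B :: "'a::euclidean_space \<Rightarrow> 'b::euclidean_space \<Rightarrow> 'c::real_vector"
  assumes "bilinear B"
  shows "B u v = (\<Sum>i\<in>Basis. \<Sum>j\<in>Basis. ((u \<bullet> i) * (v \<bullet> j)) *\<^sub>R B i j)"
proof -
  have l: "linear (\<lambda>u. B u v)" "linear (B i)" for v i
    using assms by (auto simp: bilinear_def)
  have "B u v = (\<Sum>i\<in>Basis. (u \<bullet> i) *\<^sub>R B i v)"
    by (rule linear_Basis_expand[OF l(1)])
  also have "\<dots> = (\<Sum>i\<in>Basis. (u \<bullet> i) *\<^sub>R (\<Sum>j\<in>Basis. (v \<bullet> j) *\<^sub>R B i j))"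
    by (intro sum.cong refl arg_cong2[where f = scaleR] linear_Basis_expand[OF l(2)])
  finally show ?thesis
    by (simp add: scaleR_sum_right)
qed

lemma n_minus_dims:
  fixes W :: "'v::euclidean_space set"
  shows "finite {dim U | U. subspace U \<and> U \<subseteq> W \<and> (\<forall>u\<in>U. u \<noteq> 0 \<longrightarrow> B u u < (0::real))}"
    (is "finite ?D")
proof (rule finite_subset)
  show "?D \<subseteq> {.. DIM('v)}"
    by (auto intro: dim_subset_UNIV)
qed simp

lemma n_minus_ge:
  assumes "subspace U" "U \<subseteq> W" "\<And>u. u \<in> U \<Longrightarrow> u \<noteq> 0 \<Longrightarrow> B u u < 0"
  shows "dim U \<le> n_minus W B"
  unfolding n_minus_def using assms by (intro Max_ge n_minus_dims) blast

lemma n_minus_attained: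
  assumes "subspace W"
  obtains U where "subspace U" "U \<subseteq> W" "\<And>u. u \<in> U \<Longrightarrow> u \<noteq> 0 \<Longrightarrow> B u u < 0" "dim U = n_minus W B"
proof -
  let ?D = "{dim U | U. subspace U \<and> U \<subseteq> W \<and> (\<forall>u\<in>U. u \<noteq> 0 \<longrightarrow> B u u < (0::real))}"
  have "dim {0::'a} \<in> ?D"
    using subspace_0[OF assms] by (intro CollectI exI[of _ "{0}"]) auto
  hence "Max ?D \<in> ?D"
    by (intro Max_in n_minus_dims) auto
  thus ?thesis
    using that unfolding n_minus_def by auto
qed

lemma n_plus_ge:
  assumes "subspace U" "U \<subseteq> W" "\<And>u. u \<in> U \<Longrightarrow> u \<noteq> 0 \<Longrightarrow> B u u > 0"
  shows "dim U \<le> n_plus W B"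
  unfolding n_plus_def using assms by (intro n_minus_ge) auto

lemma n_plus_attained:
  assumes "subspace W"
  obtains U where "subspace U" "U \<subseteq> W" "\<And>u. u \<in> U \<Longrightarrow> u \<noteq> 0 \<Longrightarrow> B u u > 0" "dim U = n_plus W B"
  using n_minus_attained[OF assms, of "\<lambda>u v. - B u v"] unfolding n_plus_def by auto

lemma dim_add_le_of_trivial_Int:
  fixes U V W :: "'v::euclidean_space set"
  assumes "subspace U" "subspace V" "U \<subseteq> W" "V \<subseteq> W" "subspace W" "U \<inter> V \<subseteq> {0}"
  shows "dim U + dim V \<le> dim W"
proof -
  have "dim (U \<inter> V) = 0"
    using assms(6) by simp
  moreover have "{x + y |x y. x \<in> U \<and> y \<in> V} \<subseteq> W"
    using assms by (auto intro: subspace_add)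
  ultimately show ?thesis
    using dim_sums_Int[OF assms(1,2)] dim_subset[of "{x + y |x y. x \<in> U \<and> y \<in> V}" W] by linarith
qed

text \<open>Definite subspaces of opposite sign meet only in 0, since a common vector would give
  \<open>B u u\<close> both signs.\<close>

lemma n_minus_add_n_plus_le:
  assumes "subspace W"
  shows "n_minus W B + n_plus W B \<le> dim W"
proof -
  obtain U where U: "subspace U" "U \<subseteq> W" "\<And>u. u \<in> U \<Longrightarrow> u \<noteq> 0 \<Longrightarrow> B u u < 0" "dim U = n_minus W B"
    using n_minus_attained[OF assms] by blast
  obtain V where V: "subspace V" "V \<subseteq> W" "\<And>u. u \<in> V \<Longrightarrow> u \<noteq> 0 \<Longrightarrow> B u u > 0" "dim V = n_plus W B"
    using n_plus_attained[OF assms] by blast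
  have "U \<inter> V \<subseteq> {0}"
    using U(3) V(3) by fastforce
  with dim_add_le_of_trivial_Int[OF U(1) V(1) U(2) V(2) assms] U(4) V(4) show ?thesis
    by simp
qed

text \<open>Let \<open>r w\<close> be the element of \<open>N\<close> that represents the functional
  \<open>B w\<close> on \<open>N\<close> through the Euclidean inner product. Nondegeneracy makes
  \<open>r\<close> injective on \<open>N\<close>, hence onto \<open>N\<close> by dimension; so every
  \<open>w\<close> has the same pairing with \<open>N\<close> as some \<open>x\<close> in
  \<open>N\<close>, and \<open>w - x\<close> lies in \<open>M\<close>.\<close>

lemma orthogonal_decomposition:
  fixes B :: "'v::euclidean_space \<Rightarrow> 'v \<Rightarrow> real"
  assumes B: "bilinear B" and W: "subspace W" and N: "subspace N" "N \<subseteq> W"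
    and nd: "nondegenerate_on N B"
  defines "M \<equiv> {w\<in>W. \<forall>v\<in>N. B w v = 0}"
  shows "subspace M" "N \<inter> M = {0}" "\<And>w. w \<in> W \<Longrightarrow> \<exists>x\<in>N. \<exists>y\<in>M. w = x + y" "dim N + dim M = dim W"
proof -
  show M: "subspace M"
    unfolding M_def subspace_def
    using W by (auto simp: subspace_def bilinear_lzero[OF B] bilinear_ladd[OF B] bilinear_lmul[OF B])
  show int: "N \<inter> M = {0}"
    using nd subspace_0[OF N(1)] subspace_0[OF M] unfolding nondegenerate_on_def M_def by auto
  obtain Bs where Bs: "Bs \<subseteq> N" "pairwise orthogonal Bs" "\<And>x. x \<in> Bs \<Longrightarrow> norm x = 1"
      "independent Bs" "span Bs = N"
    using orthonormal_basis_subspace[OF N(1)] by metis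
  have fin: "finite Bs"
    using Bs(4) independent_bound by blast
  define r where "r w = (\<Sum>b\<in>Bs. B w b *\<^sub>R b)" for w
  have lin: "linear r"
    unfolding r_def
    by (intro linear_compose_sum ballI linearI)
      (simp_all add: bilinear_ladd[OF B] bilinear_lmul[OF B] scaleR_left_distrib)
  have rb: "r w \<bullet> b = B w b" if "b \<in> Bs" for w b
  proof -
    have "r w \<bullet> b = (\<Sum>c\<in>Bs. B w c * (c \<bullet> b))"
      by (simp add: r_def inner_sum_left)
    also have "\<dots> = (\<Sum>c\<in>Bs. if c = b then B w b else 0)"
      using Bs(2,3) that
      by (intro sum.cong) (auto simp: pairwise_def orthogonal_def norm_eq_1)
    finally show ?thesis
      using that fin by simp
  qed
  have zero: "\<forall>v\<in>N. B w v = 0" if "r w = 0" for w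
  proof
    fix v assume "v \<in> N"
    hence "v \<in> span Bs"
      using Bs(5) by simp
    thus "B w v = 0"
    proof (induction rule: span_induct)
      case base
      show ?case
        by (auto simp: subspace_def bilinear_rzero[OF B] bilinear_radd[OF B] bilinear_rmul[OF B])
    next
      case (step x)
      thus ?case
        using rb[of x w] that by simp
    qed
  qed
  have inj: "inj_on r (span N)"
    unfolding span_eq_iff[THEN iffD2, OF N(1)]
  proof (subst linear_inj_on_iff_eq_0[OF lin N(1)], intro ballI impI)
    fix x assume "x \<in> N" "r x = 0"
    thus "x = 0"
      using zero[of x] nd unfolding nondegenerate_on_def by blast
  qed
  have "r w \<in> N" for w
    unfolding r_def using Bs(1) by (intro subspace_sum[OF N(1)] subspace_scale[OF N(1)]) auto
  hence "r ` N \<subseteq> N"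
    by auto
  moreover have "dim (r ` N) = dim N"
    by (rule dim_image_eq[OF lin inj])
  ultimately have surj: "r ` N = N"
    using linear_subspace_image[OF lin N(1)] N(1) by (metis order_refl subspace_dim_equal)
  show dec: "\<exists>x\<in>N. \<exists>y\<in>M. w = x + y" if "w \<in> W" for w
  proof -
    obtain x where x: "x \<in> N" "r x = r w"
      using surj \<open>\<And>w. r w \<in> N\<close> by (metis imageE)
    hence "r (w - x) = 0"
      by (simp add: linear_diff[OF lin])
    hence "w - x \<in> M"
      unfolding M_def using zero N(2) x(1) that W by (auto intro: subspace_diff)
    thus ?thesis
      using x(1) by (metis add.commute diff_add_cancel)
  qed
  have "{x + y |x y. x \<in> N \<and> y \<in> M} = W"
  proof
    show "{x + y |x y. x \<in> N \<and> y \<in> M} \<subseteq> W"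
      using N(2) W by (auto simp: M_def intro: subspace_add)
    show "W \<subseteq> {x + y |x y. x \<in> N \<and> y \<in> M}"
      using dec by blast
  qed
  thus "dim N + dim M = dim W"
    using dim_sums_Int[OF N(1) M] int by simp
qed

text \<open>The orthogonal complement of a maximal negative definite \<open>N\<close> carries no
  negative vector, since such a vector would enlarge \<open>N\<close>. A null vector of a positive
  semidefinite symmetric form lies in its radical, so by nondegeneracy the complement is positive
  definite.\<close>

lemma sylvester:
  fixes B :: "'v::euclidean_space \<Rightarrow> 'v \<Rightarrow> real"
  assumes B: "bilinear B" and W: "subspace W" and sym: "\<And>u v. u \<in> W \<Longrightarrow> v \<in> W \<Longrightarrow> B u v = B v u"
    and nd: "nondegenerate_on W B"
  shows "n_minus W B + n_plus W B = dim W"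
proof -
  obtain N where N: "subspace N" "N \<subseteq> W" "\<And>u. u \<in> N \<Longrightarrow> u \<noteq> 0 \<Longrightarrow> B u u < 0" "dim N = n_minus W B"
    using n_minus_attained[OF W] by blast
  define M where "M = {w\<in>W. \<forall>v\<in>N. B w v = 0}"
  have ndN: "nondegenerate_on N B"
    using N(3) unfolding nondegenerate_on_def by force
  note dec = orthogonal_decomposition[OF B W N(1,2) ndN, folded M_def]
  have MW: "M \<subseteq> W"
    unfolding M_def by auto
  have psd: "B m m \<ge> 0" if "m \<in> M" for m
  proof (rule ccontr)
    assume neg: "\<not> B m m \<ge> 0"
    define N' where "N' = {x + y |x y. x \<in> N \<and> y \<in> span {m}}"
    have m: "m \<in> W" "\<And>v. v \<in> N \<Longrightarrow> B m v = 0"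
      using that unfolding M_def by auto
    have m': "B v m = 0" if "v \<in> N" for v
      using m sym[of v m] that N(2) by auto
    have "m \<noteq> 0"
      using neg by (auto simp: bilinear_lzero[OF B])
    have sub: "subspace N'"
      unfolding N'_def by (rule subspace_sums[OF N(1) subspace_span])
    have "span {m} \<subseteq> M"
      using span_minimal[OF _ dec(1)] that by simp
    hence "N \<inter> span {m} = {0}"
      using dec(2) subspace_0[OF N(1)] span_0[of "{m}"] by blast
    hence "dim N' = dim N + 1"
      using dim_sums_Int[OF N(1) subspace_span[of "{m}"]] \<open>m \<noteq> 0\<close>
      by (simp add: N'_def)
    moreover have "dim N' \<le> n_minus W B"
    proof (rule n_minus_ge[OF sub])
      show "N' \<subseteq> W"
        using N(2) m(1) W by (auto simp: N'_def span_singleton intro!: subspace_add subspace_scale)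
      fix u assume u: "u \<in> N'" "u \<noteq> 0"
      then obtain x r where xr: "x \<in> N" "u = x + r *\<^sub>R m"
        by (auto simp: N'_def span_singleton)
      have "B u u = B x x + r\<^sup>2 * B m m"
        using m m' xr(1)
        by (simp add: xr(2) bilinear_ladd[OF B] bilinear_radd[OF B] bilinear_lmul[OF B]
            bilinear_rmul[OF B] power2_eq_square)
      moreover have "B x x \<le> 0" "x \<noteq> 0 \<Longrightarrow> B x x < 0"
        using N(3)[OF xr(1)] by (cases "x = 0"; force simp: bilinear_lzero[OF B])+
      moreover have "r\<^sup>2 * B m m \<le> 0" "r \<noteq> 0 \<Longrightarrow> r\<^sup>2 * B m m < 0"
        using neg by (auto simp: mult_le_0_iff mult_less_0_iff)
      moreover have "x \<noteq> 0 \<or> r \<noteq> 0"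
        using u(2) xr(2) by auto
      ultimately show "B u u < 0"
        by linarith
    qed
    ultimately show False
      using N(4) by simp
  qed
  have pd: "B m m > 0" if m: "m \<in> M" "m \<noteq> 0" for m
  proof (rule ccontr)
    assume "\<not> B m m > 0"
    hence 0: "B m m = 0"
      using psd[OF m(1)] by simp
    have "B m v = 0" if v: "v \<in> M" for v
    proof (rule ccontr)
      assume nz: "B m v \<noteq> 0"
      \<comment> \<open>This \<open>s\<close> makes \<open>2 * s * B m v + B v v\<close> equal to
        -1: a null vector that pairs nontrivially with \<open>v\<close> would produce a negative
        one.\<close>
      define s where "s = - (B v v + 1) / (2 * B m v)"
      have "s *\<^sub>R m + v \<in> M"
        using dec(1) m(1) v by (intro subspace_add subspace_scale)
      hence "0 \<le> B (s *\<^sub>R m + v) (s *\<^sub>R m + v)"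
        by (rule psd)
      also have "\<dots> = 2 * s * B m v + B v v"
        using 0 sym[of v m] m(1) v MW
        by (auto simp: bilinear_ladd[OF B] bilinear_radd[OF B] bilinear_lmul[OF B]
            bilinear_rmul[OF B])
      also have "\<dots> = -1"
        using nz by (simp add: s_def field_simps)
      finally show False
        by simp
    qed
    moreover have "B m v = 0" if "v \<in> N" for v
      using m(1) that unfolding M_def by auto
    ultimately have "B m w = 0" if "w \<in> W" for w
      using dec(3)[OF that] by (auto simp: bilinear_radd[OF B])
    thus False
      using nd m MW unfolding nondegenerate_on_def by blast
  qed
  have "dim M \<le> n_plus W B"
    by (rule n_plus_ge[OF dec(1) MW pd])
  with dec(4) N(4) n_minus_add_n_plus_le[OF W, of B] show ?thesis
    by linarith
qed

section \<open>Pointwise limits of linear maps and forms\<close>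

lemma tendsto_linear_apply:
  fixes D :: "'c \<Rightarrow> 'a::euclidean_space \<Rightarrow> 'b::real_normed_vector"
  assumes "\<forall>\<^sub>F t in F. linear (D t)" "linear D0" "\<And>v. ((\<lambda>t. D t v) \<longlongrightarrow> D0 v) F" "(x \<longlongrightarrow> x0) F"
  shows "((\<lambda>t. D t (x t)) \<longlongrightarrow> D0 x0) F"
proof -
  have "((\<lambda>t. \<Sum>i\<in>Basis. (x t \<bullet> i) *\<^sub>R D t i) \<longlongrightarrow> (\<Sum>i\<in>Basis. (x0 \<bullet> i) *\<^sub>R D0 i)) F"
    by (intro tendsto_intros assms)
  moreover have "\<forall>\<^sub>F t in F. (\<Sum>i\<in>Basis. (x t \<bullet> i) *\<^sub>R D t i) = D t (x t)"
    using assms(1) by eventually_elim (simp add: linear_Basis_expand[symmetric])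
  ultimately have "((\<lambda>t. D t (x t)) \<longlongrightarrow> (\<Sum>i\<in>Basis. (x0 \<bullet> i) *\<^sub>R D0 i)) F"
    by (rule Lim_transform_eventually)
  thus ?thesis
    by (simp only: linear_Basis_expand[OF assms(2), of x0])
qed

lemma eventually_linear_close:
  fixes D :: "'c \<Rightarrow> 'a::euclidean_space \<Rightarrow> 'b::real_normed_vector"
  assumes lin: "\<forall>\<^sub>F t in F. linear (D t)" and lin0: "linear D0"
    and lim: "\<And>v. ((\<lambda>t. D t v) \<longlongrightarrow> D0 v) F" and e: "e > 0"
  shows "\<forall>\<^sub>F t in F. \<forall>v. norm (D t v - D0 v) \<le> e * norm v"
proof -
  have "((\<lambda>t. \<Sum>i\<in>Basis. norm (D t i - D0 i)) \<longlongrightarrow> (\<Sum>i\<in>Basis. norm (D0 i - D0 i))) F"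
    by (intro tendsto_intros lim)
  hence "\<forall>\<^sub>F t in F. (\<Sum>i\<in>Basis. norm (D t i - D0 i)) < e"
    by (rule order_tendstoD) (simp add: e)
  with lin show ?thesis
  proof eventually_elim
    case (elim t)
    show ?case
    proof
      fix v
      have "norm (D t v - D0 v) \<le> (\<Sum>i\<in>Basis. norm (D t i - D0 i)) * norm v"
        by (rule linear_norm_le[OF linear_compose_sub[OF elim(1) lin0]])
      also have "\<dots> \<le> e * norm v"
        using elim(2) by (intro mult_right_mono) auto
      finally show "norm (D t v - D0 v) \<le> e * norm v" .
    qed
  qed
qed

lemma eventually_linear_bounded_below:
  fixes D :: "'c \<Rightarrow> 'a::euclidean_space \<Rightarrow> 'b::euclidean_space"
  assumes lin: "\<forall>\<^sub>F t in F. linear (D t)" and lin0: "linear D0" and inj: "inj D0"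
    and lim: "\<And>v. ((\<lambda>t. D t v) \<longlongrightarrow> D0 v) F"
  obtains e where "e > 0" "\<forall>\<^sub>F t in F. \<forall>v. e * norm v \<le> norm (D t v)"
proof -
  obtain e where e: "e > 0" "\<And>v. e * norm v \<le> norm (D0 v)"
    using linear_inj_bounded_below_pos[OF lin0 inj] by blast
  have "\<forall>\<^sub>F t in F. \<forall>v. norm (D t v - D0 v) \<le> e / 2 * norm v"
    by (rule eventually_linear_close[OF lin lin0 lim]) (simp_all add: e)
  hence "\<forall>\<^sub>F t in F. \<forall>v. e / 2 * norm v \<le> norm (D t v)"
  proof eventually_elim
    case (elim t)
    show ?case
    proof
      fix v
      have "norm (D0 v) \<le> norm (D t v) + norm (D t v - D0 v)"
        by (metis add.commute norm_minus_commute norm_triangle_sub)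
      with elim e(2)[of v] show "e / 2 * norm v \<le> norm (D t v)"
        by (smt (verit) field_sum_of_halves distrib_right)
    qed
  qed
  with e(1) that show thesis
    by (metis half_gt_zero)
qed

text \<open>The maps \<open>D t\<close> are eventually bounded below by a uniform constant, so
  \<open>x t - x0\<close> is controlled by \<open>D t (x t) - D t x0\<close>. This stands in for
  continuity of matrix inversion, for projections, resolvents, Christoffel symbols and
  \<open>B t\<close> alike.\<close>

lemma tendsto_linear_preimage:
  fixes D :: "'c \<Rightarrow> 'a::euclidean_space \<Rightarrow> 'b::euclidean_space"
  assumes lin: "\<forall>\<^sub>F t in F. linear (D t)" and lin0: "linear D0" and inj: "inj D0"
    and lim: "\<And>v. ((\<lambda>t. D t v) \<longlongrightarrow> D0 v) F" and x: "((\<lambda>t. D t (x t)) \<longlongrightarrow> D0 x0) F"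
  shows "(x \<longlongrightarrow> x0) F"
proof -
  obtain e where e: "e > 0" "\<forall>\<^sub>F t in F. \<forall>v. e * norm v \<le> norm (D t v)"
    using eventually_linear_bounded_below[OF lin lin0 inj lim] by blast
  have "((\<lambda>t. norm (D t (x t) - D t x0) / e) \<longlongrightarrow> norm (D0 x0 - D0 x0) / e) F"
    using e(1) by (intro tendsto_intros x lim) auto
  hence 0: "((\<lambda>t. norm (D t (x t) - D t x0) / e) \<longlongrightarrow> 0) F"
    by simp
  have "((\<lambda>t. x t - x0) \<longlongrightarrow> 0) F"
  proof (rule Lim_null_comparison[OF _ 0])
    show "\<forall>\<^sub>F t in F. norm (x t - x0) \<le> norm (D t (x t) - D t x0) / e"
      using e(2) lin
    proof eventually_elim
      case (elim t)
      have "e * norm (x t - x0) \<le> norm (D t (x t) - D t x0)"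
        using elim by (metis linear_diff)
      thus ?case
        using e(1) by (simp add: field_simps)
    qed
  qed
  thus ?thesis
    by (simp add: LIM_zero_iff)
qed

text \<open>On the compact unit sphere of \<open>N\<close> the form attains a negative maximum. If
  there are no unit vectors, \<open>N\<close> is \<open>{0}\<close> and \<open>e = 1\<close>
  serves.\<close>

lemma negative_definite_bound:
  fixes B :: "'v::euclidean_space \<Rightarrow> 'v \<Rightarrow> real"
  assumes B: "bilinear B" and N: "subspace N" and neg: "\<And>u. u \<in> N \<Longrightarrow> u \<noteq> 0 \<Longrightarrow> B u u < 0"
  obtains e where "e > 0" "\<And>u. u \<in> N \<Longrightarrow> B u u \<le> - e * (norm u)\<^sup>2"
proof (cases "N \<inter> sphere 0 1 = {}")
  case True
  have "u = 0" if "u \<in> N" for u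
  proof (rule ccontr)
    assume "u \<noteq> 0"
    hence "(1 / norm u) *\<^sub>R u \<in> N \<inter> sphere 0 1"
      using that N by (auto simp: subspace_scale)
    thus False
      using True by blast
  qed
  thus ?thesis
    using that[of 1] by (force simp: bilinear_lzero[OF B])
next
  case False
  have cont: "continuous_on (N \<inter> sphere 0 1) (\<lambda>u. B u u)"
    using bilinear_continuous_on_compose[OF continuous_on_id continuous_on_id B] by simp
  have "compact (N \<inter> sphere 0 1)"
    using closed_subspace[OF N] by (simp add: closed_Int_compact)
  then obtain x where x: "x \<in> N \<inter> sphere 0 1" "\<And>u. u \<in> N \<inter> sphere 0 1 \<Longrightarrow> B u u \<le> B x x"
    using continuous_attains_sup[OF _ False cont] by blast
  have "B x x < 0"
    using x(1) neg[of x] by (cases "x = 0") auto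
  moreover have "B u u \<le> - (- B x x) * (norm u)\<^sup>2" if "u \<in> N" for u
  proof (cases "u = 0")
    case True
    thus ?thesis
      by (simp add: bilinear_lzero[OF B])
  next
    case False
    hence "(1 / norm u) *\<^sub>R u \<in> N \<inter> sphere 0 1"
      using that N by (auto simp: subspace_scale)
    hence "B ((1 / norm u) *\<^sub>R u) ((1 / norm u) *\<^sub>R u) \<le> B x x"
      by (rule x(2))
    thus ?thesis
      using False by (simp add: bilinear_lmul[OF B] bilinear_rmul[OF B] field_simps power2_eq_square)
  qed
  ultimately show ?thesis
    using that[of "- B x x"] by auto
qed

text \<open>The gap \<open>e\<close> below zero on unit vectors of \<open>N\<close> absorbs the
  total deviation of the coefficients from those of \<open>B0\<close>.\<close>

lemma eventually_negative_definite:
  fixes B :: "'c \<Rightarrow> 'v::euclidean_space \<Rightarrow> 'v \<Rightarrow> real"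
  assumes B: "\<forall>\<^sub>F t in F. bilinear (B t)" and B0: "bilinear B0"
    and lim: "\<And>u v. ((\<lambda>t. B t u v) \<longlongrightarrow> B0 u v) F"
    and N: "subspace N" and neg: "\<And>u. u \<in> N \<Longrightarrow> u \<noteq> 0 \<Longrightarrow> B0 u u < 0"
  shows "\<forall>\<^sub>F t in F. \<forall>u\<in>N. u \<noteq> 0 \<longrightarrow> B t u u < 0"
proof -
  obtain e where e: "e > 0" "\<And>u. u \<in> N \<Longrightarrow> B0 u u \<le> - e * (norm u)\<^sup>2"
    using negative_definite_bound[OF B0 N neg] by blast
  have "((\<lambda>t. \<Sum>i\<in>Basis. \<Sum>j\<in>Basis. \<bar>B t i j - B0 i j\<bar>) \<longlongrightarrow>
      (\<Sum>i\<in>Basis. \<Sum>j\<in>Basis. \<bar>B0 i j - B0 i j\<bar>)) F"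
    by (intro tendsto_intros lim)
  hence "\<forall>\<^sub>F t in F. (\<Sum>i\<in>Basis. \<Sum>j\<in>Basis. \<bar>B t i j - B0 i j\<bar>) < e"
    by (rule order_tendstoD) (simp add: e)
  with B show ?thesis
  proof eventually_elim
    case (elim t)
    show ?case
    proof (intro ballI impI)
      fix u assume u: "u \<in> N" "u \<noteq> 0"
      have "B t u u - B0 u u = (\<Sum>i\<in>Basis. \<Sum>j\<in>Basis. (u \<bullet> i) * (u \<bullet> j) * (B t i j - B0 i j))"
        using bilinear_Basis_expand[OF elim(1), of u u] bilinear_Basis_expand[OF B0, of u u]
        by (simp add: sum_subtractf right_diff_distrib)
      also have "\<bar>\<dots>\<bar> \<le> (\<Sum>i\<in>Basis. \<Sum>j\<in>Basis. (norm u)\<^sup>2 * \<bar>B t i j - B0 i j\<bar>)"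
        by (intro order_trans[OF sum_abs] sum_mono)
          (auto simp: abs_mult power2_eq_square intro!: mult_right_mono mult_mono Basis_le_norm)
      also have "\<dots> = (norm u)\<^sup>2 * (\<Sum>i\<in>Basis. \<Sum>j\<in>Basis. \<bar>B t i j - B0 i j\<bar>)"
        by (simp add: sum_distrib_left)
      also have "\<dots> < (norm u)\<^sup>2 * e"
        using elim(2) u(2) by (intro mult_strict_left_mono) auto
      finally show "B t u u < 0"
        using e(2)[OF u(1)] by (simp add: mult.commute)
    qed
  qed
qed

text \<open>A definite subspace stays definite under small perturbations, so near each
  \<open>t\<close> both indices are at least their values at \<open>t\<close>. Their sum is pinned
  to \<open>dim W\<close> by Sylvester's law, so neither can change, and bisection turns local
  constancy into equality at the ends.\<close>

lemma n_minus_constant: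
  fixes B :: "real \<Rightarrow> 'v::euclidean_space \<Rightarrow> 'v \<Rightarrow> real"
  assumes "s \<le> e" and W: "subspace W" and B: "\<And>t. t \<in> {s..e} \<Longrightarrow> bilinear (B t)"
    and sym: "\<And>t u v. t \<in> {s..e} \<Longrightarrow> u \<in> W \<Longrightarrow> v \<in> W \<Longrightarrow> B t u v = B t v u"
    and nd: "\<And>t. t \<in> {s..e} \<Longrightarrow> nondegenerate_on W (B t)"
    and cont: "\<And>u v. continuous_on {s..e} (\<lambda>t. B t u v)"
  shows "n_minus W (B s) = n_minus W (B e)"
proof -
  have near: "\<forall>\<^sub>F r in at t within {s..e}. n_minus W (B r) = n_minus W (B t)" if t: "t \<in> {s..e}" for t
  proof -
    have lim: "((\<lambda>r. B r u v) \<longlongrightarrow> B t u v) (at t within {s..e})" for u v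
      using cont[of u v] t by (simp add: continuous_on_def)
    have ev: "\<forall>\<^sub>F r in at t within {s..e}. r \<in> {s..e}"
      by (simp add: eventually_at_filter)
    hence bil: "\<forall>\<^sub>F r in at t within {s..e}. bilinear (B r)"
      by eventually_elim (rule B)
    hence bil': "\<forall>\<^sub>F r in at t within {s..e}. bilinear (\<lambda>u v. - B r u v)"
      by eventually_elim (simp add: bilinear_def linear_compose_neg)
    obtain N where N: "subspace N" "N \<subseteq> W" "\<And>u. u \<in> N \<Longrightarrow> u \<noteq> 0 \<Longrightarrow> B t u u < 0"
        "dim N = n_minus W (B t)"
      using n_minus_attained[OF W] by blast
    obtain P where P: "subspace P" "P \<subseteq> W" "\<And>u. u \<in> P \<Longrightarrow> u \<noteq> 0 \<Longrightarrow> B t u u > 0"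
        "dim P = n_plus W (B t)"
      using n_plus_attained[OF W] by blast
    have "\<forall>\<^sub>F r in at t within {s..e}. \<forall>u\<in>N. u \<noteq> 0 \<longrightarrow> B r u u < 0"
      by (rule eventually_negative_definite[OF bil B[OF t] lim N(1,3)])
    moreover have "\<forall>\<^sub>F r in at t within {s..e}. \<forall>u\<in>P. u \<noteq> 0 \<longrightarrow> - B r u u < 0"
      using B[OF t] P(3)
      by (intro eventually_negative_definite[OF bil' _ tendsto_minus[OF lim] P(1)])
        (auto simp: bilinear_def linear_compose_neg)
    ultimately show ?thesis
      using ev
    proof eventually_elim
      case (elim r)
      have "dim N \<le> n_minus W (B r)"
        by (rule n_minus_ge[OF N(1,2)]) (use elim(1) in blast)
      moreover have "dim P \<le> n_plus W (B r)"
        by (rule n_plus_ge[OF P(1,2)]) (use elim(2) in simp)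
      moreover note N(4) P(4) sylvester[OF B[OF t] W sym[OF t] nd[OF t]]
        sylvester[OF B[OF elim(3)] W sym[OF elim(3)] nd[OF elim(3)]]
      ultimately show ?case
        by linarith
    qed
  qed
  have "s \<le> s \<and> e \<le> e \<longrightarrow> n_minus W (B s) = n_minus W (B e)"
    using \<open>s \<le> e\<close>
  proof (induction rule: Bolzano[where P = "\<lambda>x y. s \<le> x \<and> y \<le> e \<longrightarrow> n_minus W (B x) = n_minus W (B y)"])
    case (trans x y z)
    thus ?case
      by auto
  next
    case (local x)
    then obtain d where d: "d > 0" "\<And>r. r \<in> {s..e} \<Longrightarrow> r \<noteq> x \<Longrightarrow> dist r x < d \<Longrightarrow> n_minus W (B r) = n_minus W (B x)"
      using near[of x] by (auto simp: eventually_at)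
    have *: "n_minus W (B r) = n_minus W (B x)" if "r \<in> {s..e}" "\<bar>r - x\<bar> < d" for r
      using d(2)[of r] that by (cases "r = x") (auto simp: dist_real_def)
    have "n_minus W (B p) = n_minus W (B q)"
      if "p \<le> x" "x \<le> q" "q - p < d" "s \<le> p" "q \<le> e" for p q
    proof -
      have "n_minus W (B p) = n_minus W (B x)" "n_minus W (B q) = n_minus W (B x)"
        using that by (intro *; simp)+
      thus ?thesis
        by simp
    qed
    with d(1) show ?case
      by blast
  qed
  thus ?thesis
    by simp
qed

section \<open>Paths of graphs in the Lagrangian Grassmannian\<close>

lemma closest_point_subspace:
  fixes L :: "'v::euclidean_space set"
  assumes L: "subspace L" and x: "x \<in> L" and orth: "\<And>y. y \<in> L \<Longrightarrow> (z - x) \<bullet> y = 0"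
  shows "closest_point L z = x"
proof (rule closest_point_unique[symmetric])
  show "\<forall>y\<in>L. dist z x \<le> dist z y"
  proof
    fix y assume "y \<in> L"
    hence "orthogonal (z - x) (x - y)"
      using orth[of "x - y"] x L by (simp add: subspace_diff orthogonal_def)
    hence "(norm (z - x + (x - y)))\<^sup>2 = (norm (z - x))\<^sup>2 + (norm (x - y))\<^sup>2"
      by (rule norm_add_Pythagorean)
    hence "(norm (z - x))\<^sup>2 \<le> (norm (z - y))\<^sup>2"
      by simp
    thus "dist z x \<le> dist z y"
      by (simp add: dist_norm)
  qed
qed (use assms in \<open>simp_all add: subspace_imp_convex closed_subspace\<close>)

text \<open>The orthogonal projection of \<open>z\<close> onto the graph of \<open>B\<close> is
  \<open>(u, B u)\<close>, where \<open>u\<close> solves the normal equation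
  \<open>(id + B* B) u = fst z + B* (snd z)\<close>. The operator \<open>id + B* B\<close> is
  injective for every \<open>B\<close>, so \<open>u\<close> depends continuously on
  \<open>t\<close>.\<close>

lemma lagrangian_path_graph:
  fixes B :: "real \<Rightarrow> 'e::euclidean_space \<Rightarrow> 'e"
  assumes lin: "\<And>t. t \<in> {a..b} \<Longrightarrow> linear (B t)"
    and cont: "\<And>v. continuous_on {a..b} (\<lambda>t. B t v)"
    and l: "\<And>t. t \<in> {a..b} \<Longrightarrow> l t = {(v, w). w = B t v}"
    and lag: "\<And>t. t \<in> {a..b} \<Longrightarrow> lagrangian \<omega> (l t)"
  shows "lagrangian_path \<omega> a b l"
proof -
  \<comment> \<open>The Euclidean adjoint of \<open>B t\<close>, written in coordinates so that its
    continuity in \<open>t\<close> is visible.\<close>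
  define adj where "adj t q = (\<Sum>i\<in>Basis. (q \<bullet> B t i) *\<^sub>R i)" for t q
  have adj: "adj t q \<bullet> v = q \<bullet> B t v" if "t \<in> {a..b}" for t q v
    by (subst linear_Basis_expand[OF lin[OF that], of v])
      (simp add: adj_def inner_sum_left inner_sum_right mult.commute inner_commute)
  have linadj: "linear (adj t)" for t
    unfolding adj_def
    by (intro linear_compose_sum ballI linearI) (simp_all add: inner_add_left scaleR_left_distrib)
  define D where "D t v = v + adj t (B t v)" for t v
  have linD: "linear (D t)" if "t \<in> {a..b}" for t
    unfolding D_def
    using linear_compose[OF lin[OF that] linadj[of t], unfolded o_def]
    by (intro linear_compose_add linear_ident)
  have injD: "inj (D t)" if "t \<in> {a..b}" for t
  proof (subst linear_injective_0[OF linD[OF that]], intro allI impI)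
    fix v assume "D t v = 0"
    hence "D t v \<bullet> v = 0"
      by simp
    hence "v \<bullet> v + B t v \<bullet> B t v = 0"
      by (simp add: D_def inner_add_left adj[OF that])
    thus "v = 0"
      by (metis add_nonneg_eq_0_iff inner_eq_zero_iff inner_ge_zero)
  qed
  define u where "u z t = inv (D t) (fst z + adj t (snd z))" for z t
  have Du: "D t (u z t) = fst z + adj t (snd z)" if "t \<in> {a..b}" for z t
    unfolding u_def using linear_inj_imp_surj[OF linD injD, OF that that]
    by (simp add: surj_f_inv_f)
  have sub: "subspace (l t)" if "t \<in> {a..b}" for t
    using lag[OF that] unfolding lagrangian_def by simp
  have cp: "closest_point (l t) z = (u z t, B t (u z t))" if t: "t \<in> {a..b}" for z t
  proof (rule closest_point_subspace[OF sub[OF t]])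
    show "(u z t, B t (u z t)) \<in> l t"
      by (simp add: l[OF t])
    fix y assume "y \<in> l t"
    then obtain v where y: "y = (v, B t v)"
      by (auto simp: l[OF t])
    have "D t (u z t) \<bullet> v = fst z \<bullet> v + snd z \<bullet> B t v"
      by (simp add: Du[OF t] inner_add_left adj[OF t])
    thus "(z - (u z t, B t (u z t))) \<bullet> y = 0"
      by (cases z) (simp add: y D_def inner_add_left adj[OF t] inner_diff_left)
  qed
  have "continuous_on {a..b} (\<lambda>t. closest_point (l t) z)" for z
  proof -
    have "((\<lambda>t. (u z t, B t (u z t))) \<longlongrightarrow> (u z s, B s (u z s))) (at s within {a..b})"
      if s: "s \<in> {a..b}" for s
    proof -
      have ev: "\<forall>\<^sub>F t in at s within {a..b}. t \<in> {a..b}"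
        by (simp add: eventually_at_filter)
      have limB: "((\<lambda>t. B t v) \<longlongrightarrow> B s v) (at s within {a..b})" for v
        using cont[of v] s by (simp add: continuous_on_def)
      have evB: "\<forall>\<^sub>F t in at s within {a..b}. linear (B t)"
        using ev by eventually_elim (rule lin)
      have limadj: "((\<lambda>t. adj t (q t)) \<longlongrightarrow> adj s q0) (at s within {a..b})"
        if "(q \<longlongrightarrow> q0) (at s within {a..b})" for q q0
        unfolding adj_def by (intro tendsto_intros limB that)
      have limD: "((\<lambda>t. D t v) \<longlongrightarrow> D s v) (at s within {a..b})" for v
        unfolding D_def by (intro tendsto_intros limadj limB)
      have "\<forall>\<^sub>F t in at s within {a..b}. fst z + adj t (snd z) = D t (u z t)"
        using ev by eventually_elim (simp add: Du)
      moreover have "((\<lambda>t. fst z + adj t (snd z)) \<longlongrightarrow> fst z + adj s (snd z)) (at s within {a..b})"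
        by (intro tendsto_intros limadj)
      ultimately have "((\<lambda>t. D t (u z t)) \<longlongrightarrow> fst z + adj s (snd z)) (at s within {a..b})"
        by (rule Lim_transform_eventually[rotated])
      hence limDu: "((\<lambda>t. D t (u z t)) \<longlongrightarrow> D s (u z s)) (at s within {a..b})"
        by (simp add: Du[OF s])
      have "\<forall>\<^sub>F t in at s within {a..b}. linear (D t)"
        using ev by eventually_elim (rule linD)
      hence "(u z \<longlongrightarrow> u z s) (at s within {a..b})"
        using tendsto_linear_preimage[where D = D and x = "u z", OF _ linD[OF s] injD[OF s] limD limDu]
        by blast
      thus ?thesis
        by (intro tendsto_Pair tendsto_linear_apply[OF evB lin[OF s] limB])
    qed
    hence "continuous_on {a..b} (\<lambda>t. (u z t, B t (u z t)))"
      by (simp add: continuous_on_def)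
    thus ?thesis
      by (rule continuous_on_eq) (simp add: cp)
  qed
  \<comment> \<open>The Grassmannian carries the topology pulled back from pointwise convergence of
    projections, so continuity for each \<open>z\<close> suffices.\<close>
  hence "continuous_map (top_of_set {a..b}) euclidean (closest_point \<circ> l)"
    by (auto simp: comp_def intro!: continuous_on_coordinatewise_then_product)
  thus ?thesis
    unfolding lagrangian_path_def lagrangian_grassmannian_def
    by (rule continuous_map_pullback') (use lag in auto)
qed

section \<open>The resolvent of a linear map\<close>

definition resolvent :: "('e::euclidean_space \<Rightarrow> 'e) \<Rightarrow> real \<Rightarrow> 'e \<Rightarrow> 'e" where
  "resolvent B c = inv (\<lambda>v. c *\<^sub>R v - B v)"

lemma
  fixes B :: "'e::euclidean_space \<Rightarrow> 'e"
  assumes B: "linear B" and reg: "\<And>v. c *\<^sub>R v = B v \<Longrightarrow> v = 0"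
  shows resolvent_right: "c *\<^sub>R resolvent B c y - B (resolvent B c y) = y"
    and resolvent_left: "resolvent B c (c *\<^sub>R v - B v) = v"
    and linear_resolvent: "linear (resolvent B c)"
proof -
  let ?D = "\<lambda>v. c *\<^sub>R v - B v"
  have lin: "linear ?D"
    by (intro linear_compose_sub linear_compose_scale_right linear_ident B)
  have inj: "inj ?D"
    using reg by (subst linear_injective_0[OF lin]) auto
  have surj: "surj ?D"
    by (rule linear_inj_imp_surj[OF lin inj])
  show right: "c *\<^sub>R resolvent B c y - B (resolvent B c y) = y" for y
    unfolding resolvent_def using surj_f_inv_f[OF surj, of y] by simp
  show "resolvent B c (c *\<^sub>R v - B v) = v"
    unfolding resolvent_def by (rule inv_f_f[OF inj])
  show "linear (resolvent B c)"
    unfolding resolvent_def by (rule inj_linear_imp_inv_linear[OF lin inj])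
qed

lemma eventually_regular_value:
  fixes B :: "'e::euclidean_space \<Rightarrow> 'e"
  assumes "linear B"
  shows "\<forall>\<^sub>F c in at_top. \<forall>v. c *\<^sub>R v = B v \<longrightarrow> v = 0"
proof -
  obtain K where K: "K > 0" "\<And>v. norm (B v) \<le> norm v * K"
    using linear_conv_bounded_linear assms bounded_linear.pos_bounded by metis
  have "\<forall>\<^sub>F c in at_top. K < c"
    by (rule eventually_gt_at_top)
  thus ?thesis
  proof eventually_elim
    case (elim c)
    show ?case
    proof (intro allI impI)
      fix v assume "c *\<^sub>R v = B v"
      hence "c * norm v \<le> norm v * K"
        using K(2)[of v] elim K(1) by (metis abs_of_pos norm_scaleR order_less_trans)
      thus "v = 0"
        using elim by (simp add: mult.commute mult_le_cancel_right)
    qed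
  qed
qed

text \<open>Since \<open>c R = (id - B / c)^-1\<close>, the leading term of the resolvent at
  infinity is \<open>id / c\<close>: the rescaled solution satisfies an equation whose operator
  tends to the identity.\<close>

lemma tendsto_scaleR_resolvent:
  fixes B :: "'e::euclidean_space \<Rightarrow> 'e"
  assumes B: "linear B"
  shows "((\<lambda>c. c *\<^sub>R resolvent B c y) \<longlongrightarrow> y) at_top"
proof -
  let ?D = "\<lambda>c v. v - (1 / c) *\<^sub>R B v"
  have "\<forall>\<^sub>F c in at_top. y = ?D c (c *\<^sub>R resolvent B c y)"
    using eventually_regular_value[OF B] eventually_gt_at_top[of 0]
  proof eventually_elim
    case (elim c)
    thus ?case
      using resolvent_right[OF B, of c y] by (simp add: linear_scale[OF B])
  qed
  hence lim: "((\<lambda>c. ?D c (c *\<^sub>R resolvent B c y)) \<longlongrightarrow> y) at_top"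
    by (rule Lim_transform_eventually[OF tendsto_const])
  have limD: "((\<lambda>c. ?D c v) \<longlongrightarrow> v) at_top" for v
  proof -
    have "((\<lambda>c::real. 1 / c) \<longlongrightarrow> 0) at_top"
      by (rule tendsto_divide_0[OF tendsto_const filterlim_at_top_imp_at_infinity[OF filterlim_ident]])
    hence "((\<lambda>c. ?D c v) \<longlongrightarrow> v - 0 *\<^sub>R B v) at_top"
      by (intro tendsto_intros)
    thus ?thesis
      by simp
  qed
  have "linear (?D c)" for c
    by (intro linear_compose_sub linear_compose_scale_right linear_ident B)
  hence "\<forall>\<^sub>F c in at_top. linear (?D c)"
    by simp
  from tendsto_linear_preimage[where D = ?D and x = "\<lambda>c. c *\<^sub>R resolvent B c y" and ?D0.0 = "\<lambda>v. v",
      OF this linear_ident inj_on_id2 limD lim]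
  show ?thesis .
qed

lemma bilinear_uminus: "bilinear B \<Longrightarrow> bilinear (\<lambda>u v. - B u v)"
  by (simp add: bilinear_def linear_compose_neg)

lemma bilinear_compose:
  assumes "bilinear B" "linear f" "linear h"
  shows "bilinear (\<lambda>u v. B (f u) (h v))"
  using assms linear_compose[of f "\<lambda>u. B u (h _)"] linear_compose[of h "B (f _)"]
  by (auto simp: bilinear_def o_def)

lemma bilinear_tendsto:
  fixes B :: "'a::euclidean_space \<Rightarrow> 'b::euclidean_space \<Rightarrow> real"
  assumes "bilinear B" "(f \<longlongrightarrow> x) F" "(h \<longlongrightarrow> y) F"
  shows "((\<lambda>t. B (f t) (h t)) \<longlongrightarrow> B x y) F"
  using bounded_bilinear.tendsto[OF bilinear_conv_bounded_bilinear[THEN iffD1, OF assms(1)] assms(2,3)] .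

text \<open>For large \<open>c\<close> the form \<open>g (resolvent B c u) u\<close> is
  \<open>g u u / c\<close> to leading order. Applied with \<open>G\<close> and with
  \<open>- G\<close>, this gives the signature of the chart form on normal vectors.\<close>

lemma eventually_resolvent_negative:
  fixes B :: "'e::euclidean_space \<Rightarrow> 'e"
    and g :: "'e \<Rightarrow> 'e \<Rightarrow> real"
  assumes B: "linear B" and g: "bilinear g" and N: "subspace N"
    and neg: "\<And>u. u \<in> N \<Longrightarrow> u \<noteq> 0 \<Longrightarrow> g u u < 0"
  shows "\<forall>\<^sub>F c in at_top. \<forall>u\<in>N. u \<noteq> 0 \<longrightarrow> g (resolvent B c u) u < 0"
proof -
  have "\<forall>\<^sub>F c in at_top. \<forall>u\<in>N. u \<noteq> 0 \<longrightarrow> g (c *\<^sub>R resolvent B c u) u < 0"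
  proof (rule eventually_negative_definite[where B = "\<lambda>c u v. g (c *\<^sub>R resolvent B c u) v" and ?B0.0 = g])
    show "\<forall>\<^sub>F c in at_top. bilinear (\<lambda>u v. g (c *\<^sub>R resolvent B c u) v)"
      using eventually_regular_value[OF B]
    proof eventually_elim
      case (elim c)
      thus ?case
        using linear_resolvent[OF B, of c]
        by (intro bilinear_compose[OF g, where h = "\<lambda>v. v"] linear_compose_scale_right linear_ident) blast
    qed
    show "((\<lambda>c. g (c *\<^sub>R resolvent B c u) v) \<longlongrightarrow> g u v) at_top" for u v
      by (intro bilinear_tendsto[OF g] tendsto_scaleR_resolvent[OF B] tendsto_const)
  qed (use g N neg in auto)
  with eventually_gt_at_top[of 0] show ?thesis
    by eventually_elim (simp add: bilinear_lmul[OF g] mult_less_0_iff)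
qed

lemma transverseI: "(\<And>x. x \<in> A \<Longrightarrow> x \<in> B \<Longrightarrow> x = 0) \<Longrightarrow> 0 \<in> A \<inter> B \<Longrightarrow> transverse A B"
  by (auto simp: transverse_def)

section \<open>The chart form relative to the Lagrangian of a submanifold\<close>

text \<open>One value \<open>l t\<close> of the path is the graph of \<open>B\<close>; the auxiliary Lagrangian is the graph of
  \<open>\<kappa> \<cdot> id\<close>, where \<open>\<kappa>\<close> is neither an eigenvalue of \<open>B\<close> nor of \<open>-S\<close>.\<close>

locale graph_chart =
  fixes G :: "'e::euclidean_space \<Rightarrow> 'e \<Rightarrow> real" and T :: "'e set" and S B :: "'e \<Rightarrow> 'e" and \<kappa> :: real
  assumes bil: "bilinear G" and sym: "G u v = G v u" and nd: "(\<And>w. G u w = 0) \<Longrightarrow> u = 0"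
    and T: "subspace T" and ndT: "nondegenerate_on T G"
    and linS: "linear S" and ST: "v \<in> T \<Longrightarrow> S v \<in> T"
    and symS: "v \<in> T \<Longrightarrow> w \<in> T \<Longrightarrow> G (S v) w = G v (S w)"
    and linB: "linear B" and symB: "G (B v) w = G v (B w)"
    and regB: "\<kappa> *\<^sub>R v = B v \<Longrightarrow> v = 0"
    and regS: "v \<in> T \<Longrightarrow> \<kappa> *\<^sub>R v + S v = 0 \<Longrightarrow> v = 0"
begin

abbreviation "LP \<equiv> submanifold_lagrangian G T S"
abbreviation "L1 \<equiv> {(v, w). w = \<kappa> *\<^sub>R v}"
abbreviation "L \<equiv> {(v, w). w = B v}"

text \<open>\<open>y x\<close> represents the pairing of \<open>x\<close> with \<open>L1\<close>:
  the symplectic form of \<open>(z, \<kappa> z)\<close> and \<open>x\<close> is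
  \<open>G z (y x)\<close>. The kernel of \<open>y\<close> is \<open>L1\<close>, so injectivity of
  \<open>y\<close> on \<open>LP\<close> expresses transversality.\<close>

definition y :: "'e \<times> 'e \<Rightarrow> 'e" where
  "y x = \<kappa> *\<^sub>R fst x - snd x"

text \<open>Solving \<open>x + (z, \<kappa> z) \<in> L\<close> for \<open>z\<close> gives
  \<open>(\<kappa> - B) (fst x + z) = y x\<close>, so \<open>z\<close> is
  \<open>resolvent B \<kappa> (y x) - fst x\<close>; pairing \<open>(z, \<kappa> z)\<close> with
  \<open>x'\<close> yields this expression for the chart form.\<close>

definition form :: "'e \<times> 'e \<Rightarrow> 'e \<times> 'e \<Rightarrow> real" where
  "form x x' = G (resolvent B \<kappa> (y x) - fst x) (y x')"

lemmas G_simps = bilinear_ladd[OF bil] bilinear_radd[OF bil] bilinear_lmul[OF bil]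
  bilinear_rmul[OF bil] bilinear_lsub[OF bil] bilinear_rsub[OF bil] bilinear_lneg[OF bil]
  bilinear_rneg[OF bil] bilinear_lzero[OF bil] bilinear_rzero[OF bil]

lemma T_perp:
  "subspace (orthogonal_space G T)" "dim T + dim (orthogonal_space G T) = DIM('e)"
  "\<exists>v\<in>T. \<exists>w\<in>orthogonal_space G T. u = v + w"
  "nondegenerate_on (orthogonal_space G T) G"
  "v \<in> T \<Longrightarrow> v \<in> orthogonal_space G T \<Longrightarrow> v = 0"
proof -
  have *: "orthogonal_space G T = {w \<in> UNIV. \<forall>v\<in>T. G w v = 0}"
    by (simp add: orthogonal_space_def)
  note dec = orthogonal_decomposition[OF bil subspace_UNIV T subset_UNIV ndT, folded *]
  show "subspace (orthogonal_space G T)" "dim T + dim (orthogonal_space G T) = DIM('e)"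
    and dec3: "\<exists>v\<in>T. \<exists>w\<in>orthogonal_space G T. u = v + w" for u
    using dec(1,4) dec(3)[of u] by auto
  show "v \<in> T \<Longrightarrow> v \<in> orthogonal_space G T \<Longrightarrow> v = 0"
    using dec(2) by blast
  show "nondegenerate_on (orthogonal_space G T) G"
    unfolding nondegenerate_on_def
  proof (intro ballI impI)
    fix u assume u: "u \<in> orthogonal_space G T" "\<forall>w\<in>orthogonal_space G T. G u w = 0"
    show "u = 0"
    proof (rule nd)
      fix w
      obtain p q where "p \<in> T" "q \<in> orthogonal_space G T" "w = p + q"
        using dec3[of w] by blast
      thus "G u w = 0"
        using u by (simp add: G_simps orthogonal_space_def)
    qed
  qed
qed

lemma R_right: "\<kappa> *\<^sub>R resolvent B \<kappa> u - B (resolvent B \<kappa> u) = u"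
  and R_left: "resolvent B \<kappa> (\<kappa> *\<^sub>R u - B u) = u"
  and linear_R: "linear (resolvent B \<kappa>)"
  using resolvent_right[OF linB, of \<kappa> u] resolvent_left[OF linB, of \<kappa> u]
    linear_resolvent[OF linB, of \<kappa>] regB by blast+

lemma linear_y: "linear y"
  unfolding y_def by (intro linear_compose_sub linear_compose_scale_right linear_fst linear_snd)

lemma mem_LP: "x \<in> LP \<longleftrightarrow> fst x \<in> T \<and> snd x + S (fst x) \<in> orthogonal_space G T"
  by (auto simp: submanifold_lagrangian_def case_prod_beta)

lemma subspace_LP: "subspace LP"
proof -
  have "linear (\<lambda>x. snd x + S (fst x))"
    by (intro linear_compose_add linear_snd linear_compose[OF linear_fst linS, unfolded o_def])
  from linear_subspace_vimage[OF this T_perp(1)] linear_subspace_vimage[OF linear_fst T]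
  have "subspace (fst -` T \<inter> (\<lambda>x. snd x + S (fst x)) -` orthogonal_space G T)"
    by (rule subspace_inter[rotated])
  also have "fst -` T \<inter> (\<lambda>x. snd x + S (fst x)) -` orthogonal_space G T = LP"
    by (auto simp: mem_LP)
  finally show ?thesis .
qed

text \<open>If \<open>y x = 0\<close> with \<open>x\<close> in \<open>LP\<close> and
  \<open>v = fst x\<close>, then \<open>\<kappa> v + S v\<close> lies in \<open>T\<close> and in its
  orthogonal complement, hence vanishes, and so does \<open>v\<close> by the choice of
  \<open>\<kappa>\<close>. Conversely the tangential part of a target is reached through the
  bijection \<open>\<kappa> + S\<close> of \<open>T\<close>, the normal part through the second
  component.\<close>

lemma y_LP_bij: "inj_on y LP" "y ` LP = UNIV"
proof -
  have "x = 0" if x: "x \<in> LP" "y x = 0" for x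
  proof -
    have "snd x + S (fst x) = \<kappa> *\<^sub>R fst x + S (fst x)"
      using x(2) by (simp add: y_def)
    hence "\<kappa> *\<^sub>R fst x + S (fst x) \<in> orthogonal_space G T" "\<kappa> *\<^sub>R fst x + S (fst x) \<in> T"
      using x(1) T ST by (auto simp: mem_LP subspace_add subspace_scale)
    hence "fst x = 0"
      using T_perp(5) regS x(1) mem_LP by blast
    thus ?thesis
      using x(2) by (simp add: y_def prod_eq_iff)
  qed
  thus "inj_on y LP"
    by (subst linear_inj_on_iff_eq_0[OF linear_y subspace_LP]) auto
  let ?f = "\<lambda>v. \<kappa> *\<^sub>R v + S v"
  have linf: "linear ?f"
    by (intro linear_compose_add linear_compose_scale_right linear_ident linS)
  have "?f ` T \<subseteq> T"
    using T ST by (auto intro: subspace_add subspace_scale)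
  moreover have "inj_on ?f (span T)"
    using regS T by (simp add: span_eq_iff[THEN iffD2, OF T] linear_inj_on_iff_eq_0[OF linf T])
  hence "dim (?f ` T) = dim T"
    by (rule dim_image_eq[OF linf])
  ultimately have fT: "?f ` T = T"
    using linear_subspace_image[OF linf T] T by (metis order_refl subspace_dim_equal)
  show "y ` LP = UNIV"
  proof (intro equalityI subset_UNIV subsetI)
    fix u :: 'e
    obtain p q where pq: "p \<in> T" "q \<in> orthogonal_space G T" "u = p + q"
      using T_perp(3) by blast
    then obtain v where v: "v \<in> T" "p = ?f v"
      using fT by blast
    have "(v, - q - S v) \<in> LP"
      using v pq(2) T_perp(1) by (simp add: mem_LP subspace_neg)
    moreover have "y (v, - q - S v) = u"
      using pq v by (simp add: y_def)
    ultimately show "u \<in> y ` LP"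
      by (metis imageI)
  qed
qed

lemma dim_LP: "dim LP = DIM('e)"
proof -
  have "dim (y ` LP) = dim LP"
    using y_LP_bij(1) by (intro dim_image_eq[OF linear_y]) (simp add: span_eq_iff[THEN iffD2, OF subspace_LP])
  thus ?thesis
    by (simp add: y_LP_bij(2))
qed

lemma bilinear_form: "bilinear form"
  unfolding form_def
  using linear_R
  by (intro bilinear_compose[OF bil] linear_compose_sub linear_fst linear_y
      linear_compose[OF linear_y, unfolded o_def]) auto

text \<open>On \<open>LP\<close> the vector \<open>snd x' + S (fst x')\<close> is normal and
  \<open>fst x\<close> is tangent, so \<open>snd x'\<close> may be traded for
  \<open>- S (fst x')\<close> when paired with \<open>fst x\<close>. This separates the resolvent
  term, the only one involving \<open>B\<close>, from a term on \<open>T\<close>.\<close>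

lemma form_LP_0: "form x x' = G (resolvent B \<kappa> (y x)) (y x') - G (fst x) (\<kappa> *\<^sub>R fst x' + S (fst x'))"
  if "x \<in> LP" "x' \<in> LP"
proof -
  have "G (fst x) (snd x' + S (fst x')) = 0"
    using that sym by (auto simp: mem_LP orthogonal_space_def)
  thus ?thesis
    by (simp add: form_def y_def G_simps algebra_simps)
qed

text \<open>The resolvent inherits \<open>G\<close>-symmetry from \<open>B\<close>, and the
  remaining term is symmetric because \<open>S\<close> is \<open>G\<close>-symmetric on
  \<open>T\<close>.\<close>

lemma form_sym: "form x x' = form x' x" if "x \<in> LP" "x' \<in> LP"
proof -
  let ?R = "resolvent B \<kappa>"
  have R: "G (?R u) w = G u (?R w)" for u w
  proof -
    have "G (?R u) w = G (?R u) (\<kappa> *\<^sub>R ?R w - B (?R w))"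
      by (simp only: R_right)
    also have "\<dots> = G (\<kappa> *\<^sub>R ?R u - B (?R u)) (?R w)"
      by (simp add: G_simps symB)
    finally show ?thesis
      by (simp only: R_right)
  qed
  show ?thesis
    using R[of "y x" "y x'"] sym[of "y x"] symS[of "fst x" "fst x'"] sym[of "fst x'"] that
    by (simp add: form_LP_0 that G_simps mem_LP)
qed

text \<open>As \<open>y\<close> maps \<open>LP\<close> onto the whole space, a vector
  \<open>x\<close> in the radical satisfies \<open>resolvent B \<kappa> (y x) = fst x\<close>, which
  says exactly that \<open>x\<close> lies in \<open>L\<close>.\<close>

lemma form_nondegenerate:
  assumes "L \<inter> LP = {0}"
  shows "nondegenerate_on LP form"
  unfolding nondegenerate_on_def
proof (intro ballI impI)
  fix x assume x: "x \<in> LP" "\<forall>x'\<in>LP. form x x' = 0"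
  have "resolvent B \<kappa> (y x) - fst x = 0"
    by (rule nd) (use x(2) y_LP_bij(2) in \<open>auto simp: form_def image_iff set_eq_iff, metis\<close>)
  hence "\<kappa> *\<^sub>R fst x - B (fst x) = y x"
    using R_right[of "y x"] by simp
  hence "x \<in> L"
    by (auto simp: y_def case_prod_beta)
  thus "x = 0"
    using assms x(1) by blast
qed

lemma graph_map_L: "graph_map L1 L x = (resolvent B \<kappa> (y x) - fst x, \<kappa> *\<^sub>R (resolvent B \<kappa> (y x) - fst x))"
  unfolding graph_map_def
proof (rule the_equality)
  let ?r = "resolvent B \<kappa> (y x)"
  have "snd x + \<kappa> *\<^sub>R (?r - fst x) = B ?r"
    using R_right[of "y x"] by (simp add: y_def algebra_simps)
  thus "(?r - fst x, \<kappa> *\<^sub>R (?r - fst x)) \<in> L1 \<and> x + (?r - fst x, \<kappa> *\<^sub>R (?r - fst x)) \<in> L"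
    by (cases x) simp
  fix z assume z: "z \<in> L1 \<and> x + z \<in> L"
  hence "y x = \<kappa> *\<^sub>R (fst x + fst z) - B (fst x + fst z)"
    by (cases x; cases z) (simp add: y_def algebra_simps)
  hence "?r = fst x + fst z"
    by (simp add: R_left)
  thus "z = (?r - fst x, \<kappa> *\<^sub>R (?r - fst x))"
    using z by (cases z) simp
qed

lemma chart_form_L: "chart_form (jacobi_symplectic_form G) L1 L = form"
proof (intro ext)
  fix x x'
  show "chart_form (jacobi_symplectic_form G) L1 L x x' = form x x'"
    by (simp add: chart_form_def graph_map_L jacobi_symplectic_form_def form_def y_def G_simps
        sym[of "fst x'"])
qed

lemma transverse_L1: "transverse LP L1" "transverse L L1"
proof -
  have "x = 0" if "x \<in> LP" "x \<in> L1" for x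
  proof -
    have "y x = 0"
      using that(2) by (cases x) (simp add: y_def)
    thus ?thesis
      using that(1) y_LP_bij(1) unfolding linear_inj_on_iff_eq_0[OF linear_y subspace_LP] by blast
  qed
  moreover have "0 \<in> LP \<inter> L1"
    using subspace_0[OF subspace_LP] by (simp add: zero_prod_def)
  ultimately show "transverse LP L1"
    by (intro transverseI)
  have "x = 0" if "x \<in> L" "x \<in> L1" for x
  proof -
    have "\<kappa> *\<^sub>R fst x = B (fst x)" "snd x = B (fst x)"
      using that by (cases x; simp)+
    thus ?thesis
      using regB[of "fst x"] by (cases x) (simp add: zero_prod_def linear_0[OF linB])
  qed
  moreover have "0 \<in> L \<inter> L1"
    by (simp add: zero_prod_def linear_0[OF linB])
  ultimately show "transverse L L1"
    by (intro transverseI)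
qed

end

section \<open>Bounds for the Maslov index of a path of graphs\<close>

lemma dim_graph:
  fixes f :: "'e::euclidean_space \<Rightarrow> 'e"
  assumes "linear f"
  shows "subspace {(v, w). w = f v}" "dim {(v, w). w = f v} = DIM('e)"
proof -
  have lin: "linear (\<lambda>v. (v, f v))"
    using assms by (intro linearI) (auto simp: linear_add linear_scale)
  have eq: "{(v, w). w = f v} = range (\<lambda>v. (v, f v))"
    by auto
  show "subspace {(v, w). w = f v}"
    unfolding eq by (rule linear_subspace_image[OF lin subspace_UNIV])
  show "dim {(v, w). w = f v} = DIM('e)"
    unfolding eq using dim_image_eq[OF lin, of UNIV] by (simp add: inj_on_def)
qed

lemma lagrangian_graph:
  fixes f :: "'e::euclidean_space \<Rightarrow> 'e"
  assumes "linear f" "\<And>v w. G (f v) w = G v (f w)" "\<And>u v. G u v = G v u"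
  shows "lagrangian (jacobi_symplectic_form G) {(v, w). w = f v}"
  using dim_graph[OF assms(1)] assms(2,3)
  by (auto simp: lagrangian_def jacobi_symplectic_form_def)

text \<open>Let \<open>n = DIM('e)\<close> and let \<open>p\<close> and \<open>m\<close> be the
  positive and negative indices of \<open>G\<close> on the normal space, so
  \<open>p + m = n - dim T\<close>. Normal vectors give \<open>n_plus \<ge> p\<close> and
  \<open>n_minus \<ge> m\<close> for the chart forms at \<open>s\<close> and \<open>b\<close>, so
  \<open>\<mu> \<le> (n - m) - p = dim T\<close>. For the other bound, the index at \<open>s\<close>
  is at least \<open>n_plus T G + m\<close>, so
  \<open>\<mu> \<ge> p - (n - n_plus T G - m) = - n_minus T G\<close>.\<close>

lemma maslov_index_bounds:
  fixes G :: "'e::euclidean_space \<Rightarrow> 'e \<Rightarrow> real" and B :: "real \<Rightarrow> 'e \<Rightarrow> 'e"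
  assumes bil: "bilinear G" and sym: "\<And>u v. G u v = G v u"
    and nd: "\<And>u. (\<And>w. G u w = 0) \<Longrightarrow> u = 0"
    and T: "subspace T" and ndT: "nondegenerate_on T G"
    and linS: "linear S" and ST: "\<And>v. v \<in> T \<Longrightarrow> S v \<in> T"
    and symS: "\<And>v w. v \<in> T \<Longrightarrow> w \<in> T \<Longrightarrow> G (S v) w = G v (S w)"
    and ab: "a < s" "s < b"
    and linB: "\<And>t. t \<in> {a<..b} \<Longrightarrow> linear (B t)"
    and symB: "\<And>t v w. t \<in> {a<..b} \<Longrightarrow> G (B t v) w = G v (B t w)"
    and contB: "\<And>v. continuous_on {a<..b} (\<lambda>t. B t v)"
    and limB: "\<And>v. ((\<lambda>t. (t - a) *\<^sub>R B t v) \<longlongrightarrow> - v) (at_right a)"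
    and l: "\<And>t. t \<in> {a<..b} \<Longrightarrow> l t = {(v, w). w = B t v}"
    and nofocal: "\<And>t. t \<in> {a<..s} \<Longrightarrow> l t \<inter> submanifold_lagrangian G T S = {0}"
    and \<mu>: "is_maslov_index (jacobi_symplectic_form G) (submanifold_lagrangian G T S) \<mu>"
  shows "- int (n_minus T G) \<le> \<mu> s b l" "\<mu> s b l \<le> int (dim T)"
proof -
  let ?LP = "submanifold_lagrangian G T S" and ?\<omega> = "jacobi_symplectic_form G"
  let ?T' = "orthogonal_space G T"
  have ev_a: "\<forall>\<^sub>F t in at_right a. t \<in> {a<..s}"
    using eventually_at_right[OF ab(1)] ab(1) by (metis greaterThanAtMost_iff less_eq_real_def)
  have ev_lin: "\<forall>\<^sub>F t in at_right a. linear (\<lambda>v. (t - a) *\<^sub>R B t v)"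
    using ev_a by eventually_elim (use ab(2) in \<open>auto intro!: linear_compose_scale_right linB\<close>)

  \<comment> \<open>Near \<open>a\<close> the rescaled map \<open>(t - a) B t\<close> is within 1/2
    of \<open>- id\<close>, which rules out \<open>\<kappa> v = B t v\<close> with
    \<open>v \<noteq> 0\<close> for every \<open>\<kappa> > 0\<close>; on the remaining interval
    from \<open>d\<close> to \<open>b\<close>, continuity and compactness bound \<open>B t\<close>
    by \<open>K\<close>.\<close>
  have "\<forall>\<^sub>F t in at_right a. \<forall>v. norm ((t - a) *\<^sub>R B t v - (- v)) \<le> 1 / 2 * norm v"
    by (rule eventually_linear_close[OF ev_lin _ limB]) (auto intro: linear_compose_neg linear_ident)
  with ev_a have "\<forall>\<^sub>F t in at_right a. t \<in> {a<..s} \<and> (\<forall>v. norm ((t - a) *\<^sub>R B t v - (- v)) \<le> 1 / 2 * norm v)"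
    by (rule eventually_conj)
  then obtain d where d: "a < d"
      "\<And>t v. a < t \<Longrightarrow> t < d \<Longrightarrow> t \<le> s \<and> norm ((t - a) *\<^sub>R B t v - (- v)) \<le> 1 / 2 * norm v"
    unfolding eventually_at_right[OF ab(1)] by auto
  have "{d..b} \<subseteq> {a<..b}"
    using d(1) by auto
  hence "continuous_on {d..b} (\<lambda>t. \<Sum>i\<in>Basis. norm (B t i))"
    by (intro continuous_on_sum continuous_on_norm continuous_on_subset[OF contB])
  hence "bounded ((\<lambda>t. \<Sum>i\<in>Basis. norm (B t i)) ` {d..b})"
    by (intro compact_imp_bounded compact_continuous_image compact_Icc)
  then obtain K where K: "\<forall>t\<in>{d..b}. \<bar>\<Sum>i\<in>Basis. norm (B t i)\<bar> \<le> K"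
    unfolding bounded_iff by auto
  have KB: "norm (B t v) \<le> K * norm v" if t: "t \<in> {d..b}" for t v
  proof -
    have "linear (B t)"
      using t d(1) by (intro linB) auto
    hence "norm (B t v) \<le> (\<Sum>i\<in>Basis. norm (B t i)) * norm v"
      by (rule linear_norm_le)
    also have "\<dots> \<le> K * norm v"
      using bspec[OF K t] by (intro mult_right_mono) auto
    finally show ?thesis .
  qed

  have reg: "v = 0" if \<kappa>: "\<kappa> > 0" "\<kappa> > K" and t: "t \<in> {a<..b}" and v: "\<kappa> *\<^sub>R v = B t v" for \<kappa> t v
  proof (cases "t < d")
    case True
    hence "norm ((t - a) *\<^sub>R (\<kappa> *\<^sub>R v) - (- v)) \<le> 1 / 2 * norm v"
      using d(2)[of t v] t v by simp
    moreover have "(t - a) *\<^sub>R (\<kappa> *\<^sub>R v) - (- v) = ((t - a) * \<kappa> + 1) *\<^sub>R v"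
      by (simp add: algebra_simps)
    moreover have "(t - a) * \<kappa> + 1 > 1"
      using t \<kappa>(1) by simp
    ultimately have "((t - a) * \<kappa> + 1) * norm v \<le> 1 / 2 * norm v"
      by simp
    moreover have "1 * norm v \<le> ((t - a) * \<kappa> + 1) * norm v"
      using \<open>(t - a) * \<kappa> + 1 > 1\<close> by (intro mult_right_mono) auto
    ultimately have "norm v \<le> 0"
      by linarith
    thus ?thesis
      by simp
  next
    case False
    hence "norm (\<kappa> *\<^sub>R v) \<le> K * norm v"
      using KB[of t v] t v by simp
    thus ?thesis
      using \<kappa> by (simp add: mult_le_cancel_right)
  qed

  have "subspace ?T'" "dim T + dim ?T' = DIM('e)" "nondegenerate_on ?T' G"
  proof -
    \<comment> \<open>The facts in \<open>T_perp\<close> concern \<open>G\<close> and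
      \<open>T\<close> alone; zero maps and \<open>\<kappa> = 1\<close> satisfy the remaining
      conditions of the locale.\<close>
    have "graph_chart G T (\<lambda>_. 0) (\<lambda>_. 0) 1"
      by (rule graph_chart.intro[OF bil sym nd T ndT])
        (simp_all add: subspace_0[OF T] linear_zero bilinear_lzero[OF bil] bilinear_rzero[OF bil])
    from graph_chart.T_perp(1,2,4)[OF this]
    show "subspace ?T'" "dim T + dim ?T' = DIM('e)" "nondegenerate_on ?T' G" .
  qed
  note T' = this
  have sylT: "n_minus T G + n_plus T G = dim T"
    by (rule sylvester[OF bil T sym ndT])
  have sylT': "n_minus ?T' G + n_plus ?T' G = dim ?T'"
    by (rule sylvester[OF bil T'(1) sym T'(3)])
  obtain P1 where P1: "subspace P1" "P1 \<subseteq> T" "\<And>u. u \<in> P1 \<Longrightarrow> u \<noteq> 0 \<Longrightarrow> G u u > 0" "dim P1 = n_plus T G"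
    using n_plus_attained[OF T] by blast
  obtain P2 where P2: "subspace P2" "P2 \<subseteq> ?T'" "\<And>u. u \<in> P2 \<Longrightarrow> u \<noteq> 0 \<Longrightarrow> G u u > 0" "dim P2 = n_plus ?T' G"
    using n_plus_attained[OF T'(1)] by blast
  obtain N2 where N2: "subspace N2" "N2 \<subseteq> ?T'" "\<And>u. u \<in> N2 \<Longrightarrow> u \<noteq> 0 \<Longrightarrow> G u u < 0" "dim N2 = n_minus ?T' G"
    using n_minus_attained[OF T'(1)] by blast

  \<comment> \<open>The tangential term of the chart form is
    \<open>- G v (\<kappa> v + S v)\<close>; divided by \<open>\<kappa>\<close> it tends to
    \<open>- G v v\<close>, which is negative on \<open>P1\<close>.\<close>
  have ev1: "\<forall>\<^sub>F \<kappa> in at_top. \<forall>u\<in>P1. u \<noteq> 0 \<longrightarrow> - G u (u + (1 / \<kappa>) *\<^sub>R S u) < 0"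
  proof (rule eventually_negative_definite[where B = "\<lambda>\<kappa> u v. - G u (v + (1 / \<kappa>) *\<^sub>R S v)"])
    show "\<forall>\<^sub>F \<kappa> in at_top. bilinear (\<lambda>u v. - G u (v + (1 / \<kappa>) *\<^sub>R S v))"
      by (intro always_eventually allI bilinear_uminus bilinear_compose[OF bil, where f = "\<lambda>v. v"]
          linear_ident linear_compose_add linear_compose_scale_right linS)
    have lim0: "((\<lambda>\<kappa>::real. 1 / \<kappa>) \<longlongrightarrow> 0) at_top"
      by (rule tendsto_divide_0[OF tendsto_const filterlim_at_top_imp_at_infinity[OF filterlim_ident]])
    show "((\<lambda>\<kappa>. - G u (v + (1 / \<kappa>) *\<^sub>R S v)) \<longlongrightarrow> - G u (v + 0 *\<^sub>R S v)) at_top" for u v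
      by (intro tendsto_intros bilinear_tendsto[OF bil] lim0)
    show "- G u (u + 0 *\<^sub>R S u) < 0" if "u \<in> P1" "u \<noteq> 0" for u
      using P1(3)[OF that] by simp
    show "bilinear (\<lambda>u v. - G u (v + 0 *\<^sub>R S v))"
      by (intro bilinear_uminus bilinear_compose[OF bil, where f = "\<lambda>v. v"]
          linear_ident linear_compose_add linear_compose_scale_right linS)
  qed (rule P1(1))
  have linBs: "linear (B s)" "linear (B b)"
    using ab by (auto intro!: linB)
  have evN: "\<forall>\<^sub>F \<kappa> in at_top. \<forall>u\<in>N2. u \<noteq> 0 \<longrightarrow> G (resolvent C \<kappa> u) u < 0" if "linear C" for C
    by (rule eventually_resolvent_negative[OF that bil N2(1)]) (use N2(3) in auto)
  have evP: "\<forall>\<^sub>F \<kappa> in at_top. \<forall>u\<in>P2. u \<noteq> 0 \<longrightarrow> - G (resolvent C \<kappa> u) u < 0" if "linear C" for C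
    by (rule eventually_resolvent_negative[OF that bilinear_uminus[OF bil] P2(1)]) (use P2(3) in auto)
  have "\<forall>\<^sub>F \<kappa> in at_top. \<forall>v. \<kappa> *\<^sub>R v = - S v \<longrightarrow> v = 0"
    by (rule eventually_regular_value[OF linear_compose_neg[OF linS]])
  \<comment> \<open>The sign conditions on normal vectors are imposed at \<open>s\<close> and
    \<open>b\<close> only, so one \<open>\<kappa>\<close> meets them all; regularity along the whole
    path comes from \<open>\<kappa> > K\<close> through \<open>reg\<close>.\<close>
  with ev1 evN[OF linBs(1)] evN[OF linBs(2)] evP[OF linBs(1)] evP[OF linBs(2)]
    eventually_gt_at_top[of 0] eventually_gt_at_top[of K]
  have "\<forall>\<^sub>F \<kappa> in at_top. \<kappa> > 0 \<and> \<kappa> > K \<and> (\<forall>v. \<kappa> *\<^sub>R v = - S v \<longrightarrow> v = 0) \<and>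
      (\<forall>u\<in>P1. u \<noteq> 0 \<longrightarrow> - G u (u + (1 / \<kappa>) *\<^sub>R S u) < 0) \<and>
      (\<forall>t\<in>{s, b}. (\<forall>u\<in>N2. u \<noteq> 0 \<longrightarrow> G (resolvent (B t) \<kappa> u) u < 0) \<and>
         (\<forall>u\<in>P2. u \<noteq> 0 \<longrightarrow> - G (resolvent (B t) \<kappa> u) u < 0))"
    by eventually_elim auto
  from eventually_happens'[OF trivial_limit_at_top_linorder this]
  obtain \<kappa> where *: "\<kappa> > 0 \<and> \<kappa> > K \<and> (\<forall>v. \<kappa> *\<^sub>R v = - S v \<longrightarrow> v = 0) \<and>
      (\<forall>u\<in>P1. u \<noteq> 0 \<longrightarrow> - G u (u + (1 / \<kappa>) *\<^sub>R S u) < 0) \<and>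
      (\<forall>t\<in>{s, b}. (\<forall>u\<in>N2. u \<noteq> 0 \<longrightarrow> G (resolvent (B t) \<kappa> u) u < 0) \<and>
         (\<forall>u\<in>P2. u \<noteq> 0 \<longrightarrow> - G (resolvent (B t) \<kappa> u) u < 0))" ..
  have \<kappa>: "\<kappa> > 0" "\<kappa> > K" "\<And>v. \<kappa> *\<^sub>R v = - S v \<Longrightarrow> v = 0"
      "\<And>u. u \<in> P1 \<Longrightarrow> u \<noteq> 0 \<Longrightarrow> - G u (u + (1 / \<kappa>) *\<^sub>R S u) < 0"
      "\<And>t u. t \<in> {s, b} \<Longrightarrow> u \<in> N2 \<Longrightarrow> u \<noteq> 0 \<Longrightarrow> G (resolvent (B t) \<kappa> u) u < 0"
      "\<And>t u. t \<in> {s, b} \<Longrightarrow> u \<in> P2 \<Longrightarrow> u \<noteq> 0 \<Longrightarrow> - G (resolvent (B t) \<kappa> u) u < 0"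
    using * by blast+
  have gc: "graph_chart G T S (B t) \<kappa>" if "t \<in> {a<..b}" for t
  proof (rule graph_chart.intro[OF bil sym nd T ndT linS ST symS linB[OF that] symB[OF that] reg[OF \<kappa>(1,2) that]])
    show "v = 0" if "\<kappa> *\<^sub>R v + S v = 0" for v
      using \<kappa>(3)[of v] that by (simp add: eq_neg_iff_add_eq_0)
  qed
  define \<phi> where "\<phi> t = graph_chart.form G (B t) \<kappa>" for t
  let ?R = "\<lambda>t. resolvent (B t) \<kappa>"
  have s: "s \<in> {a<..b}" "b \<in> {a<..b}" "s \<in> {s, b}" "b \<in> {s, b}"
    using ab by auto
  note LP = graph_chart.subspace_LP[OF gc[OF s(1)]] graph_chart.dim_LP[OF gc[OF s(1)]]
    graph_chart.mem_LP[OF gc[OF s(1)]]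

  have \<mu>eq: "\<mu> s b l = int (n_plus ?LP (\<phi> b)) - int (n_plus ?LP (\<phi> s))"
  proof -
    let ?L1 = "{(v, w). w = \<kappa> *\<^sub>R v}"
    have "lagrangian ?\<omega> (l t)" if "t \<in> {s..b}" for t
    proof -
      have t: "t \<in> {a<..b}"
        using that ab by auto
      show ?thesis
        unfolding l[OF t] using symB[OF t] sym by (intro lagrangian_graph linB[OF t]) auto
    qed
    hence path: "lagrangian_path ?\<omega> s b l"
      using ab by (intro lagrangian_path_graph[of s b B])
        (auto intro!: linB l continuous_on_subset[OF contB])
    have lag1: "lagrangian ?\<omega> ?L1"
      using sym by (intro lagrangian_graph linear_compose_scale_right linear_ident)
        (auto simp: bilinear_lmul[OF bil] bilinear_rmul[OF bil])
    have tr: "\<forall>t\<in>{s..b}. transverse (l t) ?L1"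
    proof
      fix t assume "t \<in> {s..b}"
      hence t: "t \<in> {a<..b}"
        using ab by auto
      show "transverse (l t) ?L1"
        unfolding l[OF t] by (rule graph_chart.transverse_L1(2)[OF gc[OF t]])
    qed
    have chart: "chart_form ?\<omega> ?L1 (l t) = \<phi> t" if "t \<in> {a<..b}" for t
      unfolding l[OF that] \<phi>_def by (rule graph_chart.chart_form_L[OF gc[OF that]])
    show ?thesis
      using \<mu> ab path lag1 tr graph_chart.transverse_L1(1)[OF gc[OF s(1)]]
      unfolding is_maslov_index_def chart[OF s(1), symmetric] chart[OF s(2), symmetric]
      by blast
  qed

  have \<phi>0: "\<phi> t (0, u) (0, u) = G (?R t u) u" if "t \<in> {a<..b}" for t u
    using linear_neg[OF graph_chart.linear_R[OF gc[OF that]], of u]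
    by (simp add: \<phi>_def graph_chart.form_def[OF gc[OF that]] graph_chart.y_def[OF gc[OF that]]
        bilinear_lneg[OF bil] bilinear_rneg[OF bil])
  have emb: "subspace (Pair (0::'e) ` U)" "dim (Pair (0::'e) ` U) = dim U" "Pair (0::'e) ` U \<subseteq> ?LP"
    if "subspace U" "U \<subseteq> ?T'" for U
  proof -
    have lin: "linear (Pair (0::'e) :: 'e \<Rightarrow> _)"
      by (intro linearI) auto
    show "subspace (Pair (0::'e) ` U)"
      by (rule linear_subspace_image[OF lin that(1)])
    show "dim (Pair (0::'e) ` U) = dim U"
      by (rule dim_image_eq[OF lin]) (simp add: inj_on_def)
    show "Pair (0::'e) ` U \<subseteq> ?LP"
      using that(2) subspace_0[OF T] by (auto simp: LP(3) linear_0[OF linS])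
  qed
  have pos: "dim P2 \<le> n_plus ?LP (\<phi> t)" if t: "t \<in> {s, b}" for t
  proof -
    have "dim (Pair (0::'e) ` P2) \<le> n_plus ?LP (\<phi> t)"
    proof (rule n_plus_ge[OF emb(1,3)[OF P2(1,2)]])
      fix z :: "'e \<times> 'e"
      assume z: "z \<in> Pair 0 ` P2" "z \<noteq> 0"
      then obtain u where u: "u \<in> P2" "z = (0, u)" "u \<noteq> 0"
        by (auto simp: zero_prod_def)
      have "t \<in> {a<..b}"
        using t ab by auto
      with \<kappa>(6)[OF t u(1,3)] show "\<phi> t z z > 0"
        by (simp add: u(2) \<phi>0)
    qed
    thus ?thesis
      by (simp add: emb(2)[OF P2(1,2)])
  qed
  have neg: "dim N2 \<le> n_minus ?LP (\<phi> t)" if t: "t \<in> {s, b}" for t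
  proof -
    have "dim (Pair (0::'e) ` N2) \<le> n_minus ?LP (\<phi> t)"
    proof (rule n_minus_ge[OF emb(1,3)[OF N2(1,2)]])
      fix z :: "'e \<times> 'e"
      assume z: "z \<in> Pair 0 ` N2" "z \<noteq> 0"
      then obtain u where u: "u \<in> N2" "z = (0, u)" "u \<noteq> 0"
        by (auto simp: zero_prod_def)
      have "t \<in> {a<..b}"
        using t ab by auto
      with \<kappa>(5)[OF t u(1,3)] show "\<phi> t z z < 0"
        by (simp add: u(2) \<phi>0)
    qed
    thus ?thesis
      by (simp add: emb(2)[OF N2(1,2)])
  qed
  have "n_minus ?LP (\<phi> b) + n_plus ?LP (\<phi> b) \<le> DIM('e)"
    using n_minus_add_n_plus_le[OF LP(1), of "\<phi> b"] LP(2) by simp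
  \<comment> \<open>The positive index at \<open>b\<close> is at most
    \<open>DIM('e) - dim N2\<close>, the one at \<open>s\<close> at least \<open>dim P2\<close>;
    what remains is the dimension of \<open>T\<close>.\<close>
  with \<mu>eq pos[OF s(3)] neg[OF s(4)] P2(4) N2(4) sylT' T'(2)
  show "\<mu> s b l \<le> int (dim T)"
    by linarith

  text \<open>As \<open>t\<close> tends to \<open>a\<close>, the form \<open>\<phi> t\<close> degenerates on the normal directions at the rate
    \<open>t - a\<close>; rescaling these directions by \<open>1 / sqrt (t - a)\<close> gives a nondegenerate limit.\<close>
  define q where "q t x = sqrt (t - a) *\<^sub>R (\<kappa> *\<^sub>R fst x + S (fst x)) - snd x" for t and x :: "'e \<times> 'e"
  define \<psi> where "\<psi> t x x' = G ((1 / (t - a)) *\<^sub>R ?R t (q t x)) (q t x') - G (fst x) (\<kappa> *\<^sub>R fst x' + S (fst x'))"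
    for t and x x' :: "'e \<times> 'e"
  define \<psi>0 where "\<psi>0 x x' = G (snd x) (snd x') - G (fst x) (\<kappa> *\<^sub>R fst x' + S (fst x'))"
    for x x' :: "'e \<times> 'e"
  have lin\<kappa>S: "linear (\<lambda>x :: 'e \<times> 'e. \<kappa> *\<^sub>R fst x + S (fst x))"
    by (intro linear_compose_add linear_compose_scale_right linear_fst
        linear_compose[OF linear_fst linS, unfolded o_def])
  have linq: "linear (q t)" for t
    unfolding q_def by (intro linear_compose_sub linear_compose_scale_right lin\<kappa>S linear_snd)
  have bil_diff: "bilinear (\<lambda>u v. B1 u v - B2 u v)"
    if "bilinear B1" "bilinear B2" for B1 B2 :: "'e \<times> 'e \<Rightarrow> 'e \<times> 'e \<Rightarrow> real"
    using that by (simp add: bilinear_def linear_compose_sub)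
  have bil\<psi>0: "bilinear \<psi>0"
    unfolding \<psi>0_def
    by (intro bil_diff bilinear_compose[OF bil] linear_fst linear_snd lin\<kappa>S)
  have bil\<psi>: "\<forall>\<^sub>F t in at_right a. bilinear (\<psi> t)"
    using ev_a
  proof eventually_elim
    case (elim t)
    hence t: "t \<in> {a<..b}"
      using ab by auto
    show ?case
      unfolding \<psi>_def
      by (intro bil_diff bilinear_compose[OF bil] linear_fst lin\<kappa>S linq linear_compose_scale_right
          linear_compose[OF linq graph_chart.linear_R[OF gc[OF t]], unfolded o_def])
  qed
  have lim\<psi>: "((\<lambda>t. \<psi> t x x') \<longlongrightarrow> \<psi>0 x x') (at_right a)" for x x'
  proof -
    have t0: "((\<lambda>t. t - a) \<longlongrightarrow> a - a) (at_right a)"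
      by (intro tendsto_intros)
    hence "((\<lambda>t. sqrt (t - a)) \<longlongrightarrow> sqrt (a - a)) (at_right a)"
      by (intro tendsto_intros)
    hence "((\<lambda>t. q t x) \<longlongrightarrow> sqrt (a - a) *\<^sub>R (\<kappa> *\<^sub>R fst x + S (fst x)) - snd x) (at_right a)" for x
      unfolding q_def by (intro tendsto_intros)
    hence limq: "((\<lambda>t. q t x) \<longlongrightarrow> - snd x) (at_right a)" for x
      by simp
    let ?D = "\<lambda>t v. (t - a) *\<^sub>R (\<kappa> *\<^sub>R v) - (t - a) *\<^sub>R B t v"
    have limD: "((\<lambda>t. ?D t v) \<longlongrightarrow> v) (at_right a)" for v
    proof -
      have "((\<lambda>t. ?D t v) \<longlongrightarrow> (a - a) *\<^sub>R (\<kappa> *\<^sub>R v) - (- v)) (at_right a)"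
        by (intro tendsto_diff limB tendsto_scaleR t0 tendsto_const)
      thus ?thesis
        by simp
    qed
    have linD: "\<forall>\<^sub>F t in at_right a. linear (?D t)"
      using ev_lin
    proof eventually_elim
      case (elim t)
      show ?case
        by (rule linear_compose_sub[OF _ elim]) (intro linear_compose_scale_right linear_ident)
    qed
    \<comment> \<open>The rescaled vector solves an equation whose operator
      \<open>(t - a) (\<kappa> - B t)\<close> tends to the identity, so it has the same limit as
      \<open>q t x\<close>, namely \<open>- snd x\<close>.\<close>
    have "\<forall>\<^sub>F t in at_right a. q t x = ?D t ((1 / (t - a)) *\<^sub>R ?R t (q t x))"
      using ev_a
    proof eventually_elim
      case (elim t)
      hence t: "t \<in> {a<..b}"
        using ab by auto
      have "q t x = \<kappa> *\<^sub>R ?R t (q t x) - B t (?R t (q t x))"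
        by (rule graph_chart.R_right[OF gc[OF t], symmetric])
      thus ?case
        using t by (simp add: linear_scale[OF linB[OF t]])
    qed
    from Lim_transform_eventually[OF limq this]
    have "((\<lambda>t. (1 / (t - a)) *\<^sub>R ?R t (q t x)) \<longlongrightarrow> - snd x) (at_right a)"
      using tendsto_linear_preimage[where D = ?D and ?D0.0 = "\<lambda>v. v" and x = "\<lambda>t. (1 / (t - a)) *\<^sub>R ?R t (q t x)",
          OF linD linear_ident inj_on_id2 limD] by blast
    hence "((\<lambda>t. \<psi> t x x') \<longlongrightarrow> G (- snd x) (- snd x') - G (fst x) (\<kappa> *\<^sub>R fst x' + S (fst x'))) (at_right a)"
      unfolding \<psi>_def by (intro tendsto_diff bilinear_tendsto[OF bil] limq tendsto_const)
    thus ?thesis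
      by (simp add: \<psi>0_def bilinear_lneg[OF bil] bilinear_rneg[OF bil])
  qed
  \<comment> \<open>The limit form has no cross terms between the two factors: the choice of
    \<open>\<kappa>\<close> makes it negative on \<open>P1\<close>, and on \<open>N2\<close> it is
    \<open>G\<close>.\<close>
  have "\<psi>0 x x < 0" if x: "x \<in> P1 \<times> N2" "x \<noteq> 0" for x
  proof -
    obtain v w where vw: "x = (v, w)" "v \<in> P1" "w \<in> N2"
      using x(1) by blast
    have "G w w \<le> 0" "w \<noteq> 0 \<Longrightarrow> G w w < 0"
      using N2(3)[OF vw(3)] by (cases "w = 0"; force simp: bilinear_lzero[OF bil])+
    moreover have "- G v (\<kappa> *\<^sub>R v + S v) = \<kappa> * - G v (v + (1 / \<kappa>) *\<^sub>R S v)"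
      using \<kappa>(1) by (simp add: bilinear_radd[OF bil] bilinear_rmul[OF bil] field_simps)
    hence "- G v (\<kappa> *\<^sub>R v + S v) < 0" if "v \<noteq> 0"
      using \<kappa>(4)[OF vw(2) that] \<kappa>(1) by (simp only: mult_pos_neg)
    moreover have "- G v (\<kappa> *\<^sub>R v + S v) = 0" if "v = 0"
      using that by (simp add: bilinear_lzero[OF bil])
    moreover have "v \<noteq> 0 \<or> w \<noteq> 0"
      using x(2) vw(1) by (auto simp: zero_prod_def)
    ultimately show ?thesis
      by (cases "v = 0") (auto simp: \<psi>0_def vw(1))
  qed
  from eventually_negative_definite[OF bil\<psi> bil\<psi>0 lim\<psi> subspace_Times[OF P1(1) N2(1)] this]
  have "\<forall>\<^sub>F t in at_right a. \<forall>x\<in>P1 \<times> N2. x \<noteq> 0 \<longrightarrow> \<psi> t x x < 0"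
    by simp
  from eventually_happens'[OF _ eventually_conj[OF ev_a this]]
  obtain r where r: "r \<in> {a<..s}" "\<And>x. x \<in> P1 \<times> N2 \<Longrightarrow> x \<noteq> 0 \<Longrightarrow> \<psi> r x x < 0"
    by auto
  have rb: "r \<in> {a<..b}"
    using r(1) ab by auto
  \<comment> \<open>\<open>h\<close> undoes the rescaling: the normal component is multiplied by
    \<open>1 / sqrt (r - a)\<close>, and the summand \<open>- S (fst x)\<close> puts the pair into
    \<open>LP\<close>. Since \<open>q r x = sqrt (r - a) y (h x)\<close>, the quadratic form of
    \<open>\<phi> r\<close> pulled back by \<open>h\<close> is that of
    \<open>\<psi> r\<close>.\<close>
  define h where "h x = (fst x, (1 / sqrt (r - a)) *\<^sub>R snd x - S (fst x))" for x :: "'e \<times> 'e"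
  have linh: "linear h"
    unfolding h_def
    by (intro linearI) (simp_all add: linear_add[OF linS] linear_scale[OF linS] algebra_simps)
  have injh: "x = x'" if "h x = h x'" for x x'
    using that r(1) by (auto simp: h_def prod_eq_iff)
  have hLP: "h ` (P1 \<times> N2) \<subseteq> ?LP"
  proof (rule image_subsetI)
    fix x assume "x \<in> P1 \<times> N2"
    hence "fst x \<in> T" "snd x \<in> ?T'"
      using P1(2) N2(2) by auto
    thus "h x \<in> ?LP"
      using subspace_scale[OF T'(1)] by (simp add: LP(3) h_def)
  qed
  have "dim (h ` (P1 \<times> N2)) \<le> n_minus ?LP (\<phi> r)"
  proof (rule n_minus_ge[OF linear_subspace_image[OF linh subspace_Times[OF P1(1) N2(1)]] hLP])
    fix z assume z: "z \<in> h ` (P1 \<times> N2)" "z \<noteq> 0"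
    then obtain x where x: "x \<in> P1 \<times> N2" "z = h x"
      by blast
    hence "x \<noteq> 0"
      using z(2) linear_0[OF linh] by auto
    let ?y = "graph_chart.y \<kappa> z"
    have zLP: "z \<in> ?LP"
      using hLP z(1) by blast
    have pos: "r - a > 0" "sqrt (r - a) > 0"
      using r(1) by auto
    have qy: "q r x = sqrt (r - a) *\<^sub>R ?y"
      using pos by (simp add: q_def graph_chart.y_def[OF gc[OF rb]] x(2) h_def algebra_simps)
    have "\<phi> r z z = G (?R r ?y) ?y - G (fst x) (\<kappa> *\<^sub>R fst x + S (fst x))"
      unfolding \<phi>_def using graph_chart.form_LP_0[OF gc[OF rb] zLP zLP] by (simp add: x(2) h_def)
    also have "G (?R r ?y) ?y = G ((1 / (r - a)) *\<^sub>R ?R r (q r x)) (q r x)"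
      using pos unfolding qy
      by (simp add: linear_scale[OF graph_chart.linear_R[OF gc[OF rb]]] bilinear_lmul[OF bil]
          bilinear_rmul[OF bil] flip: power2_eq_square mult.assoc)
    finally show "\<phi> r z z < 0"
      using r(2)[OF x(1) \<open>x \<noteq> 0\<close>] by (simp add: \<psi>_def)
  qed
  moreover have "dim (h ` (P1 \<times> N2)) = dim P1 + dim N2"
    using dim_image_eq[OF linh inj_onI[OF injh], of "P1 \<times> N2"] dim_Times[OF P1(1) N2(1)] by simp
  \<comment> \<open>Absence of focal instants keeps \<open>\<phi> t\<close> nondegenerate from
    \<open>r\<close> to \<open>s\<close>, so the index found at \<open>r\<close> is still present at
    \<open>s\<close>.\<close>
  moreover have "n_minus ?LP (\<phi> r) = n_minus ?LP (\<phi> s)"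
  proof (rule n_minus_constant[OF _ LP(1)])
    show "r \<le> s"
      using r(1) by simp
    fix t assume "t \<in> {r..s}"
    hence t: "t \<in> {a<..s}" "t \<in> {a<..b}"
      using r(1) ab by auto
    show "bilinear (\<phi> t)"
      unfolding \<phi>_def by (rule graph_chart.bilinear_form[OF gc[OF t(2)]])
    show "\<phi> t u v = \<phi> t v u" if "u \<in> ?LP" "v \<in> ?LP" for u v
      unfolding \<phi>_def by (rule graph_chart.form_sym[OF gc[OF t(2)] that])
    show "nondegenerate_on ?LP (\<phi> t)"
      unfolding \<phi>_def using nofocal[OF t(1)] unfolding l[OF t(2)]
      by (rule graph_chart.form_nondegenerate[OF gc[OF t(2)]])
  next
    fix x x' :: "'e \<times> 'e"
    have "((\<lambda>t. \<phi> t x x') \<longlongrightarrow> \<phi> t0 x x') (at t0 within {r..s})" if "t0 \<in> {r..s}" for t0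
    proof -
      have t0: "t0 \<in> {a<..b}"
        using that r(1) ab by auto
      have ev: "\<forall>\<^sub>F t in at t0 within {r..s}. t \<in> {a<..b}"
        using r(1) ab by (auto simp: eventually_at_filter)
      have limB: "((\<lambda>t. B t v) \<longlongrightarrow> B t0 v) (at t0 within {r..s})" for v
      proof -
        have "{r..s} \<subseteq> {a<..b}"
          using r(1) ab by auto
        from continuous_on_subset[OF contB this] that show ?thesis
          by (simp add: continuous_on_def)
      qed
      let ?D = "\<lambda>t v. \<kappa> *\<^sub>R v - B t v"
      have linD: "linear (?D t)" if "t \<in> {a<..b}" for t
        by (intro linear_compose_sub linear_compose_scale_right linear_ident linB that)
      have evD: "\<forall>\<^sub>F t in at t0 within {r..s}. linear (?D t)"
        using ev by eventually_elim (rule linD)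
      have injD: "inj (?D t0)"
        using reg[OF \<kappa>(1,2) t0] by (subst linear_injective_0[OF linD[OF t0]]) auto
      have limD: "((\<lambda>t. ?D t v) \<longlongrightarrow> ?D t0 v) (at t0 within {r..s})" for v
        by (intro tendsto_intros limB)
      have limR: "((\<lambda>t. ?R t u) \<longlongrightarrow> ?R t0 u) (at t0 within {r..s})" for u
      proof -
        have "\<forall>\<^sub>F t in at t0 within {r..s}. ?D t0 (?R t0 u) = ?D t (?R t u)"
          using ev by eventually_elim (simp add: graph_chart.R_right[OF gc] graph_chart.R_right[OF gc[OF t0]])
        from Lim_transform_eventually[OF tendsto_const this]
        show ?thesis
          using tendsto_linear_preimage[where D = ?D and x = "\<lambda>t. ?R t u",
              OF evD linD[OF t0] injD limD] by blast
      qed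
      have "((\<lambda>t. G (?R t (graph_chart.y \<kappa> x) - fst x) (graph_chart.y \<kappa> x')) \<longlongrightarrow>
          G (?R t0 (graph_chart.y \<kappa> x) - fst x) (graph_chart.y \<kappa> x')) (at t0 within {r..s})"
        by (intro bilinear_tendsto[OF bil] tendsto_diff limR tendsto_const)
      moreover have "\<forall>\<^sub>F t in at t0 within {r..s}.
          G (?R t (graph_chart.y \<kappa> x) - fst x) (graph_chart.y \<kappa> x') = \<phi> t x x'"
        using ev by eventually_elim (simp add: \<phi>_def graph_chart.form_def[OF gc])
      ultimately show ?thesis
        unfolding \<phi>_def graph_chart.form_def[OF gc[OF t0]]
        by (rule Lim_transform_eventually[unfolded \<phi>_def])
    qed
    thus "continuous_on {r..s} (\<lambda>t. \<phi> t x x')"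
      by (simp add: continuous_on_def)
  qed
  moreover have "n_minus ?LP (\<phi> s) + n_plus ?LP (\<phi> s) \<le> DIM('e)"
    using n_minus_add_n_plus_le[OF LP(1), of "\<phi> s"] LP(2) by simp
  ultimately show "- int (n_minus T G) \<le> \<mu> s b l"
    using \<mu>eq pos[OF s(4)] P1(4) P2(4) N2(4) sylT sylT' T'(2) by linarith
qed

section \<open>Linear ordinary differential equations on short intervals\<close>

lemma continuous_on_linear_apply:
  fixes M :: "'c::t2_space \<Rightarrow> 'a::euclidean_space \<Rightarrow> 'b::real_normed_vector"
  assumes lin: "\<And>t. t \<in> S \<Longrightarrow> linear (M t)" and cont: "\<And>v. continuous_on S (\<lambda>t. M t v)"
    and f: "continuous_on S f"
  shows "continuous_on S (\<lambda>t. M t (f t))"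
  unfolding continuous_on_def
proof
  fix t assume t: "t \<in> S"
  have "\<forall>\<^sub>F r in at t within S. r \<in> S"
    by (simp add: eventually_at_filter)
  hence "\<forall>\<^sub>F r in at t within S. linear (M r)"
    by eventually_elim (rule lin)
  moreover have "((\<lambda>r. M r v) \<longlongrightarrow> M t v) (at t within S)" for v
    using cont[of v] t by (simp add: continuous_on_def)
  moreover have "(f \<longlongrightarrow> f t) (at t within S)"
    using f t by (simp add: continuous_on_def)
  ultimately show "((\<lambda>t. M t (f t)) \<longlongrightarrow> M t (f t)) (at t within S)"
    by (rule tendsto_linear_apply[OF _ lin[OF t]])
qed

text \<open>Picard iteration: \<open>C * (e - s) \<le> 1 / 2\<close> makes the integral operator a
  contraction with factor 1/2. A linear field is globally Lipschitz, so no invariant ball has to be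
  found and the admissible length of the interval depends on \<open>C\<close> only.\<close>

lemma linear_ode_existence:
  fixes M :: "real \<Rightarrow> 'e::euclidean_space \<Rightarrow> 'e"
  assumes se: "s \<le> e" and lin: "\<And>t. t \<in> {s..e} \<Longrightarrow> linear (M t)"
    and cont: "\<And>v. continuous_on {s..e} (\<lambda>t. M t v)"
    and bound: "\<And>t v. t \<in> {s..e} \<Longrightarrow> norm (M t v) \<le> C * norm v"
    and C: "C \<ge> 0" "C * (e - s) \<le> 1 / 2"
  obtains y where "y s = y0" "\<And>t. t \<in> {s..e} \<Longrightarrow> (y has_vector_derivative M t (y t)) (at t within {s..e})"
proof -
  let ?I = "\<lambda>f t. y0 + integral {s..t} (\<lambda>r. M r (f r))"
  have contM: "continuous_on {s..e} (\<lambda>r. M r (apply_bcontfun f r))" for f :: "real \<Rightarrow>\<^sub>C 'e"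
    by (rule continuous_on_linear_apply[where M = M, OF lin cont continuous_on_apply_bcontfun])
  \<comment> \<open>Clamping the time extends a function on \<open>[s, e]\<close> by constants to
    the whole line, which places the fixed point problem in the complete space of bounded continuous
    functions.\<close>
  have "\<exists>g :: real \<Rightarrow>\<^sub>C 'e. (\<forall>t\<in>{s..e}. apply_bcontfun g t = ?I f t) \<and>
      (\<forall>t. apply_bcontfun g t = ?I f (clamp s e t))" for f :: "real \<Rightarrow>\<^sub>C 'e"
  proof -
    have "continuous_on {s..e} (?I f)"
      by (intro continuous_intros indefinite_integral_continuous_1 integrable_continuous_real contM)
    hence "continuous_on (cbox s e) (?I f)"
      by simp
    thus ?thesis
    proof (rule continuous_on_cbox_bcontfunE)
      fix g :: "real \<Rightarrow>\<^sub>C 'e"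
      assume "\<And>t. t \<in> cbox s e \<Longrightarrow> g t = ?I f t" "\<And>t. g t = ?I f (clamp s e t)"
      thus ?thesis
        by (intro exI[of _ g] conjI ballI allI) simp_all
    qed
  qed
  then obtain \<Phi> :: "(real \<Rightarrow>\<^sub>C 'e) \<Rightarrow> real \<Rightarrow>\<^sub>C 'e"
    where \<Phi>: "\<And>f t. t \<in> {s..e} \<Longrightarrow> \<Phi> f t = ?I f t" "\<And>f t. \<Phi> f t = ?I f (clamp s e t)"
    by metis
  have "dist (\<Phi> f) (\<Phi> g) \<le> 1 / 2 * dist f g" for f g
  proof (rule dist_bound)
    fix x
    define t where "t = clamp s e x"
    have t: "t \<in> {s..e}"
      using clamp_in_interval[of s e x] se by (simp add: t_def)
    have sub: "{s..t} \<subseteq> {s..e}"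
      using t by auto
    have int: "(\<lambda>r. M r (apply_bcontfun f r)) integrable_on {s..t}" for f :: "real \<Rightarrow>\<^sub>C 'e"
      by (intro integrable_continuous_real continuous_on_subset[OF contM sub])
    have "dist (\<Phi> f x) (\<Phi> g x) = norm (?I f t - ?I g t)"
      by (simp add: \<Phi>(2)[of _ x] dist_norm t_def)
    also have "?I f t - ?I g t = integral {s..t} (\<lambda>r. M r (f r) - M r (g r))"
      by (simp add: integral_diff int)
    also have "norm \<dots> \<le> C * dist f g * (t - s)"
    proof (rule integral_bound)
      show "continuous_on {s..t} (\<lambda>r. M r (f r) - M r (g r))"
        by (intro continuous_intros continuous_on_subset[OF contM sub])
      show "norm (M r (f r) - M r (g r)) \<le> C * dist f g" if "r \<in> {s..t}" for r
      proof -
        have r: "r \<in> {s..e}"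
          using that sub by blast
        have "norm (M r (f r) - M r (g r)) = norm (M r (f r - g r))"
          by (simp add: linear_diff[OF lin[OF r]])
        also have "\<dots> \<le> C * dist (f r) (g r)"
          using bound[OF r] by (simp add: dist_norm)
        also have "\<dots> \<le> C * dist f g"
          using C(1) by (intro mult_left_mono dist_bounded)
        finally show ?thesis .
      qed
    qed (use t in simp)
    also have "\<dots> = C * (t - s) * dist f g"
      by simp
    also have "\<dots> \<le> C * (e - s) * dist f g"
      using t C(1) by (intro mult_right_mono mult_left_mono) auto
    also have "\<dots> \<le> 1 / 2 * dist f g"
      using C(2) by (intro mult_right_mono) auto
    finally show "dist (\<Phi> f x) (\<Phi> g x) \<le> 1 / 2 * dist f g" .
  qed
  then obtain y where y: "\<Phi> y = y"
    using banach_fix_type[of "1/2" \<Phi>] by auto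
  have yt: "apply_bcontfun y t = ?I y t" if "t \<in> {s..e}" for t
    using \<Phi>(1)[OF that, of y] by (simp add: y)
  show thesis
  proof
    show "apply_bcontfun y s = y0"
      using yt[of s] se by simp
    fix t assume t: "t \<in> {s..e}"
    have "(?I y has_vector_derivative 0 + M t (y t)) (at t within {s..e})"
      by (intro has_vector_derivative_add has_vector_derivative_const
          integral_has_vector_derivative contM t)
    hence "(?I y has_vector_derivative M t (y t)) (at t within {s..e})"
      by simp
    thus "(apply_bcontfun y has_vector_derivative M t (y t)) (at t within {s..e})"
      by (rule has_vector_derivative_transform[OF t, rotated]) (rule yt)
  qed
qed

text \<open>At a point \<open>m\<close> where \<open>norm (y t)\<close> is maximal, the mean value
  inequality gives \<open>norm (y m) \<le> C * (e - s) * norm (y m)\<close>, at most half of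
  itself.\<close>

lemma linear_ode_uniqueness:
  fixes M :: "real \<Rightarrow> 'e::euclidean_space \<Rightarrow> 'e"
  assumes bound: "\<And>t v. t \<in> {s..e} \<Longrightarrow> norm (M t v) \<le> C * norm v"
    and C: "C \<ge> 0" "C * (e - s) \<le> 1 / 2"
    and y: "y s = 0" "\<And>t. t \<in> {s..e} \<Longrightarrow> (y has_vector_derivative M t (y t)) (at t within {s..e})"
    and t: "t \<in> {s..e}"
  shows "y t = 0"
proof -
  have "continuous_on {s..e} y"
    unfolding continuous_on_eq_continuous_within
    by (intro ballI has_vector_derivative_continuous[OF y(2)])
  hence "continuous_on {s..e} (\<lambda>t. norm (y t))"
    by (intro continuous_intros)
  then obtain m where m: "m \<in> {s..e}" "\<And>t. t \<in> {s..e} \<Longrightarrow> norm (y t) \<le> norm (y m)"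
    using continuous_attains_sup[of "{s..e}" "\<lambda>t. norm (y t)"] t by auto
  have "norm (y m - y s) \<le> C * norm (y m) * norm (m - s)"
  proof (rule differentiable_bound[of "{s..e}" y "\<lambda>t h. h *\<^sub>R M t (y t)"])
    fix r assume r: "r \<in> {s..e}"
    show "(y has_derivative (\<lambda>h. h *\<^sub>R M r (y r))) (at r within {s..e})"
      using y(2)[OF r] by (simp add: has_vector_derivative_def)
    have "norm (M r (y r)) \<le> C * norm (y m)"
      using bound[OF r, of "y r"] mult_left_mono[OF m(2)[OF r] C(1)] by linarith
    thus "onorm (\<lambda>h. h *\<^sub>R M r (y r)) \<le> C * norm (y m)"
      by (simp add: onorm_scaleR_left onorm_id mult_left_mono mult.commute bounded_linear_ident)
  qed (use m(1) t in auto)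
  also have "\<dots> = C * (m - s) * norm (y m)"
    using m(1) by simp
  also have "\<dots> \<le> C * (e - s) * norm (y m)"
    using m(1) C(1) by (intro mult_right_mono mult_left_mono) auto
  also have "\<dots> \<le> 1 / 2 * norm (y m)"
    using C(2) by (intro mult_right_mono) auto
  finally have "norm (y m) \<le> 0"
    using y(1) by simp
  thus ?thesis
    using m(2)[OF t] by (metis norm_le_zero_iff order_trans)
qed

section \<open>Smooth functions\<close>

lemma smooth_on_has_derivative:
  "smooth_on S f \<Longrightarrow> x \<in> S \<Longrightarrow> (f has_derivative frechet_derivative f (at x)) (at x)"
  unfolding smooth_on_def using Ck_on.simps(2) frechet_derivative_works by blast

lemma smooth_on_frechet_derivative:
  "smooth_on S f \<Longrightarrow> smooth_on S (\<lambda>x. frechet_derivative f (at x) v)"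
  unfolding smooth_on_def using Ck_on.simps(2) by blast

lemma smooth_on_continuous: "smooth_on S f \<Longrightarrow> continuous_on S f"
  unfolding smooth_on_def using Ck_on.simps(1) by blast

text \<open>The second difference over a parallelogram is a difference in direction \<open>v\<close>
  of a difference in direction \<open>w\<close>; the mean value theorem, used once for each, turns
  it into a mixed derivative at an intermediate point.\<close>

lemma mixed_difference:
  fixes f :: "'a::real_normed_vector \<Rightarrow> real"
  assumes h: "h > 0" and S: "\<And>p q. p \<in> {0..h} \<Longrightarrow> q \<in> {0..h} \<Longrightarrow> x + p *\<^sub>R v + q *\<^sub>R w \<in> S"
    and f: "\<And>y. y \<in> S \<Longrightarrow> (f has_derivative f' y) (at y)"
    and fv: "\<And>y. y \<in> S \<Longrightarrow> ((\<lambda>y. f' y v) has_derivative fv y) (at y)"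
  obtains p q where "p \<in> {0..h}" "q \<in> {0..h}"
    "f (x + h *\<^sub>R v + h *\<^sub>R w) - f (x + h *\<^sub>R v) - f (x + h *\<^sub>R w) + f x = h\<^sup>2 * fv (x + p *\<^sub>R v + q *\<^sub>R w) w"
proof -
  have lineS: "x + p *\<^sub>R v \<in> S" if "p \<in> {0..h}" for p
    using S[OF that, of 0] h by simp
  let ?A = "\<lambda>p. f (x + p *\<^sub>R v + h *\<^sub>R w) - f (x + p *\<^sub>R v)"
  have A: "(?A has_derivative (\<lambda>r. f' (x + p *\<^sub>R v + h *\<^sub>R w) (r *\<^sub>R v) - f' (x + p *\<^sub>R v) (r *\<^sub>R v))) (at p within {0..h})"
    if "p \<in> {0..h}" for p
    using S[OF that, of h] lineS[OF that] h
    by (intro has_derivative_diff has_derivative_compose[OF _ f] derivative_eq_intros) auto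
  have "\<exists>p\<in>{0<..<h}. ?A h - ?A 0 =
      f' (x + p *\<^sub>R v + h *\<^sub>R w) ((h - 0) *\<^sub>R v) - f' (x + p *\<^sub>R v) ((h - 0) *\<^sub>R v)"
    by (rule mvt_simple[OF h]) (rule A; simp)
  then obtain p where p0: "p \<in> {0<..<h}"
      "?A h - ?A 0 = f' (x + p *\<^sub>R v + h *\<^sub>R w) ((h - 0) *\<^sub>R v) - f' (x + p *\<^sub>R v) ((h - 0) *\<^sub>R v)"
    by blast
  hence p: "p \<in> {0..h}"
      "?A h - ?A 0 = f' (x + p *\<^sub>R v + h *\<^sub>R w) (h *\<^sub>R v) - f' (x + p *\<^sub>R v) (h *\<^sub>R v)"
    by simp_all
  have lin: "f' y (h *\<^sub>R v) = h * f' y v" if "y \<in> S" for y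
    using linear_scale[OF has_derivative_linear[OF f[OF that]]] by simp
  let ?B = "\<lambda>q. f' (x + p *\<^sub>R v + q *\<^sub>R w) v"
  have B: "(?B has_derivative (\<lambda>r. fv (x + p *\<^sub>R v + q *\<^sub>R w) (r *\<^sub>R w))) (at q within {0..h})"
    if "q \<in> {0..h}" for q
    using S[OF p(1) that]
    by (intro has_derivative_compose[OF _ fv] derivative_eq_intros) auto
  have "\<exists>q\<in>{0<..<h}. ?B h - ?B 0 = fv (x + p *\<^sub>R v + q *\<^sub>R w) ((h - 0) *\<^sub>R w)"
    by (rule mvt_simple[OF h]) (rule B; simp)
  then obtain q where q0: "q \<in> {0<..<h}" "?B h - ?B 0 = fv (x + p *\<^sub>R v + q *\<^sub>R w) ((h - 0) *\<^sub>R w)"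
    by blast
  hence q: "q \<in> {0..h}" "?B h - ?B 0 = fv (x + p *\<^sub>R v + q *\<^sub>R w) (h *\<^sub>R w)"
    by simp_all
  have "fv (x + p *\<^sub>R v + q *\<^sub>R w) (h *\<^sub>R w) = h * fv (x + p *\<^sub>R v + q *\<^sub>R w) w"
    using linear_scale[OF has_derivative_linear[OF fv[OF S[OF p(1) q(1)]]]] by simp
  moreover have "?A h - ?A 0 = h * (?B h - ?B 0)"
    using p(2) lin[OF lineS[OF p(1)]] lin[OF S[OF p(1), of h]] h by (simp add: right_diff_distrib)
  ultimately have "?A h - ?A 0 = h\<^sup>2 * fv (x + p *\<^sub>R v + q *\<^sub>R w) w"
    using q(2) by (simp add: power2_eq_square)
  with p(1) q(1) show thesis
    by (intro that[of p q]) auto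
qed

text \<open>The second difference is unchanged when \<open>v\<close> and \<open>w\<close> are
  exchanged, while \<open>mixed_difference\<close> evaluates it by either mixed derivative; by
  continuity both values are close to those at \<open>x\<close> on a small parallelogram.\<close>

lemma mixed_derivatives_real:
  fixes f :: "'a::real_normed_vector \<Rightarrow> real"
  assumes S: "open S" "x \<in> S"
    and f: "\<And>y. y \<in> S \<Longrightarrow> (f has_derivative f' y) (at y)"
    and fv: "\<And>y. y \<in> S \<Longrightarrow> ((\<lambda>y. f' y v) has_derivative fv y) (at y)"
    and fw: "\<And>y. y \<in> S \<Longrightarrow> ((\<lambda>y. f' y w) has_derivative fw y) (at y)"
    and cont: "continuous_on S (\<lambda>y. fv y w)" "continuous_on S (\<lambda>y. fw y v)"
  shows "fv x w = fw x v"
proof (rule ccontr)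
  assume ne: "fv x w \<noteq> fw x v"
  define e where "e = \<bar>fv x w - fw x v\<bar> / 2"
  have e: "e > 0"
    using ne by (simp add: e_def)
  have "\<forall>\<^sub>F y in nhds x. y \<in> S \<and> \<bar>fv y w - fv x w\<bar> < e \<and> \<bar>fw y v - fw x v\<bar> < e"
  proof -
    have "isCont (\<lambda>y. fv y w) x" "isCont (\<lambda>y. fw y v) x"
      using cont S continuous_on_eq_continuous_at by blast+
    hence "((\<lambda>y. fv y w) \<longlongrightarrow> fv x w) (nhds x)" "((\<lambda>y. fw y v) \<longlongrightarrow> fw x v) (nhds x)"
      unfolding isCont_def by (simp_all add: tendsto_at_iff_tendsto_nhds[of "\<lambda>y. fv y w"] tendsto_at_iff_tendsto_nhds[of "\<lambda>y. fw y v"])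
    from this[THEN tendstoD, OF e]
    have "\<forall>\<^sub>F y in nhds x. \<bar>fv y w - fv x w\<bar> < e" "\<forall>\<^sub>F y in nhds x. \<bar>fw y v - fw x v\<bar> < e"
      by (simp_all add: dist_real_def)
    with eventually_nhds_in_open[OF S] show ?thesis
      by eventually_elim auto
  qed
  then obtain d where d: "d > 0" "\<And>y. dist y x < d \<Longrightarrow> y \<in> S \<and> \<bar>fv y w - fv x w\<bar> < e \<and> \<bar>fw y v - fw x v\<bar> < e"
    by (auto simp: eventually_nhds_metric)
  \<comment> \<open>The summand 1 keeps \<open>n\<close> positive when both directions vanish;
    \<open>h = d / n / 2\<close> then fits the whole parallelogram into the ball of radius
    \<open>d\<close>.\<close>
  define n where "n = norm v + norm w + 1"
  have n: "n > 0"
    by (simp add: n_def add_nonneg_pos)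
  define h where "h = d / n / 2"
  have h: "h > 0"
    using d(1) n by (simp add: h_def)
  have small: "dist (x + p *\<^sub>R v + q *\<^sub>R w) x < d" if "p \<in> {0..h}" "q \<in> {0..h}" for p q
  proof -
    have "dist (x + p *\<^sub>R v + q *\<^sub>R w) x = norm (p *\<^sub>R v + q *\<^sub>R w)"
      by (simp add: dist_norm)
    also have "\<dots> \<le> h * norm v + h * norm w"
      using that by (intro order_trans[OF norm_triangle_ineq] add_mono) (auto intro: mult_right_mono)
    also have "\<dots> \<le> h * n"
      using h by (simp add: n_def distrib_left)
    also have "\<dots> = d / 2"
      using n by (simp add: h_def)
    finally show ?thesis
      using d(1) by simp
  qed
  let ?\<Delta> = "f (x + h *\<^sub>R v + h *\<^sub>R w) - f (x + h *\<^sub>R v) - f (x + h *\<^sub>R w) + f x"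
  have inS: "x + p *\<^sub>R v + q *\<^sub>R w \<in> S" "x + q *\<^sub>R w + p *\<^sub>R v \<in> S"
    if "p \<in> {0..h}" "q \<in> {0..h}" for p q
    using d(2)[OF small[OF that]] by (auto simp: algebra_simps)
  obtain p q where pq: "p \<in> {0..h}" "q \<in> {0..h}" "?\<Delta> = h\<^sup>2 * fv (x + p *\<^sub>R v + q *\<^sub>R w) w"
    using mixed_difference[OF h inS(1) f fv] by blast
  obtain p' q' where pq': "p' \<in> {0..h}" "q' \<in> {0..h}"
      "f (x + h *\<^sub>R w + h *\<^sub>R v) - f (x + h *\<^sub>R w) - f (x + h *\<^sub>R v) + f x =
        h\<^sup>2 * fw (x + p' *\<^sub>R w + q' *\<^sub>R v) v"
    using mixed_difference[OF h inS(2) f fw] by blast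
  have "h\<^sup>2 * fv (x + p *\<^sub>R v + q *\<^sub>R w) w = h\<^sup>2 * fw (x + p' *\<^sub>R w + q' *\<^sub>R v) v"
    unfolding pq(3)[symmetric] pq'(3)[symmetric] by (simp add: algebra_simps)
  hence "fv (x + p *\<^sub>R v + q *\<^sub>R w) w = fw (x + q' *\<^sub>R v + p' *\<^sub>R w) v"
    using h by (simp add: algebra_simps)
  moreover have "\<bar>fv (x + p *\<^sub>R v + q *\<^sub>R w) w - fv x w\<bar> < e"
    using d(2)[OF small[OF pq(1,2)]] by simp
  moreover have "\<bar>fw (x + q' *\<^sub>R v + p' *\<^sub>R w) v - fw x v\<bar> < e"
    using d(2)[OF small[OF pq'(2,1)]] by simp
  ultimately have "\<bar>fv x w - fw x v\<bar> < 2 * e"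
    by linarith
  thus False
    by (simp add: e_def)
qed

lemma mixed_derivatives_smooth:
  fixes f :: "'a::euclidean_space \<Rightarrow> 'b::euclidean_space"
  assumes S: "open S" "x \<in> S" and f: "smooth_on S f"
  shows "frechet_derivative (\<lambda>y. frechet_derivative f (at y) v) (at x) w =
    frechet_derivative (\<lambda>y. frechet_derivative f (at y) w) (at x) v"
proof (rule euclidean_eqI)
  fix b :: 'b assume "b \<in> Basis"
  let ?f' = "\<lambda>y u. frechet_derivative f (at y) u"
  have 2: "((\<lambda>y. ?f' y u \<bullet> b) has_derivative (\<lambda>r. frechet_derivative (\<lambda>y. ?f' y u) (at y) r \<bullet> b)) (at y)"
    if "y \<in> S" for y u
    by (rule has_derivative_inner_left) (rule smooth_on_has_derivative[OF smooth_on_frechet_derivative[OF f] that])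
  show "frechet_derivative (\<lambda>y. ?f' y v) (at x) w \<bullet> b = frechet_derivative (\<lambda>y. ?f' y w) (at x) v \<bullet> b"
  proof (rule mixed_derivatives_real[OF S, where f = "\<lambda>y. f y \<bullet> b" and f' = "\<lambda>y u. ?f' y u \<bullet> b"
        and fv = "\<lambda>y r. frechet_derivative (\<lambda>y. ?f' y v) (at y) r \<bullet> b"
        and fw = "\<lambda>y r. frechet_derivative (\<lambda>y. ?f' y w) (at y) r \<bullet> b"])
    show "((\<lambda>y. f y \<bullet> b) has_derivative (\<lambda>u. ?f' y u \<bullet> b)) (at y)" if "y \<in> S" for y
      by (rule has_derivative_inner_left) (rule smooth_on_has_derivative[OF f that])
    show "continuous_on S (\<lambda>y. frechet_derivative (\<lambda>y. ?f' y v) (at y) w \<bullet> b)"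
      "continuous_on S (\<lambda>y. frechet_derivative (\<lambda>y. ?f' y w) (at y) v \<bullet> b)"
      by (intro continuous_intros smooth_on_continuous smooth_on_frechet_derivative f)+
  qed (rule 2; assumption)+
qed

section \<open>Nondegenerate linear systems depending on a parameter\<close>

text \<open>As \<open>f\<close> vanishes at \<open>x\<close>, the product
  \<open>(k y - k x) * f y\<close> is of smaller order than \<open>norm (y - x)\<close> even when
  \<open>k\<close> is merely continuous. This allows products with a factor whose differentiability
  is not yet known.\<close>

lemma has_derivative_mult_vanishing:
  fixes f k :: "'a::real_normed_vector \<Rightarrow> real"
  assumes f: "(f has_derivative f') (at x)" "f x = 0" and k: "isCont k x"
  shows "((\<lambda>y. k y * f y) has_derivative (\<lambda>d. k x * f' d)) (at x)"
proof -
  have 1: "((\<lambda>y. k x * f y) has_derivative (\<lambda>d. k x * f' d)) (at x)"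
    using f(1) by (auto intro!: derivative_eq_intros)
  have "((\<lambda>y. (k y - k x) * f y) has_derivative (\<lambda>d. 0)) (at x)"
    unfolding has_derivative_at_within
  proof
    obtain K where K: "\<And>d. \<bar>f' d\<bar> \<le> norm d * K" "K > 0"
      using bounded_linear.pos_bounded[OF has_derivative_bounded_linear[OF f(1)]] by auto
    have "((\<lambda>y. f y / norm (y - x) - f' (y - x) / norm (y - x)) \<longlongrightarrow> 0) (at x)"
    proof -
      have eq: "(f y - f x - f' (y - x)) /\<^sub>R norm (y - x) = f y / norm (y - x) - f' (y - x) / norm (y - x)" for y
        by (simp add: f(2) divide_inverse algebra_simps)
      show ?thesis
        using f(1) unfolding has_derivative_at_within eq by blast
    qed
    hence "((\<lambda>y. (k y - k x) * (f y / norm (y - x) - f' (y - x) / norm (y - x))) \<longlongrightarrow> (k x - k x) * 0) (at x)"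
      using k by (intro tendsto_intros) (auto simp: isCont_def)
    moreover have "((\<lambda>y. (k y - k x) * (f' (y - x) / norm (y - x))) \<longlongrightarrow> 0) (at x)"
    proof (rule Lim_null_comparison)
      have "((\<lambda>y. \<bar>k y - k x\<bar> * K) \<longlongrightarrow> \<bar>k x - k x\<bar> * K) (at x)"
        using k by (intro tendsto_intros) (auto simp: isCont_def)
      thus "((\<lambda>y. \<bar>k y - k x\<bar> * K) \<longlongrightarrow> 0) (at x)"
        by simp
      show "\<forall>\<^sub>F y in at x. norm ((k y - k x) * (f' (y - x) / norm (y - x))) \<le> \<bar>k y - k x\<bar> * K"
      proof (intro always_eventually allI)
        fix y
        have "\<bar>f' (y - x)\<bar> / norm (y - x) \<le> K"
          using K(1)[of "y - x"] K(2) by (cases "y = x") (auto simp: field_simps)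
        thus "norm ((k y - k x) * (f' (y - x) / norm (y - x))) \<le> \<bar>k y - k x\<bar> * K"
          by (simp add: abs_mult mult_left_mono del: times_divide_eq_right)
      qed
    qed
    ultimately have "((\<lambda>y. (k y - k x) * (f y / norm (y - x) - f' (y - x) / norm (y - x)) +
        (k y - k x) * (f' (y - x) / norm (y - x))) \<longlongrightarrow> (k x - k x) * 0 + 0) (at x)"
      by (rule tendsto_add)
    moreover have "(k y - k x) * (f y / norm (y - x) - f' (y - x) / norm (y - x)) +
        (k y - k x) * (f' (y - x) / norm (y - x)) = ((k y - k x) * f y) / norm (y - x)" for y
      by (simp add: right_diff_distrib)
    ultimately have "((\<lambda>y. ((k y - k x) * f y) / norm (y - x)) \<longlongrightarrow> 0) (at x)"
      by simp
    thus "((\<lambda>y. ((k y - k x) * f y - (k x - k x) * f x - 0) /\<^sub>R norm (y - x)) \<longlongrightarrow> 0) (at x)"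
      by (simp add: divide_inverse mult.commute)
  qed simp
  from has_derivative_add[OF 1 this] show ?thesis
    by (simp add: algebra_simps)
qed

text \<open>The linear equation \<open>A x (z x) = h x\<close> with coefficients depending on a
  point. Through the Koszul formula the Christoffel symbols and their derivatives are solutions of
  this kind with the metric as \<open>A\<close>, so their regularity is read off from
  \<open>A\<close> and \<open>h\<close>.\<close>

locale parametric_system =
  fixes S :: "'p::euclidean_space set" and A :: "'p \<Rightarrow> 'e::euclidean_space \<Rightarrow> 'e \<Rightarrow> real"
    and h :: "'p \<Rightarrow> 'e \<Rightarrow> real" and z :: "'p \<Rightarrow> 'e"
  assumes S: "open S" and bil: "\<And>x. x \<in> S \<Longrightarrow> bilinear (A x)"
    and nd: "\<And>x v. x \<in> S \<Longrightarrow> (\<And>w. A x v w = 0) \<Longrightarrow> v = 0"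
    and contA: "\<And>u v. continuous_on S (\<lambda>x. A x u v)" and conth: "\<And>w. continuous_on S (\<lambda>x. h x w)"
    and sol: "\<And>x w. x \<in> S \<Longrightarrow> A x (z x) w = h x w"
begin

definition op :: "'p \<Rightarrow> 'e \<Rightarrow> 'e" where
  "op x v = (\<Sum>i\<in>Basis. A x v i *\<^sub>R i)"

lemma linear_op: "x \<in> S \<Longrightarrow> linear (op x)"
  unfolding op_def
  by (intro linear_compose_sum ballI linearI)
    (simp_all add: bilinear_ladd[OF bil] bilinear_lmul[OF bil] scaleR_left_distrib)

lemma op_inner: "x \<in> S \<Longrightarrow> op x v \<bullet> w = A x v w"
  using linear_Basis_expand[of "A x v" w] bil[of x]
  by (simp add: op_def inner_sum_left inner_commute[of w] bilinear_def mult.commute)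

lemma inj_op: "x \<in> S \<Longrightarrow> inj (op x)"
  using nd[of x] by (subst linear_injective_0[OF linear_op]) (auto simp flip: op_inner)

lemma op_z: "x \<in> S \<Longrightarrow> op x (z x) = (\<Sum>i\<in>Basis. h x i *\<^sub>R i)"
  by (simp add: op_def sol)

lemma continuous_z: "continuous_on S z"
  unfolding continuous_on_def
proof
  fix x assume x: "x \<in> S"
  have ev: "\<forall>\<^sub>F y in at x within S. y \<in> S"
    by (simp add: eventually_at_filter)
  hence evl: "\<forall>\<^sub>F y in at x within S. linear (op y)"
    by eventually_elim (rule linear_op)
  have lim: "((\<lambda>y. op y v) \<longlongrightarrow> op x v) (at x within S)" for v
    unfolding op_def using contA x by (intro tendsto_intros) (auto simp: continuous_on_def)
  have "((\<lambda>y. \<Sum>i\<in>Basis. h y i *\<^sub>R i) \<longlongrightarrow> (\<Sum>i\<in>Basis. h x i *\<^sub>R i)) (at x within S)"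
    using conth x by (intro tendsto_intros) (auto simp: continuous_on_def)
  moreover have "\<forall>\<^sub>F y in at x within S. (\<Sum>i\<in>Basis. h y i *\<^sub>R i) = op y (z y)"
    using ev by eventually_elim (simp add: op_z)
  ultimately have "((\<lambda>y. op y (z y)) \<longlongrightarrow> op x (z x)) (at x within S)"
    unfolding op_z[OF x] by (rule Lim_transform_eventually)
  thus "(z \<longlongrightarrow> z x) (at x within S)"
    using tendsto_linear_preimage[where D = op and x = z, OF evl linear_op[OF x] inj_op[OF x] lim]
    by blast
qed

text \<open>Freezing the operator at \<open>x\<close> gives
  \<open>op x (z y) = h y - (A y - A x) (z y)\<close>. The last term multiplies \<open>z\<close>, so
  far only continuous, by a factor vanishing at \<open>x\<close>, hence is differentiable by
  \<open>has_derivative_mult_vanishing\<close>; it remains to invert the fixed map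
  \<open>op x\<close>.\<close>

lemma differentiable_z:
  assumes x: "x \<in> S" and A: "\<And>u v. (\<lambda>y. A y u v) differentiable (at x)"
    and h: "\<And>w. (\<lambda>y. h y w) differentiable (at x)"
  shows "z differentiable (at x)"
proof -
  have contz: "isCont z x"
    using continuous_z S x continuous_on_eq_continuous_at by blast
  obtain A' where A': "\<And>u v. ((\<lambda>y. A y u v) has_derivative A' u v) (at x)"
    using A unfolding differentiable_def by metis
  obtain h' where h': "\<And>w. ((\<lambda>y. h y w) has_derivative h' w) (at x)"
    using h unfolding differentiable_def by metis
  let ?r = "\<lambda>y. \<Sum>i\<in>Basis. (h y i - (\<Sum>j\<in>Basis. (z y \<bullet> j) * (A y j i - A x j i))) *\<^sub>R i"
  have "((\<lambda>y. (z y \<bullet> j) * (A y j i - A x j i)) has_derivative (\<lambda>d. (z x \<bullet> j) * (A' j i d - 0))) (at x)" for i j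
    by (intro has_derivative_mult_vanishing has_derivative_diff A' has_derivative_const)
      (use contz in \<open>auto intro!: continuous_intros\<close>)
  hence "((?r) has_derivative (\<lambda>d. \<Sum>i\<in>Basis. (h' i d - (\<Sum>j\<in>Basis. (z x \<bullet> j) * (A' j i d - 0))) *\<^sub>R i)) (at x)"
    by (intro has_derivative_sum has_derivative_scaleR_left has_derivative_diff h')
  hence r: "?r differentiable (at x)"
    by (rule differentiableI)
  have lin: "linear (inv (op x))"
    by (rule inj_linear_imp_inv_linear[OF linear_op[OF x] inj_op[OF x]])
  have zr: "z y = inv (op x) (?r y)" if y: "y \<in> S" for y
  proof -
    have "op x (z y) = ?r y"
    proof (rule euclidean_eqI)
      fix i :: 'e assume i: "i \<in> Basis"
      have e: "A y' (z y) i = (\<Sum>j\<in>Basis. (z y \<bullet> j) * A y' j i)" if "y' \<in> S" for y'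
        using linear_Basis_expand[of "\<lambda>u. A y' u i" "z y"] bil[OF that] by (simp add: bilinear_def)
      have "op x (z y) \<bullet> i = A x (z y) i"
        by (rule op_inner[OF x])
      also have "\<dots> = h y i - (A y (z y) i - A x (z y) i)"
        by (simp add: sol[OF y])
      also have "\<dots> = ?r y \<bullet> i"
        by (simp add: e[OF x] e[OF y] i inner_sum_left inner_Basis if_distrib right_diff_distrib sum_subtractf
            cong: if_cong)
      finally show "op x (z y) \<bullet> i = ?r y \<bullet> i" .
    qed
    thus ?thesis
      by (metis inj_op[OF x] inv_f_f)
  qed
  have "(\<lambda>y. inv (op x) (?r y)) differentiable (at x)"
    by (rule differentiable_compose[OF linear_imp_differentiable[OF lin] r])
  then obtain D where "((\<lambda>y. inv (op x) (?r y)) has_derivative D) (at x)"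
    unfolding differentiable_def by blast
  hence "(z has_derivative D) (at x)"
    by (rule has_derivative_transform_within_open[OF _ S x]) (simp add: zr)
  thus ?thesis
    by (rule differentiableI)
qed

text \<open>Differentiating the equation shows that the derivative of \<open>z\<close> solves a
  system with the same \<open>A\<close>, which makes its continuity another instance of
  \<open>continuous_z\<close>.\<close>

lemma frechet_derivative_z:
  assumes x: "x \<in> S" and A: "\<And>u v. (\<lambda>y. A y u v) differentiable (at x)"
    and h: "\<And>w. (\<lambda>y. h y w) differentiable (at x)"
  shows "A x (frechet_derivative z (at x) d) w =
    frechet_derivative (\<lambda>y. h y w) (at x) d -
      (\<Sum>j\<in>Basis. (z x \<bullet> j) * frechet_derivative (\<lambda>y. A y j w) (at x) d)"
proof -
  have z: "(z has_derivative frechet_derivative z (at x)) (at x)"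
    using differentiable_z[OF x A h] frechet_derivative_works by blast
  have A': "((\<lambda>y. A y u v) has_derivative frechet_derivative (\<lambda>y. A y u v) (at x)) (at x)" for u v
    using A frechet_derivative_works by blast
  have e: "A y v w = (\<Sum>j\<in>Basis. (v \<bullet> j) * A y j w)" if "y \<in> S" for y v
    using linear_Basis_expand[of "\<lambda>u. A y u w" v] bil[OF that] by (simp add: bilinear_def)
  have "((\<lambda>y. \<Sum>j\<in>Basis. (z y \<bullet> j) * A y j w) has_derivative
      (\<lambda>d. \<Sum>j\<in>Basis. (z x \<bullet> j) * frechet_derivative (\<lambda>y. A y j w) (at x) d +
        (frechet_derivative z (at x) d \<bullet> j) * A x j w)) (at x)"
    by (intro has_derivative_sum has_derivative_mult has_derivative_inner_left z A')
  hence "((\<lambda>y. h y w) has_derivative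
      (\<lambda>d. \<Sum>j\<in>Basis. (z x \<bullet> j) * frechet_derivative (\<lambda>y. A y j w) (at x) d +
        (frechet_derivative z (at x) d \<bullet> j) * A x j w)) (at x)"
    by (rule has_derivative_transform_within_open[OF _ S x]) (simp add: sol flip: e)
  from fun_cong[OF frechet_derivative_at[OF this], of d] e[OF x, of "frechet_derivative z (at x) d"]
  show ?thesis
    by (simp add: sum.distrib)
qed

end

section \<open>Levi-Civita connection and curvature in a chart\<close>

text \<open>Product rule, read off from the expansion in a basis, so that only the derivatives of
  the finitely many coefficients \<open>F y i j\<close> enter.\<close>

lemma has_derivative_bilinear_family:
  fixes F :: "'p::euclidean_space \<Rightarrow> 'a::euclidean_space \<Rightarrow> 'b::euclidean_space \<Rightarrow> 'c::euclidean_space"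
  assumes S: "open S" "\<gamma> x \<in> S" "x \<in> X" and bil: "\<And>y. y \<in> S \<Longrightarrow> bilinear (F y)"
    and F: "\<And>u v. ((\<lambda>y. F y u v) has_derivative (\<lambda>d. F' d u v)) (at (\<gamma> x))"
    and F': "\<And>d. bilinear (F' d)"
    and \<gamma>: "(\<gamma> has_derivative \<gamma>') (at x within X)"
    and p: "(p has_derivative p') (at x within X)" and q: "(q has_derivative q') (at x within X)"
  shows "((\<lambda>y. F (\<gamma> y) (p y) (q y)) has_derivative
    (\<lambda>d. F' (\<gamma>' d) (p x) (q x) + F (\<gamma> x) (p' d) (q x) + F (\<gamma> x) (p x) (q' d))) (at x within X)"
proof -
  have "((\<lambda>y. \<Sum>i\<in>Basis. \<Sum>j\<in>Basis. ((p y \<bullet> i) * (q y \<bullet> j)) *\<^sub>R F (\<gamma> y) i j) has_derivative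
      (\<lambda>d. \<Sum>i\<in>Basis. \<Sum>j\<in>Basis. ((p x \<bullet> i) * (q x \<bullet> j)) *\<^sub>R F' (\<gamma>' d) i j +
        ((p x \<bullet> i) * (q' d \<bullet> j) + (p' d \<bullet> i) * (q x \<bullet> j)) *\<^sub>R F (\<gamma> x) i j)) (at x within X)"
    by (intro has_derivative_sum has_derivative_scaleR has_derivative_mult has_derivative_inner_left p q
        has_derivative_compose[OF \<gamma> F])
  also have "(\<lambda>d. \<Sum>i\<in>Basis. \<Sum>j\<in>Basis. ((p x \<bullet> i) * (q x \<bullet> j)) *\<^sub>R F' (\<gamma>' d) i j +
        ((p x \<bullet> i) * (q' d \<bullet> j) + (p' d \<bullet> i) * (q x \<bullet> j)) *\<^sub>R F (\<gamma> x) i j) =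
      (\<lambda>d. F' (\<gamma>' d) (p x) (q x) + F (\<gamma> x) (p' d) (q x) + F (\<gamma> x) (p x) (q' d))"
    using bil[OF S(2)]
    by (simp add: bilinear_Basis_expand[OF F', of _ "p x" "q x"]
        bilinear_Basis_expand[OF bil[OF S(2)], of "p' _" "q x"]
        bilinear_Basis_expand[OF bil[OF S(2)], of "p x" "q' _"]
        scaleR_left_distrib sum.distrib fun_eq_iff)
  finally have *: "((\<lambda>y. \<Sum>i\<in>Basis. \<Sum>j\<in>Basis. ((p y \<bullet> i) * (q y \<bullet> j)) *\<^sub>R F (\<gamma> y) i j) has_derivative
      (\<lambda>d. F' (\<gamma>' d) (p x) (q x) + F (\<gamma> x) (p' d) (q x) + F (\<gamma> x) (p x) (q' d))) (at x within X)" .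
  have "continuous (at x within X) \<gamma>"
    by (rule has_derivative_continuous[OF \<gamma>])
  hence "\<forall>\<^sub>F y in at x within X. \<gamma> y \<in> S"
    using S(1,2) by (auto simp: continuous_within dest: topological_tendstoD)
  hence "\<forall>\<^sub>F y in at x within X. (\<Sum>i\<in>Basis. \<Sum>j\<in>Basis. ((p y \<bullet> i) * (q y \<bullet> j)) *\<^sub>R F (\<gamma> y) i j) = F (\<gamma> y) (p y) (q y)"
    by eventually_elim (rule bilinear_Basis_expand[OF bil, symmetric])
  from has_derivative_transform_eventually[OF * this] show ?thesis
    using bilinear_Basis_expand[OF bil[OF S(2)], of "p x" "q x"] S(3) by simp
qed

locale smooth_metric =
  fixes S :: "'e::euclidean_space set" and G :: "'e \<Rightarrow> 'e \<Rightarrow> 'e \<Rightarrow> real"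
  assumes open_S: "open S" and bil: "x \<in> S \<Longrightarrow> bilinear (G x)"
    and sym: "x \<in> S \<Longrightarrow> G x u v = G x v u"
    and nd: "x \<in> S \<Longrightarrow> (\<And>w. G x u w = 0) \<Longrightarrow> u = 0"
    and smooth: "smooth_on S (\<lambda>x. G x u v)"
begin

abbreviation \<Gamma> :: "'e \<Rightarrow> 'e \<Rightarrow> 'e \<Rightarrow> 'e" where "\<Gamma> \<equiv> christoffel G"

definition dG :: "'e \<Rightarrow> 'e \<Rightarrow> 'e \<Rightarrow> 'e \<Rightarrow> real" where
  "dG x d u v = frechet_derivative (\<lambda>y. G y u v) (at x) d"

definition koszul :: "'e \<Rightarrow> 'e \<Rightarrow> 'e \<Rightarrow> 'e \<Rightarrow> real" where
  "koszul x u v w = (dG x u v w + dG x v u w - dG x w u v) / 2"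

definition d\<Gamma> :: "'e \<Rightarrow> 'e \<Rightarrow> 'e \<Rightarrow> 'e \<Rightarrow> 'e" where
  "d\<Gamma> x d u v = frechet_derivative (\<lambda>y. \<Gamma> y u v) (at x) d"

definition ddG :: "'e \<Rightarrow> 'e \<Rightarrow> 'e \<Rightarrow> 'e \<Rightarrow> 'e \<Rightarrow> real" where
  "ddG x e d u v = frechet_derivative (\<lambda>y. dG y d u v) (at x) e"

lemmas G_simps = bilinear_ladd[OF bil] bilinear_radd[OF bil] bilinear_lmul[OF bil]
  bilinear_rmul[OF bil] bilinear_lsub[OF bil] bilinear_rsub[OF bil] bilinear_lneg[OF bil]
  bilinear_rneg[OF bil] bilinear_lzero[OF bil] bilinear_rzero[OF bil]

lemma eqI: "x \<in> S \<Longrightarrow> (\<And>w. G x u w = G x v w) \<Longrightarrow> u = v"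
  using nd[of x "u - v"] by (simp add: G_simps)

lemma G_deriv: "x \<in> S \<Longrightarrow> ((\<lambda>y. G y u v) has_derivative (\<lambda>d. dG x d u v)) (at x)"
  unfolding dG_def by (rule smooth_on_has_derivative[OF smooth])

lemma frechet_unique: "(f has_derivative f') (at x) \<Longrightarrow> frechet_derivative f (at x) = f'"
  using frechet_derivative_at by metis

lemma dG_linear: "x \<in> S \<Longrightarrow> linear (\<lambda>d. dG x d u v)"
  using G_deriv has_derivative_linear by blast

lemma dG_eqI:
  assumes x: "x \<in> S" and "(f has_derivative f') (at x)" "\<And>y. y \<in> S \<Longrightarrow> f y = G y u v"
  shows "dG x d u v = f' d"
proof -
  have "((\<lambda>y. G y u v) has_derivative f') (at x)"
    by (rule has_derivative_transform_within_open[OF assms(2) open_S x assms(3)])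
  thus ?thesis
    by (simp add: dG_def frechet_unique)
qed

lemma dG_bilinear: assumes x: "x \<in> S" shows "bilinear (dG x d)"
  unfolding bilinear_def
proof (intro conjI allI linearI)
  fix u v w and r :: real
  show "dG x d u (v + w) = dG x d u v + dG x d u w"
    by (rule dG_eqI[OF x has_derivative_add[OF G_deriv[OF x] G_deriv[OF x]]]) (simp add: G_simps)
  show "dG x d (u + v) w = dG x d u w + dG x d v w"
    by (rule dG_eqI[OF x has_derivative_add[OF G_deriv[OF x] G_deriv[OF x]]]) (simp add: G_simps)
  show "dG x d u (r *\<^sub>R v) = r *\<^sub>R dG x d u v"
    by (rule dG_eqI[OF x has_derivative_scaleR_right[OF G_deriv[OF x]]]) (simp add: G_simps)
  show "dG x d (r *\<^sub>R u) v = r *\<^sub>R dG x d u v"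
    by (rule dG_eqI[OF x has_derivative_scaleR_right[OF G_deriv[OF x]]]) (simp add: G_simps)
qed

lemma dG_sym: assumes x: "x \<in> S" shows "dG x d u v = dG x d v u"
  by (rule dG_eqI[OF x G_deriv[OF x]]) (rule sym)

lemma dG_smooth: "smooth_on S (\<lambda>x. dG x d u v)"
  unfolding dG_def by (rule smooth_on_frechet_derivative[OF smooth])

lemma dG_deriv: "x \<in> S \<Longrightarrow> ((\<lambda>y. dG y d u v) has_derivative (\<lambda>e. ddG x e d u v)) (at x)"
  unfolding ddG_def by (rule smooth_on_has_derivative[OF dG_smooth])

lemma ddG_sym: "x \<in> S \<Longrightarrow> ddG x e d u v = ddG x d e u v"
  unfolding ddG_def dG_def by (rule mixed_derivatives_smooth[OF open_S _ smooth])

lemma koszul_linear: assumes x: "x \<in> S" shows "linear (koszul x u v)"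
  unfolding koszul_def
  using linear_add[OF dG_linear[OF x]] linear_scale[OF dG_linear[OF x]]
  by (intro linearI)
    (simp_all add: bilinear_radd[OF dG_bilinear[OF x]] bilinear_rmul[OF dG_bilinear[OF x]] field_simps)

lemma \<Gamma>_koszul: assumes x: "x \<in> S" shows "G x (\<Gamma> x u v) w = koszul x u v w"
proof -
  \<comment> \<open>The solution 0 with its matching right-hand side is chosen just to instantiate
    the locale: the invertibility of \<open>op\<close> produces the vector demanded by the definite
    description in \<open>christoffel\<close>.\<close>
  interpret P: parametric_system S G "\<lambda>x w. G x 0 w" "\<lambda>x. 0"
    by unfold_locales (use open_S nd smooth_on_continuous[OF smooth] in \<open>auto intro: bil\<close>)
  have "surj (P.op x)"
    by (rule linear_inj_imp_surj[OF P.linear_op[OF x] P.inj_op[OF x]])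
  then obtain z where z: "P.op x z = (\<Sum>i\<in>Basis. koszul x u v i *\<^sub>R i)"
    by (metis surjD)
  have Gz: "G x z w = koszul x u v w" for w
    using linear_Basis_expand[OF koszul_linear[OF x], of u v w]
    by (simp add: z inner_sum_left inner_commute[of w] mult.commute flip: P.op_inner[OF x])
  have "\<Gamma> x u v = z"
    unfolding christoffel_def
  proof (rule the_equality)
    show "\<forall>w. 2 * G x z w = frechet_derivative (\<lambda>y. G y v w) (at x) u
        + frechet_derivative (\<lambda>y. G y u w) (at x) v - frechet_derivative (\<lambda>y. G y u v) (at x) w"
      by (simp add: Gz koszul_def dG_def)
    fix z' assume z': "\<forall>w. 2 * G x z' w = frechet_derivative (\<lambda>y. G y v w) (at x) u
        + frechet_derivative (\<lambda>y. G y u w) (at x) v - frechet_derivative (\<lambda>y. G y u v) (at x) w"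
    have "G x z' w = G x z w" for w
      using spec[OF z', of w] by (simp add: Gz koszul_def dG_def)
    thus "z' = z"
      by (rule eqI[OF x])
  qed
  thus ?thesis
    by (simp add: Gz)
qed

lemma \<Gamma>_sym: assumes x: "x \<in> S" shows "\<Gamma> x u v = \<Gamma> x v u"
  by (rule eqI[OF x]) (simp add: \<Gamma>_koszul[OF x] koszul_def dG_sym[OF x, of _ u v])

lemma \<Gamma>_bilinear: assumes x: "x \<in> S" shows "bilinear (\<Gamma> x)"
  unfolding bilinear_def
proof (intro conjI allI linearI)
  note k = \<Gamma>_koszul[OF x] koszul_def linear_add[OF dG_linear[OF x]] linear_scale[OF dG_linear[OF x]]
    bilinear_ladd[OF dG_bilinear[OF x]] bilinear_radd[OF dG_bilinear[OF x]]
    bilinear_lmul[OF dG_bilinear[OF x]] bilinear_rmul[OF dG_bilinear[OF x]]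
  fix u v w and r :: real
  show "\<Gamma> x u (v + w) = \<Gamma> x u v + \<Gamma> x u w" "\<Gamma> x (u + v) w = \<Gamma> x u w + \<Gamma> x v w"
    "\<Gamma> x u (r *\<^sub>R v) = r *\<^sub>R \<Gamma> x u v" "\<Gamma> x (r *\<^sub>R u) v = r *\<^sub>R \<Gamma> x u v"
    by (rule eqI[OF x]; simp add: G_simps[OF x] k field_simps)+
qed

text \<open>The Koszul expressions for \<open>(d, u, v)\<close> and \<open>(d, v, u)\<close> add up
  to \<open>dG x d u v\<close>, the other terms cancelling by symmetry: the connection is
  metric.\<close>

lemma compatible: assumes x: "x \<in> S" shows "dG x d u v = G x (\<Gamma> x d u) v + G x u (\<Gamma> x d v)"
  using sym[OF x, of u "\<Gamma> x d v"] dG_sym[OF x, of u] dG_sym[OF x, of v] dG_sym[OF x, of d]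
  by (simp add: \<Gamma>_koszul[OF x] koszul_def field_simps)

section \<open>Derivatives of the Christoffel symbols\<close>

lemma koszul_deriv:
  "x \<in> S \<Longrightarrow> ((\<lambda>y. koszul y u v w) has_derivative
    (\<lambda>d. (ddG x d u v w + ddG x d v u w - ddG x d w u v) / 2)) (at x)"
  unfolding koszul_def by (auto intro!: derivative_eq_intros dG_deriv)

lemma \<Gamma>_system: "parametric_system S G (\<lambda>x. koszul x u v) (\<lambda>x. \<Gamma> x u v)"
  using open_S bil nd \<Gamma>_koszul
  by unfold_locales
    (auto simp: koszul_def intro!: continuous_intros smooth_on_continuous[OF smooth] smooth_on_continuous[OF dG_smooth])

lemma \<Gamma>_continuous: "continuous_on S (\<lambda>x. \<Gamma> x u v)"
  by (rule parametric_system.continuous_z[OF \<Gamma>_system])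

lemma \<Gamma>_deriv: assumes x: "x \<in> S" shows "((\<lambda>y. \<Gamma> y u v) has_derivative (\<lambda>d. d\<Gamma> x d u v)) (at x)"
proof -
  have "(\<lambda>y. \<Gamma> y u v) differentiable (at x)"
    by (rule parametric_system.differentiable_z[OF \<Gamma>_system x])
      (auto intro: differentiableI G_deriv[OF x] koszul_deriv[OF x])
  thus ?thesis
    unfolding d\<Gamma>_def using frechet_derivative_works by blast
qed

lemma d\<Gamma>_continuous: "continuous_on S (\<lambda>x. d\<Gamma> x d u v)"
proof -
  let ?h = "\<lambda>x w. (ddG x d u v w + ddG x d v u w - ddG x d w u v) / 2 -
      (\<Sum>j\<in>Basis. (\<Gamma> x u v \<bullet> j) * dG x d j w)"
  have "parametric_system S G ?h (\<lambda>x. d\<Gamma> x d u v)"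
  proof
    show "continuous_on S (\<lambda>x. ?h x w)" for w
      unfolding ddG_def
      by (intro continuous_intros \<Gamma>_continuous smooth_on_continuous[OF dG_smooth]
          smooth_on_continuous[OF smooth_on_frechet_derivative[OF dG_smooth]]) simp
    show "G x (d\<Gamma> x d u v) w = ?h x w" if x: "x \<in> S" for x w
      unfolding d\<Gamma>_def
      by (subst parametric_system.frechet_derivative_z[OF \<Gamma>_system x])
        (auto simp: frechet_unique[OF koszul_deriv[OF x]] dG_def
          intro: differentiableI G_deriv[OF x] koszul_deriv[OF x])
  qed (use open_S nd in \<open>auto intro: bil smooth_on_continuous[OF smooth]\<close>)
  thus ?thesis
    by (rule parametric_system.continuous_z)
qed

lemma d\<Gamma>_linear: "x \<in> S \<Longrightarrow> linear (\<lambda>d. d\<Gamma> x d u v)"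
  using \<Gamma>_deriv has_derivative_linear by blast

lemma d\<Gamma>_eqI:
  assumes x: "x \<in> S" and "(f has_derivative f') (at x)" "\<And>y. y \<in> S \<Longrightarrow> f y = \<Gamma> y u v"
  shows "d\<Gamma> x d u v = f' d"
proof -
  have "((\<lambda>y. \<Gamma> y u v) has_derivative f') (at x)"
    by (rule has_derivative_transform_within_open[OF assms(2) open_S x assms(3)])
  thus ?thesis
    by (simp add: d\<Gamma>_def frechet_unique)
qed

lemma d\<Gamma>_bilinear: assumes x: "x \<in> S" shows "bilinear (d\<Gamma> x d)"
  unfolding bilinear_def
proof (intro conjI allI linearI)
  note s = bilinear_ladd[OF \<Gamma>_bilinear] bilinear_radd[OF \<Gamma>_bilinear]
    bilinear_lmul[OF \<Gamma>_bilinear] bilinear_rmul[OF \<Gamma>_bilinear]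
  fix u v w and r :: real
  show "d\<Gamma> x d u (v + w) = d\<Gamma> x d u v + d\<Gamma> x d u w"
    by (rule d\<Gamma>_eqI[OF x has_derivative_add[OF \<Gamma>_deriv[OF x] \<Gamma>_deriv[OF x]]]) (simp add: s)
  show "d\<Gamma> x d (u + v) w = d\<Gamma> x d u w + d\<Gamma> x d v w"
    by (rule d\<Gamma>_eqI[OF x has_derivative_add[OF \<Gamma>_deriv[OF x] \<Gamma>_deriv[OF x]]]) (simp add: s)
  show "d\<Gamma> x d u (r *\<^sub>R v) = r *\<^sub>R d\<Gamma> x d u v"
    by (rule d\<Gamma>_eqI[OF x has_derivative_scaleR_right[OF \<Gamma>_deriv[OF x]]]) (simp add: s)
  show "d\<Gamma> x d (r *\<^sub>R u) v = r *\<^sub>R d\<Gamma> x d u v"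
    by (rule d\<Gamma>_eqI[OF x has_derivative_scaleR_right[OF \<Gamma>_deriv[OF x]]]) (simp add: s)
qed

lemma d\<Gamma>_sym: assumes x: "x \<in> S" shows "d\<Gamma> x d u v = d\<Gamma> x d v u"
  by (rule d\<Gamma>_eqI[OF x \<Gamma>_deriv[OF x]]) (rule \<Gamma>_sym)

lemmas \<Gamma>_simps = bilinear_ladd[OF \<Gamma>_bilinear] bilinear_radd[OF \<Gamma>_bilinear]
  bilinear_lmul[OF \<Gamma>_bilinear] bilinear_rmul[OF \<Gamma>_bilinear] bilinear_lsub[OF \<Gamma>_bilinear]
  bilinear_rsub[OF \<Gamma>_bilinear] bilinear_lzero[OF \<Gamma>_bilinear] bilinear_rzero[OF \<Gamma>_bilinear]

section \<open>The curvature tensor and its symmetries\<close>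

lemma curvature_eq:
  assumes x: "x \<in> S"
  shows "curvature G x u v w = d\<Gamma> x u v w - d\<Gamma> x v u w + \<Gamma> x u (\<Gamma> x v w) - \<Gamma> x v (\<Gamma> x u w)"
proof -
  have c: "frechet_derivative (\<lambda>_. w :: 'e) (at y) d = 0" for w y d
    using fun_cong[OF frechet_unique[OF has_derivative_const]] by blast
  have n: "nabla G (\<lambda>_. v) (\<lambda>_. w) = (\<lambda>y. \<Gamma> y v w)" for v w
    by (simp add: fun_eq_iff nabla_def c)
  have l: "lie_bracket (\<lambda>_. u) (\<lambda>_. v) = (\<lambda>_. 0)"
    by (simp add: fun_eq_iff lie_bracket_def c)
  show ?thesis
    unfolding curvature_def curvature_op_def n l
    by (simp add: nabla_def d\<Gamma>_def \<Gamma>_simps(7)[OF x])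
qed

lemma curvature_linear:
  assumes x: "x \<in> S"
  shows "linear (\<lambda>v. curvature G x u v w)"
  unfolding curvature_eq[OF x]
  by (intro linearI)
    (simp_all add: \<Gamma>_simps[OF x] bilinear_ladd[OF d\<Gamma>_bilinear[OF x]] bilinear_radd[OF d\<Gamma>_bilinear[OF x]]
      bilinear_lmul[OF d\<Gamma>_bilinear[OF x]] bilinear_rmul[OF d\<Gamma>_bilinear[OF x]]
      linear_add[OF d\<Gamma>_linear[OF x]] linear_scale[OF d\<Gamma>_linear[OF x]] algebra_simps)

text \<open>Differentiate \<open>d\<^sub>d G(w, z) = G(\<Gamma>(d, w), z) + G(w, \<Gamma>(d, z))\<close> once more and use that
  second derivatives commute.\<close>

lemma curvature_skew:
  assumes x: "x \<in> S"
  shows "G x (curvature G x e d w) z = - G x w (curvature G x e d z)"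
proof -
  have E: "ddG x e d w z = dG x e (\<Gamma> x d w) z + G x (d\<Gamma> x e d w) z + (dG x e w (\<Gamma> x d z) + G x w (d\<Gamma> x e d z))" for e d
  proof -
    have 1: "((\<lambda>y. G y (p y) (q y)) has_derivative
        (\<lambda>e. dG x e (p x) (q x) + G x (p' e) (q x) + G x (p x) (q' e))) (at x)"
      if "(p has_derivative p') (at x)" "(q has_derivative q') (at x)" for p q p' q'
      using has_derivative_bilinear_family[OF open_S, of "\<lambda>y. y" x UNIV G "dG x" "\<lambda>d. d" p p' q q'] x that
      by (simp add: bil G_deriv dG_bilinear)
    have 2: "G x (\<Gamma> x d w) 0 = 0" "G x 0 (\<Gamma> x d z) = 0" "G x w 0 = 0" "G x 0 z = 0"
      by (simp_all add: G_simps[OF x])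
    have "((\<lambda>y. G y (\<Gamma> y d w) z + G y w (\<Gamma> y d z)) has_derivative
        (\<lambda>e. (dG x e (\<Gamma> x d w) z + G x (d\<Gamma> x e d w) z + G x (\<Gamma> x d w) 0) +
          (dG x e w (\<Gamma> x d z) + G x 0 (\<Gamma> x d z) + G x w (d\<Gamma> x e d z)))) (at x)"
      by (intro has_derivative_add 1 \<Gamma>_deriv[OF x] has_derivative_const)
    hence "((\<lambda>y. dG y d w z) has_derivative
        (\<lambda>e. (dG x e (\<Gamma> x d w) z + G x (d\<Gamma> x e d w) z + G x (\<Gamma> x d w) 0) +
          (dG x e w (\<Gamma> x d z) + G x 0 (\<Gamma> x d z) + G x w (d\<Gamma> x e d z)))) (at x)"
      by (rule has_derivative_transform_within_open[OF _ open_S x]) (rule compatible[symmetric])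
    from fun_cong[OF frechet_unique[OF this], of e] show ?thesis
      by (simp add: ddG_def 2)
  qed
  show ?thesis
    using E[of e d] E[of d e] ddG_sym[OF x, of e d w z]
    by (simp add: compatible[OF x] curvature_eq[OF x] G_simps[OF x])
qed

lemma curvature_bianchi:
  assumes x: "x \<in> S"
  shows "curvature G x u v w + curvature G x v w u + curvature G x w u v = 0"
  by (simp add: curvature_eq[OF x] \<Gamma>_sym[OF x, of w u] \<Gamma>_sym[OF x, of w v] \<Gamma>_sym[OF x, of v u]
      d\<Gamma>_sym[OF x, of _ w u] d\<Gamma>_sym[OF x, of _ w v] d\<Gamma>_sym[OF x, of _ v u])

text \<open>The octahedron argument: four Bianchi identities, one for each choice of the last
  argument, combined with skew symmetry in both pairs of slots.\<close>

lemma curvature_pair: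
  assumes x: "x \<in> S"
  shows "G x (curvature G x a b c) d = G x (curvature G x c d a) b"
proof -
  define R where "R a b c d = G x (curvature G x a b c) d" for a b c d
  have 1: "R a b c d = - R b a c d" for a b c d
    by (simp add: R_def curvature_eq[OF x] G_simps[OF x])
  have 2: "R a b c d = - R a b d c" for a b c d
    unfolding R_def by (subst curvature_skew[OF x], subst sym[OF x]) simp
  have 3: "R a b c d + R b c a d + R c a b d = 0" for a b c d
    using arg_cong[OF curvature_bianchi[OF x, of a b c], of "\<lambda>z. G x z d"]
    by (simp add: R_def G_simps[OF x])
  have "R a b c d = R c d a b"
    using 3[of a b c d] 3[of b c d a] 3[of c d a b] 3[of d a b c]
      1[of a b] 1[of b c] 1[of c a] 1[of c d] 1[of d b] 1[of d a]
      2[of a b c d] 2[of b c a d] 2[of c a b d] 2[of c d b a] 2[of d b c a] 2[of d a c b] 2[of a c d b]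
      2[of c d a b] 2[of a b d c] 2[of b d a c] 2[of d a b c] 2[of a c b d]
      1[of c a d b] 1[of c a b d] 1[of b d a c] 1[of b d c a]
    by (smt (verit))
  thus ?thesis
    by (simp add: R_def)
qed

text \<open>Self-adjointness of the Jacobi operator, which makes the Wronskian of two Jacobi fields
  constant.\<close>

lemma curvature_jacobi_sym:
  assumes x: "x \<in> S"
  shows "G x (curvature G x u v u) w = G x v (curvature G x u w u)"
  using curvature_pair[OF x, of u v u w] sym[OF x] by metis

end

section \<open>Isometric changes of coordinates\<close>

locale metric_change = M: smooth_metric S G + M': smooth_metric S' G'
  for S S' :: "'e::euclidean_space set" and G G' :: "'e \<Rightarrow> 'e \<Rightarrow> 'e \<Rightarrow> real" +
  fixes U :: "'e set" and \<phi> :: "'e \<Rightarrow> 'e"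
  assumes U: "open U" "U \<subseteq> S" "\<phi> ` U \<subseteq> S'" and \<phi>: "smooth_on U \<phi>"
    and isometry: "x \<in> U \<Longrightarrow>
      G' (\<phi> x) (frechet_derivative \<phi> (at x) u) (frechet_derivative \<phi> (at x) v) = G x u v"
begin

text \<open>Together with \<open>H\<close> and \<open>K\<close>, these are the first, second and
  third derivatives of the coordinate change; the first vector argument is the direction of the
  latest differentiation.\<close>

definition D :: "'e \<Rightarrow> 'e \<Rightarrow> 'e" where "D x u = frechet_derivative \<phi> (at x) u"
definition H :: "'e \<Rightarrow> 'e \<Rightarrow> 'e \<Rightarrow> 'e" where "H x u v = frechet_derivative (\<lambda>y. D y v) (at x) u"
definition K :: "'e \<Rightarrow> 'e \<Rightarrow> 'e \<Rightarrow> 'e \<Rightarrow> 'e" where "K x d u v = frechet_derivative (\<lambda>y. H y u v) (at x) d"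

lemma \<phi>_deriv: "x \<in> U \<Longrightarrow> (\<phi> has_derivative D x) (at x)"
  unfolding D_def by (rule smooth_on_has_derivative[OF \<phi>])

lemma D_smooth: "smooth_on U (\<lambda>x. D x u)"
  unfolding D_def by (rule smooth_on_frechet_derivative[OF \<phi>])

lemma D_deriv: "x \<in> U \<Longrightarrow> ((\<lambda>y. D y v) has_derivative (\<lambda>u. H x u v)) (at x)"
  unfolding H_def by (rule smooth_on_has_derivative[OF D_smooth])

lemma H_deriv: "x \<in> U \<Longrightarrow> ((\<lambda>y. H y u v) has_derivative (\<lambda>d. K x d u v)) (at x)"
  unfolding H_def K_def by (rule smooth_on_has_derivative[OF smooth_on_frechet_derivative[OF D_smooth]])

lemma D_linear: "x \<in> U \<Longrightarrow> linear (D x)"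
  using \<phi>_deriv has_derivative_linear by blast

lemma H_sym: "x \<in> U \<Longrightarrow> H x u v = H x v u"
  unfolding H_def D_def by (rule mixed_derivatives_smooth[OF U(1) _ \<phi>])

lemma H_linear: "x \<in> U \<Longrightarrow> linear (\<lambda>u. H x u v)"
  using D_deriv has_derivative_linear by blast

lemma H_bilinear: "x \<in> U \<Longrightarrow> bilinear (H x)"
  using H_linear[of x] by (simp add: bilinear_def H_sym[of x])

lemma K_sym: "x \<in> U \<Longrightarrow> K x d u v = K x u d v"
  unfolding K_def H_def by (rule mixed_derivatives_smooth[OF U(1) _ D_smooth])

lemma iso: "x \<in> U \<Longrightarrow> G' (\<phi> x) (D x u) (D x v) = G x u v"
  unfolding D_def by (rule isometry)

lemma D_surj: assumes x: "x \<in> U" shows "surj (D x)"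
proof (rule linear_inj_imp_surj[OF D_linear[OF x]])
  show "inj (D x)"
    unfolding linear_injective_0[OF D_linear[OF x]]
  proof (intro allI impI)
    fix v assume v: "D x v = 0"
    have "G x v w = 0" for w
      using iso[OF x, of v w] U x by (auto simp: v M'.G_simps)
    thus "v = 0"
      using M.nd x U(2) by blast
  qed
qed

lemma dG_change:
  assumes x: "x \<in> U"
  shows "M.dG x d u v = M'.dG (\<phi> x) (D x d) (D x u) (D x v) + G' (\<phi> x) (H x d u) (D x v)
    + G' (\<phi> x) (D x u) (H x d v)"
proof -
  have x': "\<phi> x \<in> S'"
    using x U by auto
  have "((\<lambda>y. G' (\<phi> y) (D y u) (D y v)) has_derivative
      (\<lambda>d. M'.dG (\<phi> x) (D x d) (D x u) (D x v) + G' (\<phi> x) (H x d u) (D x v) + G' (\<phi> x) (D x u) (H x d v))) (at x)"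
    by (rule has_derivative_bilinear_family[OF M'.open_S x' UNIV_I M'.bil M'.G_deriv[OF x']
          M'.dG_bilinear[OF x'] \<phi>_deriv[OF x] D_deriv[OF x] D_deriv[OF x]])
  hence "((\<lambda>y. G y u v) has_derivative
      (\<lambda>d. M'.dG (\<phi> x) (D x d) (D x u) (D x v) + G' (\<phi> x) (H x d u) (D x v) + G' (\<phi> x) (D x u) (H x d v))) (at x)"
    by (rule has_derivative_transform_within_open[OF _ U(1) x iso])
  from fun_cong[OF M.frechet_unique[OF this], of d] show ?thesis
    by (simp add: M.dG_def)
qed

text \<open>It suffices to pair both sides with vectors \<open>D x w\<close>, since
  \<open>D x\<close> is onto. In the Koszul expression the second derivatives coming from
  \<open>dG_change\<close> cancel up to one copy of \<open>H x u v\<close>, the inhomogeneous term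
  in the transformation law of a connection.\<close>

lemma christoffel_change:
  assumes x: "x \<in> U"
  shows "D x (christoffel G x u v) = christoffel G' (\<phi> x) (D x u) (D x v) + H x u v"
proof (rule M'.eqI)
  show x': "\<phi> x \<in> S'"
    using x U by auto
  fix w'
  obtain w where w: "w' = D x w"
    using D_surj[OF x] by (metis surjD)
  have xS: "x \<in> S"
    using x U by auto
  note s = H_sym[OF x, of w u] H_sym[OF x, of w v] H_sym[OF x, of v u] M'.sym[OF x', of "D x u" "H x v w"]
    M'.sym[OF x', of "D x v" "H x u w"]
  have "G' (\<phi> x) (D x (christoffel G x u v)) (D x w) = M.koszul x u v w"
    by (simp add: iso[OF x] M.\<Gamma>_koszul[OF xS])
  also have "\<dots> = M'.koszul (\<phi> x) (D x u) (D x v) (D x w) + G' (\<phi> x) (H x u v) (D x w)"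
    by (simp add: M.koszul_def M'.koszul_def dG_change[OF x] s field_simps)
  also have "\<dots> = G' (\<phi> x) (christoffel G' (\<phi> x) (D x u) (D x v) + H x u v) (D x w)"
    by (simp add: M'.G_simps[OF x'] M'.\<Gamma>_koszul[OF x'])
  finally show "G' (\<phi> x) (D x (christoffel G x u v)) w' =
      G' (\<phi> x) (christoffel G' (\<phi> x) (D x u) (D x v) + H x u v) w'"
    by (simp add: w)
qed

text \<open>Derivative of both sides of \<open>christoffel_change\<close>, each by its own product
  rule.\<close>

lemma d\<Gamma>_change:
  assumes x: "x \<in> U"
  shows "H x d (christoffel G x u v) + D x (M.d\<Gamma> x d u v) =
    M'.d\<Gamma> (\<phi> x) (D x d) (D x u) (D x v) + christoffel G' (\<phi> x) (H x d u) (D x v)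
      + christoffel G' (\<phi> x) (D x u) (H x d v) + K x d u v"
proof -
  have x': "\<phi> x \<in> S'" and xS: "x \<in> S"
    using x U by auto
  have "((\<lambda>y. christoffel G' (\<phi> y) (D y u) (D y v) + H y u v) has_derivative
      (\<lambda>d. (M'.d\<Gamma> (\<phi> x) (D x d) (D x u) (D x v) + christoffel G' (\<phi> x) (H x d u) (D x v)
        + christoffel G' (\<phi> x) (D x u) (H x d v)) + K x d u v)) (at x)"
    by (intro has_derivative_add H_deriv[OF x])
      (rule has_derivative_bilinear_family[OF M'.open_S x' UNIV_I M'.\<Gamma>_bilinear M'.\<Gamma>_deriv[OF x']
          M'.d\<Gamma>_bilinear[OF x'] \<phi>_deriv[OF x] D_deriv[OF x] D_deriv[OF x]])
  hence 1: "((\<lambda>y. D y (christoffel G y u v)) has_derivative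
      (\<lambda>d. (M'.d\<Gamma> (\<phi> x) (D x d) (D x u) (D x v) + christoffel G' (\<phi> x) (H x d u) (D x v)
        + christoffel G' (\<phi> x) (D x u) (H x d v)) + K x d u v)) (at x)"
    by (rule has_derivative_transform_within_open[OF _ U(1) x christoffel_change[symmetric]])
  have e: "D y z = (\<Sum>i\<in>Basis. (z \<bullet> i) *\<^sub>R D y i)" if "y \<in> U" for y z
    by (rule linear_Basis_expand[OF D_linear[OF that]])
  have eH: "H x d z = (\<Sum>i\<in>Basis. (z \<bullet> i) *\<^sub>R H x d i)" for d z
    by (rule linear_Basis_expand) (use H_bilinear[OF x] in \<open>simp add: bilinear_def\<close>)
  have "((\<lambda>y. \<Sum>i\<in>Basis. (christoffel G y u v \<bullet> i) *\<^sub>R D y i) has_derivative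
      (\<lambda>d. \<Sum>i\<in>Basis. (christoffel G x u v \<bullet> i) *\<^sub>R H x d i + (M.d\<Gamma> x d u v \<bullet> i) *\<^sub>R D x i)) (at x)"
    by (intro has_derivative_sum has_derivative_scaleR has_derivative_inner_left M.\<Gamma>_deriv[OF xS] D_deriv[OF x])
  also have "(\<lambda>d. \<Sum>i\<in>Basis. (christoffel G x u v \<bullet> i) *\<^sub>R H x d i + (M.d\<Gamma> x d u v \<bullet> i) *\<^sub>R D x i) =
      (\<lambda>d. H x d (christoffel G x u v) + D x (M.d\<Gamma> x d u v))"
    by (simp only: sum.distrib eH[of _ "christoffel G x u v"] e[OF x, of "M.d\<Gamma> x _ u v"])
  finally have "((\<lambda>y. D y (christoffel G y u v)) has_derivative
      (\<lambda>d. H x d (christoffel G x u v) + D x (M.d\<Gamma> x d u v))) (at x)"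
    by (rule has_derivative_transform_within_open[OF _ U(1) x e[symmetric]])
  from fun_cong[OF has_derivative_unique[OF this 1], of d] show ?thesis .
qed

text \<open>After substitution of the two transformation laws, the third derivatives
  \<open>K\<close> cancel by their symmetry in \<open>u\<close> and \<open>v\<close>, and the terms
  with \<open>H\<close> cancel in pairs, so that a tensor remains.\<close>

lemma curvature_change:
  assumes x: "x \<in> U"
  shows "D x (curvature G x u v w) = curvature G' (\<phi> x) (D x u) (D x v) (D x w)"
proof -
  have x': "\<phi> x \<in> S'" and xS: "x \<in> S"
    using x U by auto
  note Dl = linear_add[OF D_linear[OF x]] linear_diff[OF D_linear[OF x]]
  have A: "D x (M.d\<Gamma> x u v w) = M'.d\<Gamma> (\<phi> x) (D x u) (D x v) (D x w) + christoffel G' (\<phi> x) (H x u v) (D x w)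
      + christoffel G' (\<phi> x) (D x v) (H x u w) + K x u v w - H x u (christoffel G x v w)" for u v
    unfolding d\<Gamma>_change[OF x, of u v w, symmetric] by simp
  have B: "D x (christoffel G x u (christoffel G x v w)) =
      christoffel G' (\<phi> x) (D x u) (christoffel G' (\<phi> x) (D x v) (D x w)) +
      christoffel G' (\<phi> x) (D x u) (H x v w) + H x u (christoffel G x v w)" for u v
    by (simp add: christoffel_change[OF x] M'.\<Gamma>_simps[OF x'])
  show ?thesis
    unfolding M.curvature_eq[OF xS] M'.curvature_eq[OF x'] Dl A B K_sym[OF x, of v u w] H_sym[OF x, of v u]
    by simp
qed

end

section \<open>Charts, tangent vectors and submanifolds\<close>

lemma chart_inj: "is_chart X c \<Longrightarrow> inj_on (snd c) (fst c)"
  unfolding is_chart_def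
  by (auto dest!: homeomorphic_imp_injective_map openin_subset simp: Int_absorb1)

lemma chart_open_image:
  assumes c: "is_chart X c" and W: "openin X W"
  shows "open (snd c ` (fst c \<inter> W))"
proof -
  have "openin (subtopology X (fst c)) (fst c \<inter> W)"
    using W by (auto simp: openin_subtopology)
  hence "openin (top_of_set (snd c ` fst c)) (snd c ` (fst c \<inter> W))"
    using c homeomorphic_imp_open_map unfolding is_chart_def open_map_def by blast
  thus ?thesis
    using c unfolding is_chart_def by (meson openin_open_trans)
qed

lemma chart_eventually:
  assumes c: "is_chart X c" and p: "p \<in> fst c" "p \<in> W" "openin X W"
    and \<sigma>: "((\<lambda>s. snd c (\<sigma> s)) \<longlongrightarrow> snd c p) F" "\<forall>\<^sub>F s in F. \<sigma> s \<in> fst c"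
  shows "\<forall>\<^sub>F s in F. \<sigma> s \<in> W"
proof -
  have "\<forall>\<^sub>F s in F. snd c (\<sigma> s) \<in> snd c ` (fst c \<inter> W)"
    by (rule topological_tendstoD[OF \<sigma>(1) chart_open_image[OF c p(3)]]) (use p in auto)
  with \<sigma>(2) show ?thesis
  proof eventually_elim
    case (elim s)
    thus ?case
      using chart_inj[OF c] by (auto simp: inj_on_def)
  qed
qed

lemma transition_apply: "is_chart X c \<Longrightarrow> p \<in> fst c \<Longrightarrow> transition c c' (snd c p) = snd c' p"
  by (simp add: transition_def inv_into_f_f[OF chart_inj])

definition chart_jacobian ::
  "('m, 'e::euclidean_space) chart \<Rightarrow> ('m, 'e) chart \<Rightarrow> 'm \<Rightarrow> 'e \<Rightarrow> 'e" where
  "chart_jacobian c c' p = frechet_derivative (transition c c') (at (snd c p))"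

lemma overlap_open:
  assumes "is_chart X c" "is_chart X c'"
  shows "open (snd c ` (fst c \<inter> fst c'))"
  using assms by (intro chart_open_image) (auto simp: is_chart_def)

lemma transition_has_derivative:
  assumes "compatible c c'" "p \<in> fst c" "p \<in> fst c'"
  shows "(transition c c' has_derivative chart_jacobian c c' p) (at (snd c p))"
  unfolding chart_jacobian_def
proof (rule smooth_on_has_derivative)
  show "smooth_on (snd c ` (fst c \<inter> fst c')) (transition c c')"
    using assms(1) unfolding compatible_def by (rule conjunct1)
  show "snd c p \<in> snd c ` (fst c \<inter> fst c')"
    using assms(2,3) by (intro imageI IntI)
qed

lemma chart_jacobian_linear:
  "compatible c c' \<Longrightarrow> p \<in> fst c \<Longrightarrow> p \<in> fst c' \<Longrightarrow> linear (chart_jacobian c c' p)"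
  by (rule has_derivative_linear[OF transition_has_derivative])

lemma compatible_sym: "compatible c c' \<Longrightarrow> compatible c' c"
  by (auto simp: compatible_def Int_commute)

lemma chart_jacobian_cocycle:
  assumes charts: "is_chart X c" "is_chart X c'" "is_chart X c''"
    and compat: "compatible c c'" "compatible c' c''"
    and p: "p \<in> fst c" "p \<in> fst c'" "p \<in> fst c''"
  shows "chart_jacobian c' c'' p (chart_jacobian c c' p u) = chart_jacobian c c'' p u"
proof -
  let ?W = "snd c ` (fst c \<inter> (fst c' \<inter> fst c''))"
  have "open ?W"
    using charts by (intro chart_open_image) (auto simp: is_chart_def)
  have "(transition c' c'' has_derivative chart_jacobian c' c'' p) (at (transition c c' (snd c p)))"
    using transition_has_derivative[OF compat(2) p(2,3)] by (simp add: transition_apply[OF charts(1) p(1)])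
  from has_derivative_compose[OF transition_has_derivative[OF compat(1) p(1,2)] this]
  have "((\<lambda>x. transition c' c'' (transition c c' x)) has_derivative
      (\<lambda>u. chart_jacobian c' c'' p (chart_jacobian c c' p u))) (at (snd c p))" .
  hence "(transition c c'' has_derivative (\<lambda>u. chart_jacobian c' c'' p (chart_jacobian c c' p u))) (at (snd c p))"
    by (rule has_derivative_transform_within_open[OF _ \<open>open ?W\<close>])
      (use p in \<open>auto simp: transition_apply[OF charts(1)] transition_apply[OF charts(2)]\<close>)
  from frechet_derivative_at[OF this] show ?thesis
    by (simp add: chart_jacobian_def fun_eq_iff)
qed

lemma chart_jacobian_id:
  assumes c: "is_chart X c" and p: "p \<in> fst c"
  shows "chart_jacobian c c p u = u"
proof -
  have op: "open (snd c ` fst c)"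
    using c by (simp add: is_chart_def)
  have "(transition c c has_derivative (\<lambda>u. u)) (at (snd c p))"
    by (rule has_derivative_transform_within_open[OF has_derivative_ident op])
      (use p in \<open>auto simp: transition_apply[OF c]\<close>)
  from frechet_derivative_at[OF this] show ?thesis
    by (simp add: chart_jacobian_def fun_eq_iff)
qed

lemma chart_jacobian_inverse:
  assumes c: "is_chart X c" "is_chart X c'" and cc: "compatible c c'" "p \<in> fst c" "p \<in> fst c'"
  shows "chart_jacobian c' c p (chart_jacobian c c' p u) = u"
  using chart_jacobian_cocycle[OF c c(1) cc(1) compatible_sym[OF cc(1)] cc(2,3,2)]
  by (simp add: chart_jacobian_id[OF c(1) cc(2)])

section \<open>Tangent spaces of embedded submanifolds\<close>

lemma has_vector_derivative_quotient:
  assumes "(f has_vector_derivative v) (at t within I)"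
  shows "((\<lambda>s. (f s - f t) /\<^sub>R (s - t)) \<longlongrightarrow> v) (at t within I)"
proof -
  have "((\<lambda>s. norm (f s - f t - (s - t) *\<^sub>R v) / norm (s - t)) \<longlongrightarrow> 0) (at t within I)"
    using assms unfolding has_vector_derivative_def has_derivative_iff_norm by blast
  moreover have "\<forall>\<^sub>F s in at t within I.
      norm (f s - f t - (s - t) *\<^sub>R v) / norm (s - t) = norm ((f s - f t) /\<^sub>R (s - t) - v)"
    unfolding eventually_at_filter
  proof (intro always_eventually allI impI)
    fix s assume "s \<noteq> t"
    hence "(f s - f t) /\<^sub>R (s - t) - v = (f s - f t - (s - t) *\<^sub>R v) /\<^sub>R (s - t)"
      by (simp add: scaleR_diff_right)
    thus "norm (f s - f t - (s - t) *\<^sub>R v) / norm (s - t) = norm ((f s - f t) /\<^sub>R (s - t) - v)"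
      by (simp add: divide_inverse_commute)
  qed
  ultimately have "((\<lambda>s. norm ((f s - f t) /\<^sub>R (s - t) - v)) \<longlongrightarrow> 0) (at t within I)"
    by (rule Lim_transform_eventually)
  hence "((\<lambda>s. (f s - f t) /\<^sub>R (s - t) - v) \<longlongrightarrow> 0) (at t within I)"
    by (rule tendsto_norm_zero_cancel)
  thus ?thesis
    by (rule LIM_zero_cancel)
qed

lemma derivative_in_subspace:
  fixes f :: "real \<Rightarrow> 'e::euclidean_space"
  assumes W: "subspace W" and f: "\<forall>\<^sub>F s in nhds 0. f s \<in> W" and d: "(f has_vector_derivative v) (at 0)"
  shows "v \<in> W"
proof (rule Lim_in_closed_set[OF closed_subspace[OF W] _ _ has_vector_derivative_quotient[OF d]])
  have f0: "f 0 \<in> W"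
    using f eventually_nhds_x_imp_x by blast
  show "\<forall>\<^sub>F s in at 0. (f s - f 0) /\<^sub>R (s - 0) \<in> W"
    using f unfolding eventually_at_filter
    by eventually_elim (use f0 in \<open>auto intro!: subspace_scale[OF W] subspace_diff[OF W]\<close>)
qed simp

text \<open>In the slice chart \<open>c1\<close> the submanifold is the subspace \<open>W\<close>:
  difference quotients of curves in \<open>P\<close> stay in \<open>W\<close>, and conversely every
  line in \<open>W\<close> through the base point is locally a curve in \<open>P\<close>. The
  Jacobian of the coordinate change carries both to \<open>c\<close>.\<close>

lemma submanifold_tangent_image:
  fixes c c1 :: "('m, 'e::euclidean_space) chart"
  assumes c: "is_chart X c" "is_chart X c1" "compatible c1 c"
    and p: "p \<in> P" "p \<in> fst c" "p \<in> fst c1"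
    and W: "subspace W" "snd c1 ` (P \<inter> fst c1) = W \<inter> snd c1 ` fst c1"
  shows "submanifold_tangent c P p = chart_jacobian c1 c p ` W"
proof (intro equalityI subsetI)
  fix v assume "v \<in> submanifold_tangent c P p"
  then obtain \<sigma> where \<sigma>: "\<sigma> 0 = p" "\<forall>\<^sub>F s in nhds (0::real). \<sigma> s \<in> P \<inter> fst c"
      "((\<lambda>s. snd c (\<sigma> s)) has_vector_derivative v) (at 0)"
    unfolding submanifold_tangent_def by blast
  have "isCont (\<lambda>s. snd c (\<sigma> s)) 0"
    using has_vector_derivative_continuous[OF \<sigma>(3)] .
  hence lim: "((\<lambda>s. snd c (\<sigma> s)) \<longlongrightarrow> snd c p) (nhds 0)"
    using tendsto_at_iff_tendsto_nhds[of "\<lambda>s. snd c (\<sigma> s)" 0] by (simp add: isCont_def \<sigma>(1))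
  have "openin X (fst c1)"
    using c(2) by (simp add: is_chart_def)
  from chart_eventually[OF c(1) p(2,3) this lim] \<sigma>(2)
  have ev1: "\<forall>\<^sub>F s in nhds 0. \<sigma> s \<in> fst c1"
    by (smt (verit) IntD2 eventually_mono)
  have "(transition c c1 has_derivative chart_jacobian c c1 p) (at (snd c (\<sigma> 0)))"
    using transition_has_derivative[OF compatible_sym[OF c(3)] p(2,3)] by (simp add: \<sigma>(1))
  from has_derivative_compose[OF \<sigma>(3)[unfolded has_vector_derivative_def] this]
  have 1: "((\<lambda>s. transition c c1 (snd c (\<sigma> s))) has_vector_derivative chart_jacobian c c1 p v) (at 0)"
    by (simp add: has_vector_derivative_def linear_scale[OF chart_jacobian_linear[OF compatible_sym[OF c(3)] p(2,3)]])
  have "\<forall>\<^sub>F s in nhds 0. transition c c1 (snd c (\<sigma> s)) \<in> W"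
    using \<sigma>(2) ev1
  proof eventually_elim
    case (elim s)
    hence "snd c1 (\<sigma> s) \<in> W"
      using W(2) by blast
    thus ?case
      using elim by (simp add: transition_apply[OF c(1)])
  qed
  from derivative_in_subspace[OF W(1) this 1]
  have "chart_jacobian c c1 p v \<in> W" .
  moreover have "v = chart_jacobian c1 c p (chart_jacobian c c1 p v)"
    using chart_jacobian_inverse[OF c(1,2) compatible_sym[OF c(3)] p(2,3)] by simp
  ultimately show "v \<in> chart_jacobian c1 c p ` W"
    by blast
next
  fix v assume "v \<in> chart_jacobian c1 c p ` W"
  then obtain w where w: "w \<in> W" "v = chart_jacobian c1 c p w"
    by blast
  \<comment> \<open>The curve in \<open>P\<close> whose \<open>c1\<close>-coordinates run along the
    line in direction \<open>w\<close>; where this line leaves the image of the chart the value is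
    unspecified, which is harmless away from \<open>s = 0\<close>.\<close>
  define \<sigma> where "\<sigma> s = inv_into (fst c1) (snd c1) (snd c1 p + s *\<^sub>R w)" for s :: real
  have x0: "snd c1 p \<in> W"
    using W(2) p by blast
  have lim: "((\<lambda>s. snd c1 p + s *\<^sub>R w) \<longlongrightarrow> snd c1 p + 0 *\<^sub>R w) (nhds 0)"
    by (intro tendsto_intros filterlim_ident)
  have "\<forall>\<^sub>F s in nhds 0. snd c1 p + s *\<^sub>R w \<in> snd c1 ` (fst c1 \<inter> fst c)"
    by (rule topological_tendstoD[OF lim overlap_open[OF c(2,1)]]) (use p in auto)
  hence ev: "\<forall>\<^sub>F s in nhds 0. \<sigma> s \<in> P \<inter> fst c \<and> snd c (\<sigma> s) = transition c1 c (snd c1 p + s *\<^sub>R w)"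
  proof eventually_elim
    case (elim s)
    then obtain q where q: "q \<in> fst c1" "q \<in> fst c" "snd c1 q = snd c1 p + s *\<^sub>R w"
      by auto
    have "\<sigma> s = q"
      by (simp add: \<sigma>_def flip: q(3)) (rule inv_into_f_f[OF chart_inj[OF c(2)] q(1)])
    moreover have "snd c1 q \<in> W \<inter> snd c1 ` fst c1"
      using q(1) x0 w(1) W(1) by (auto simp: q(3) intro: subspace_add subspace_scale) (metis imageI q(3))
    then obtain q' where "q' \<in> P \<inter> fst c1" "snd c1 q' = snd c1 q"
      using W(2) by (metis imageE)
    hence "q \<in> P"
      using chart_inj[OF c(2)] q(1) by (auto simp: inj_on_def)
    ultimately show ?case
      using q by (simp add: transition_apply[OF c(2)] flip: q(3))
  qed
  have "(transition c1 c has_derivative chart_jacobian c1 c p) (at (snd c1 p + 0 *\<^sub>R w))"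
    using transition_has_derivative[OF c(3) p(3,2)] by simp
  moreover have "((\<lambda>s. snd c1 p + s *\<^sub>R w) has_derivative (\<lambda>s. s *\<^sub>R w)) (at 0)"
    by (auto intro!: derivative_eq_intros)
  ultimately have "((\<lambda>s. transition c1 c (snd c1 p + s *\<^sub>R w)) has_derivative (\<lambda>s. chart_jacobian c1 c p (s *\<^sub>R w))) (at 0)"
    by (rule has_derivative_compose[rotated])
  hence "((\<lambda>s. transition c1 c (snd c1 p + s *\<^sub>R w)) has_vector_derivative v) (at 0)"
    by (simp add: has_vector_derivative_def w(2) linear_scale[OF chart_jacobian_linear[OF c(3) p(3,2)]])
  moreover from ev obtain U where U: "open U" "0 \<in> U" "\<And>s. s \<in> U \<Longrightarrow> snd c (\<sigma> s) = transition c1 c (snd c1 p + s *\<^sub>R w)"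
    unfolding eventually_nhds by blast
  note U(1,2)
  ultimately have "((\<lambda>s. snd c (\<sigma> s)) has_vector_derivative v) (at 0)"
    by (rule has_vector_derivative_transform_within_open) (rule U(3)[symmetric])
  moreover have "\<sigma> 0 = p"
    by (simp add: \<sigma>_def inv_into_f_f[OF chart_inj[OF c(2)] p(3)])
  moreover have "\<forall>\<^sub>F s in nhds 0. \<sigma> s \<in> P \<inter> fst c"
    using ev by eventually_elim simp
  ultimately show "v \<in> submanifold_tangent c P p"
    unfolding submanifold_tangent_def by blast
qed

text \<open>The slice chart need not belong to the atlas, it is only compatible with it; its
  invertible Jacobian transports the dimension of the slice.\<close>

lemma submanifold_tangent_dim:
  fixes c :: "('m, 'e::euclidean_space) chart"
  assumes M: "smooth_manifold X A" and P: "embedded_submanifold X A k P" "p \<in> P" and c: "c \<in> charts_at A p"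
  shows "subspace (submanifold_tangent c P p)" "dim (submanifold_tangent c P p) = k"
proof -
  have cA: "c \<in> A" "p \<in> fst c" "is_chart X c"
    using c M by (auto simp: charts_at_def smooth_manifold_def)
  obtain c1 :: "('m, 'e) chart" and W where c1: "is_chart X c1" "compatible c1 c" "p \<in> fst c1" "subspace W" "dim W = k"
      "snd c1 ` (P \<inter> fst c1) = W \<inter> snd c1 ` fst c1"
    using P cA(1) unfolding embedded_submanifold_def by blast
  note eq = submanifold_tangent_image[OF cA(3) c1(1,2) P(2) cA(2) c1(3,4,6)]
  note lin = chart_jacobian_linear[OF c1(2,3) cA(2)]
  show "subspace (submanifold_tangent c P p)"
    unfolding eq by (rule linear_subspace_image[OF lin c1(4)])
  have "inj_on (chart_jacobian c1 c p) UNIV"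
    by (rule inj_on_inverseI[where g = "chart_jacobian c c1 p"])
      (rule chart_jacobian_inverse[OF c1(1) cA(3) c1(2,3) cA(2)])
  thus "dim (submanifold_tangent c P p) = k"
    unfolding eq c1(5)[symmetric] by (intro dim_image_eq[OF lin]) (auto intro: inj_on_subset)
qed

section \<open>Jacobi fields\<close>

lemma continuous_on_bilinear_family:
  fixes F :: "'p::euclidean_space \<Rightarrow> 'a::euclidean_space \<Rightarrow> 'b::euclidean_space \<Rightarrow> 'c::euclidean_space"
  assumes bil: "\<And>y. y \<in> S \<Longrightarrow> bilinear (F y)" and cont: "\<And>u v. continuous_on S (\<lambda>y. F y u v)"
    and f: "continuous_on I f" "f ` I \<subseteq> S" and p: "continuous_on I p" and q: "continuous_on I q"
  shows "continuous_on I (\<lambda>t. F (f t) (p t) (q t))"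
proof -
  have "continuous_on I (\<lambda>t. \<Sum>i\<in>Basis. \<Sum>j\<in>Basis. ((p t \<bullet> i) * (q t \<bullet> j)) *\<^sub>R F (f t) i j)"
    by (intro continuous_on_sum continuous_on_scaleR continuous_on_mult continuous_on_inner p q
        continuous_on_const continuous_on_compose2[OF cont f])
  thus ?thesis
  proof (rule continuous_on_eq)
    fix t assume "t \<in> I"
    hence "f t \<in> S"
      using f(2) by blast
    thus "(\<Sum>i\<in>Basis. \<Sum>j\<in>Basis. ((p t \<bullet> i) * (q t \<bullet> j)) *\<^sub>R F (f t) i j) = F (f t) (p t) (q t)"
      by (rule bilinear_Basis_expand[OF bil, symmetric])
  qed
qed

text \<open>A linear family is treated as a bilinear one with an additional scalar argument, which
  is held at 1.\<close>

lemma has_vector_derivative_linear_family: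
  fixes D :: "'p::euclidean_space \<Rightarrow> 'a::euclidean_space \<Rightarrow> 'c::euclidean_space"
  assumes S: "open S" "x t \<in> S" "t \<in> I" and lin: "\<And>y. y \<in> S \<Longrightarrow> linear (D y)"
    and D: "\<And>v. ((\<lambda>y. D y v) has_derivative (\<lambda>d. H d v)) (at (x t))" and H: "\<And>d. linear (H d)"
    and x: "(x has_vector_derivative x') (at t within I)" and p: "(p has_vector_derivative p') (at t within I)"
  shows "((\<lambda>s. D (x s) (p s)) has_vector_derivative H x' (p t) + D (x t) p') (at t within I)"
proof -
  have lH: "linear (\<lambda>d. H d v)" for v
    by (rule has_derivative_linear[OF D])
  have bil: "bilinear (\<lambda>r v. r *\<^sub>R f v)" if "linear f" for f :: "'a \<Rightarrow> 'c"
    using that by (auto simp: bilinear_def linear_compose_scale_right intro!: linearI scaleR_left_distrib)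
  have "((\<lambda>s. 1 *\<^sub>R D (x s) (p s)) has_derivative
      (\<lambda>h. 1 *\<^sub>R H (h *\<^sub>R x') (p t) + 0 *\<^sub>R D (x t) (p t) + 1 *\<^sub>R D (x t) (h *\<^sub>R p'))) (at t within I)"
    by (rule has_derivative_bilinear_family[where F = "\<lambda>y (r::real) v. r *\<^sub>R D y v" and F' = "\<lambda>d r v. r *\<^sub>R H d v"
          and p = "\<lambda>_. 1" and p' = "\<lambda>_. 0", OF S bil[OF lin] has_derivative_scaleR_right[OF D] bil[OF H]
          x[unfolded has_vector_derivative_def] has_derivative_const p[unfolded has_vector_derivative_def]])
  thus ?thesis
    by (simp add: has_vector_derivative_def linear_scale[OF lH] linear_scale[OF lin[OF S(2)]] scaleR_add_right)
qed

context smooth_metric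
begin

lemma curvature_bilinear:
  assumes x: "x \<in> S"
  shows "bilinear (\<lambda>u w. curvature G x u v w)"
  unfolding curvature_eq[OF x] bilinear_def
  by (intro conjI allI linearI)
    (simp_all add: \<Gamma>_simps[OF x] bilinear_ladd[OF d\<Gamma>_bilinear[OF x]] bilinear_radd[OF d\<Gamma>_bilinear[OF x]]
      bilinear_lmul[OF d\<Gamma>_bilinear[OF x]] bilinear_rmul[OF d\<Gamma>_bilinear[OF x]]
      linear_add[OF d\<Gamma>_linear[OF x]] linear_scale[OF d\<Gamma>_linear[OF x]] algebra_simps)

lemma curvature_continuous: "continuous_on S (\<lambda>x. curvature G x u v w)"
proof -
  have "continuous_on S (\<lambda>x. \<Gamma> x u (\<Gamma> x v w))" for u v
    by (rule continuous_on_bilinear_family[where S = S])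
      (auto intro: \<Gamma>_bilinear \<Gamma>_continuous continuous_on_id)
  hence "continuous_on S (\<lambda>x. d\<Gamma> x u v w - d\<Gamma> x v u w + \<Gamma> x u (\<Gamma> x v w) - \<Gamma> x v (\<Gamma> x u w))"
    by (intro continuous_intros d\<Gamma>_continuous)
  thus ?thesis
    by (rule continuous_on_eq) (rule curvature_eq[symmetric])
qed

end

section \<open>Coordinate changes along the geodesic\<close>

locale geodesic_setting =
  fixes X :: "'m topology" and A :: "('m, 'e::euclidean_space) chart set" and g :: "('m, 'e) metric"
    and a b :: real and \<gamma> :: "real \<Rightarrow> 'm"
  assumes M: "semi_riemannian_manifold X A g" and \<gamma>: "geodesic X A g a b \<gamma>" and ab: "a < b"
begin

abbreviation "CA t \<equiv> charts_at A (\<gamma> t)"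
abbreviation "TS t \<equiv> tangent_space A (\<gamma> t)"
abbreviation "vel c t \<equiv> velocity A a b \<gamma> t c"
abbreviation "\<Gamma> c t \<equiv> christoffel (g c) (snd c (\<gamma> t))"
abbreviation "R c t u \<equiv> curvature (g c) (snd c (\<gamma> t)) (vel c t) u (vel c t)"
abbreviation "jac c c' t \<equiv> chart_jacobian c c' (\<gamma> t)"

lemma chart: "c \<in> A \<Longrightarrow> is_chart X c"
  using M by (auto simp: semi_riemannian_manifold_def smooth_manifold_def)

lemma compat: "c \<in> A \<Longrightarrow> c' \<in> A \<Longrightarrow> compatible c c'"
  using M by (auto simp: semi_riemannian_manifold_def smooth_manifold_def)

lemma CA_D: "c \<in> CA t \<Longrightarrow> c \<in> A" "c \<in> CA t \<Longrightarrow> \<gamma> t \<in> fst c"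
  by (auto simp: charts_at_def)

lemma metric: assumes c: "c \<in> A" shows "smooth_metric (snd c ` fst c) (g c)"
proof -
  have *: "\<forall>c\<in>A. (\<forall>x\<in>snd c ` fst c. bilinear (g c x) \<and> (\<forall>u v. g c x u v = g c x v u) \<and>
                (\<forall>u. (\<forall>v. g c x u v = 0) \<longrightarrow> u = 0)) \<and>
             (\<forall>u v. smooth_on (snd c ` fst c) (\<lambda>x. g c x u v))"
    using M unfolding semi_riemannian_manifold_def by (elim conjE)
  note m = bspec[OF conjunct1[OF bspec[OF * c]]]
  show ?thesis
  proof
    show "open (snd c ` fst c)"
      using chart[OF c] by (simp add: is_chart_def)
    show "smooth_on (snd c ` fst c) (\<lambda>x. g c x u v)" for u v
      using conjunct2[OF bspec[OF * c]] by blast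
    fix x u v assume x: "x \<in> snd c ` fst c"
    show "bilinear (g c x)" "g c x u v = g c x v u"
      using m[OF x] by blast+
    show "u = 0" if "\<And>w. g c x u w = 0"
      using m[OF x] that by blast
  qed
qed

lemma change:
  assumes c: "c \<in> A" "c' \<in> A"
  shows "metric_change (snd c ` fst c) (snd c' ` fst c') (g c) (g c') (snd c ` (fst c \<inter> fst c')) (transition c c')"
proof (intro metric_change.intro metric_change_axioms.intro metric c)
  show "open (snd c ` (fst c \<inter> fst c'))"
    by (rule overlap_open[OF chart chart]) (use c in auto)
  show "smooth_on (snd c ` (fst c \<inter> fst c')) (transition c c')"
    using compat[OF c] unfolding compatible_def by blast
  show "transition c c' ` snd c ` (fst c \<inter> fst c') \<subseteq> snd c' ` fst c'"
    by (auto simp: transition_apply[OF chart[OF c(1)]])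
  fix x u v assume "x \<in> snd c ` (fst c \<inter> fst c')"
  then obtain p where p: "p \<in> fst c \<inter> fst c'" "x = snd c p"
    by blast
  have *: "\<forall>c\<in>A. \<forall>c'\<in>A. \<forall>p\<in>fst c \<inter> fst c'. \<forall>u v.
        (let D = frechet_derivative (transition c c') (at (snd c p))
         in g c' (snd c' p) (D u) (D v) = g c (snd c p) u v)"
    using M unfolding semi_riemannian_manifold_def by (elim conjE)
  from bspec[OF bspec[OF bspec[OF * c(1)] c(2)] p(1)] p show "g c' (transition c c' x) (frechet_derivative (transition c c') (at x) u)
      (frechet_derivative (transition c c') (at x) v) = g c x u v"
    by (simp add: Let_def transition_apply[OF chart[OF c(1)]])
qed auto

lemma change_D: "c \<in> A \<Longrightarrow> c' \<in> A \<Longrightarrow> metric_change.D (transition c c') (snd c p) = chart_jacobian c c' p"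
  by (simp add: fun_eq_iff metric_change.D_def[OF change] chart_jacobian_def)

lemma \<gamma>_near:
  assumes t: "t \<in> {a..b}" and W: "openin X W" "\<gamma> t \<in> W"
  obtains d where "d > 0" "\<And>s. s \<in> {a..b} \<Longrightarrow> \<bar>s - t\<bar> < d \<Longrightarrow> \<gamma> s \<in> W"
proof -
  have "continuous_map (top_of_set {a..b}) X \<gamma>"
    using \<gamma> by (simp add: geodesic_def)
  from openin_continuous_map_preimage[OF this W(1)]
  have "openin (top_of_set {a..b}) {s \<in> {a..b}. \<gamma> s \<in> W}"
    by simp
  then obtain O' where O': "open O'" "{s \<in> {a..b}. \<gamma> s \<in> W} = {a..b} \<inter> O'"
    by (auto simp: openin_open)
  hence "t \<in> O'"
    using t W by blast
  with O'(1) obtain d where "d > 0" "ball t d \<subseteq> O'"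
    using open_contains_ball by blast
  with O'(2) show thesis
    by (intro that[of d]) (auto simp: dist_real_def abs_minus_commute ball_def)
qed

lemma CA_near:
  assumes t: "t \<in> {a..b}" and c: "c \<in> CA t"
  obtains d where "d > 0" "\<And>s. s \<in> {a..b} \<Longrightarrow> \<bar>s - t\<bar> < d \<Longrightarrow> c \<in> CA s"
proof -
  have "openin X (fst c)"
    using chart[OF CA_D(1)[OF c]] by (simp add: is_chart_def)
  from \<gamma>_near[OF t this CA_D(2)[OF c]] obtain d where "d > 0" "\<And>s. s \<in> {a..b} \<Longrightarrow> \<bar>s - t\<bar> < d \<Longrightarrow> \<gamma> s \<in> fst c"
    by blast
  with that[of d] show thesis
    using CA_D(1)[OF c] by (auto simp: charts_at_def)
qed

lemma CA_eventually:
  assumes t: "t \<in> I" "I \<subseteq> {a..b}" and c: "c \<in> CA t"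
  shows "\<forall>\<^sub>F s in at t within I. s \<in> I \<and> c \<in> CA s"
proof -
  obtain d where d: "d > 0" "\<And>s. s \<in> {a..b} \<Longrightarrow> \<bar>s - t\<bar> < d \<Longrightarrow> c \<in> CA s"
    using CA_near[of t c] t c by blast
  show ?thesis
    unfolding eventually_at by (rule exI[of _ d]) (use d t(2) in \<open>auto simp: dist_real_def\<close>)
qed

lemma CA_nonempty: "t \<in> {a..b} \<Longrightarrow> \<exists>c. c \<in> CA t"
proof -
  assume "t \<in> {a..b}"
  moreover have "continuous_map (top_of_set {a..b}) X \<gamma>"
    using \<gamma> by (simp add: geodesic_def)
  ultimately have "\<gamma> t \<in> topspace X"
    by (auto simp: continuous_map_def)
  moreover have "(\<Union>c\<in>A. fst c) = topspace X"
    using M by (simp add: semi_riemannian_manifold_def smooth_manifold_def)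
  ultimately obtain c where "c \<in> A" "\<gamma> t \<in> fst c"
    by (metis UN_iff)
  thus ?thesis
    unfolding charts_at_def by blast
qed

lemma position_deriv:
  assumes t: "t \<in> I" "I \<subseteq> {a..b}" and c: "c \<in> CA t"
  shows "((\<lambda>s. snd c (\<gamma> s)) has_vector_derivative vel c t) (at t within I)"
proof -
  have "(\<lambda>s. snd c (\<gamma> s)) differentiable (at t within {a..b})"
    using \<gamma> t c unfolding geodesic_def by blast
  hence "((\<lambda>s. snd c (\<gamma> s)) has_vector_derivative vel c t) (at t within {a..b})"
    using c by (simp add: velocity_def vector_derivative_works)
  thus ?thesis
    using t(2) by (rule has_vector_derivative_within_subset)
qed

lemma velocity_continuous:
  assumes I: "I \<subseteq> {a..b}" and c: "\<And>t. t \<in> I \<Longrightarrow> c \<in> CA t"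
  shows "continuous_on I (vel c)"
  unfolding continuous_on_eq_continuous_within
proof
  fix t assume t: "t \<in> I"
  have "differentiable_along A a b \<gamma> (velocity A a b \<gamma>)"
    using \<gamma> by (simp add: geodesic_def)
  hence "vel c differentiable (at t within {a..b})"
    using t I c[OF t] unfolding differentiable_along_def by blast
  hence "continuous (at t within {a..b}) (vel c)"
    by (rule differentiable_imp_continuous_within)
  thus "continuous (at t within I) (vel c)"
    using I by (rule continuous_within_subset)
qed

lemma position_continuous:
  assumes I: "I \<subseteq> {a..b}" and c: "\<And>t. t \<in> I \<Longrightarrow> c \<in> CA t"
  shows "continuous_on I (\<lambda>t. snd c (\<gamma> t))"
  unfolding continuous_on_eq_continuous_within
  by (intro ballI has_vector_derivative_continuous[OF position_deriv[OF _ I c]])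

text \<open>Here \<open>q\<close> is the covariant derivative of \<open>p\<close> in the chart
  \<open>c\<close>. Differentiating \<open>jac c c' s (p s)\<close> produces a second derivative of
  the coordinate change, and \<open>christoffel_change\<close> absorbs exactly this term; so
  covariant derivatives transform as vectors.\<close>

lemma derivative_change:
  assumes t: "t \<in> I" "I \<subseteq> {a..b}" and c: "c \<in> CA t" "c' \<in> CA t"
    and p: "(p has_vector_derivative q - \<Gamma> c t (vel c t) (p t)) (at t within I)"
    and p': "\<And>s. s \<in> I \<Longrightarrow> c \<in> CA s \<Longrightarrow> c' \<in> CA s \<Longrightarrow> p' s = jac c c' s (p s)"
  shows "vel c' t = jac c c' t (vel c t)"
    and "(p' has_vector_derivative jac c c' t q - \<Gamma> c' t (jac c c' t (vel c t)) (p' t)) (at t within I)"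
proof -
  note cA = CA_D(1)[OF c(1)] CA_D(1)[OF c(2)]
  interpret C: metric_change "snd c ` fst c" "snd c' ` fst c'" "g c" "g c'" "snd c ` (fst c \<inter> fst c')" "transition c c'"
    by (rule change[OF cA])
  have D: "C.D (snd c p) = chart_jacobian c c' p" for p
    by (rule change_D[OF cA])
  let ?x = "snd c (\<gamma> t)"
  have x: "?x \<in> snd c ` (fst c \<inter> fst c')"
    using CA_D[OF c(1)] CA_D[OF c(2)] by blast
  note tr = transition_apply[OF chart[OF cA(1)]]
  have tab: "t \<in> {a..b}"
    using t by blast
  have "((\<lambda>s. transition c c' (snd c (\<gamma> s))) has_vector_derivative jac c c' t (vel c t)) (at t within {a..b})"
    using has_derivative_compose[OF position_deriv[OF tab order_refl c(1), unfolded has_vector_derivative_def]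
        C.\<phi>_deriv[OF x]]
    by (simp add: has_vector_derivative_def linear_scale[OF C.D_linear[OF x], unfolded D] D)
  moreover have "\<forall>\<^sub>F s in at t within {a..b}. transition c c' (snd c (\<gamma> s)) = snd c' (\<gamma> s)"
    using CA_eventually[OF tab order_refl c(1)] by eventually_elim (simp add: tr CA_D(2))
  ultimately have "((\<lambda>s. snd c' (\<gamma> s)) has_vector_derivative jac c c' t (vel c t)) (at t within {a..b})"
    unfolding has_vector_derivative_def
    by (rule has_derivative_transform_eventually) (use tab CA_D(2)[OF c(1)] in \<open>auto simp: tr\<close>)
  from vector_derivative_within_closed_interval[OF ab tab this]
  show "vel c' t = jac c c' t (vel c t)"
    using c(2) by (simp add: velocity_def)
  have "((\<lambda>s. C.D (snd c (\<gamma> s)) (p s)) has_vector_derivative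
      C.H ?x (vel c t) (p t) + C.D ?x (q - \<Gamma> c t (vel c t) (p t))) (at t within I)"
    using C.H_bilinear[OF x] C.H_linear[OF x]
    by (intro has_vector_derivative_linear_family[OF C.U(1) x t(1) C.D_linear C.D_deriv[OF x] _ position_deriv[OF t c(1)] p])
      (auto simp: bilinear_def)
  also have "C.H ?x (vel c t) (p t) + C.D ?x (q - \<Gamma> c t (vel c t) (p t)) =
      jac c c' t q - \<Gamma> c' t (jac c c' t (vel c t)) (p' t)"
    using C.christoffel_change[OF x, of "vel c t" "p t"] p'[OF t(1) c] CA_D(2)[OF c(1)]
    by (simp add: D tr linear_diff[OF C.D_linear[OF x], unfolded D])
  finally have 1: "((\<lambda>s. C.D (snd c (\<gamma> s)) (p s)) has_vector_derivative
      jac c c' t q - \<Gamma> c' t (jac c c' t (vel c t)) (p' t)) (at t within I)" .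
  have "\<forall>\<^sub>F s in at t within I. C.D (snd c (\<gamma> s)) (p s) = p' s"
    using CA_eventually[OF t c(1)] CA_eventually[OF t c(2)] by eventually_elim (simp add: D p')
  from has_derivative_transform_eventually[OF 1[unfolded has_vector_derivative_def] this _ t(1)]
  show "(p' has_vector_derivative jac c c' t q - \<Gamma> c' t (jac c c' t (vel c t)) (p' t)) (at t within I)"
    unfolding has_vector_derivative_def by (simp add: D p'[OF t(1) c])
qed

text \<open>Only the first conclusion of \<open>derivative_change\<close> is wanted, so the zero
  field serves as \<open>p\<close>.\<close>

lemma velocity_change: "t \<in> {a..b} \<Longrightarrow> c \<in> CA t \<Longrightarrow> c' \<in> CA t \<Longrightarrow> vel c' t = jac c c' t (vel c t)"
  by (rule derivative_change(1)[where p = "\<lambda>_. 0" and q = 0 and I = "{a..b}" and p' = "\<lambda>s. jac c c' s 0"])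
    (auto simp: smooth_metric.\<Gamma>_simps[OF metric] CA_D)

lemma curvature_change: "t \<in> {a..b} \<Longrightarrow> c \<in> CA t \<Longrightarrow> c' \<in> CA t \<Longrightarrow> jac c c' t (R c t u) = R c' t (jac c c' t u)"
  using metric_change.curvature_change[OF change, of c c' "snd c (\<gamma> t)"]
  by (simp add: change_D CA_D velocity_change[of t c c'] transition_apply[OF chart])

lemma metric_invariant:
  "c \<in> CA t \<Longrightarrow> c' \<in> CA t \<Longrightarrow>
    g c' (snd c' (\<gamma> t)) (jac c c' t u) (jac c c' t v) = g c (snd c (\<gamma> t)) u v"
  using metric_change.iso[OF change, of c c' "snd c (\<gamma> t)"]
  by (simp add: change_D CA_D transition_apply[OF chart])

lemma jac_linear: "c \<in> CA t \<Longrightarrow> c' \<in> CA t \<Longrightarrow> linear (jac c c' t)"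
  by (intro chart_jacobian_linear compat) (auto dest: CA_D)

section \<open>Tangent vectors from their coordinates in one chart\<close>

definition tvec :: "('m, 'e) chart \<Rightarrow> real \<Rightarrow> 'e \<Rightarrow> ('m, 'e) tvector" where
  "tvec c t u c' = (if c' \<in> CA t then jac c c' t u else 0)"

lemma TS_change: "v \<in> TS t \<Longrightarrow> c \<in> CA t \<Longrightarrow> c' \<in> CA t \<Longrightarrow> v c' = jac c c' t (v c)"
proof -
  assume c: "c \<in> CA t" "c' \<in> CA t"
  assume "v \<in> TS t"
  hence "\<forall>c\<in>CA t. \<forall>c'\<in>CA t. v c' = frechet_derivative (transition c c') (at (snd c (\<gamma> t))) (v c)"
    unfolding tangent_space_def by (elim CollectE conjE)
  from bspec[OF bspec[OF this c(1)] c(2)] show ?thesis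
    by (simp only: chart_jacobian_def)
qed

lemma TS_0: "v \<in> TS t \<Longrightarrow> c \<notin> CA t \<Longrightarrow> v c = 0"
  unfolding tangent_space_def by (elim CollectE conjE) (erule allE, erule impE)

lemma TS_I:
  "(\<And>c. c \<notin> CA t \<Longrightarrow> v c = 0) \<Longrightarrow> (\<And>c c'. c \<in> CA t \<Longrightarrow> c' \<in> CA t \<Longrightarrow> v c' = jac c c' t (v c)) \<Longrightarrow> v \<in> TS t"
  unfolding tangent_space_def chart_jacobian_def mem_Collect_eq by (intro conjI allI ballI impI)

lemma tvec_self: "c \<in> CA t \<Longrightarrow> tvec c t u c = u"
  by (simp add: tvec_def chart_jacobian_id[OF chart] CA_D)

lemma tvec_TS: assumes c: "c \<in> CA t" shows "tvec c t u \<in> TS t"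
proof (rule TS_I)
  fix c' c'' assume c': "c' \<in> CA t" "c'' \<in> CA t"
  have "jac c' c'' t (jac c c' t u) = jac c c'' t u"
    by (rule chart_jacobian_cocycle) (use c c' in \<open>auto intro!: chart compat dest: CA_D\<close>)
  thus "tvec c t u c'' = jac c' c'' t (tvec c t u c')"
    using c' by (simp add: tvec_def)
qed (simp add: tvec_def)

lemma TS_eq_tvec: assumes "v \<in> TS t" "c \<in> CA t" shows "v = tvec c t (v c)"
proof
  fix c'
  show "v c' = tvec c t (v c) c'"
    using TS_change[OF assms, of c'] TS_0[OF assms(1), of c'] by (simp add: tvec_def)
qed

lemma tvec_0: "c \<in> CA t \<Longrightarrow> tvec c t 0 = (\<lambda>_. 0)"
  by (auto simp: tvec_def linear_0[OF jac_linear])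

text \<open>The Jacobi equation as a first-order system: \<open>K\<close> stands for the covariant
  derivative of \<open>J\<close>, and the Christoffel terms turn ordinary derivatives of coordinates
  into covariant ones. The equations are demanded in every chart, so that solutions on adjacent
  intervals can be joined even when no single chart covers both.\<close>

definition jacobi_system :: "real \<Rightarrow> real \<Rightarrow> (real \<Rightarrow> ('m, 'e) tvector) \<Rightarrow> (real \<Rightarrow> ('m, 'e) tvector) \<Rightarrow> bool" where
  "jacobi_system s e J K \<longleftrightarrow> (\<forall>t\<in>{s..e}. J t \<in> TS t \<and> K t \<in> TS t \<and> (\<forall>c\<in>CA t.
     ((\<lambda>r. J r c) has_vector_derivative K t c - \<Gamma> c t (vel c t) (J t c)) (at t within {s..e}) \<and>
     ((\<lambda>r. K r c) has_vector_derivative R c t (J t c) - \<Gamma> c t (vel c t) (K t c)) (at t within {s..e})))"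

lemma jacobi_systemD:
  assumes "jacobi_system s e J K" "t \<in> {s..e}"
  shows "J t \<in> TS t" "K t \<in> TS t"
    "c \<in> CA t \<Longrightarrow> ((\<lambda>r. J r c) has_vector_derivative K t c - \<Gamma> c t (vel c t) (J t c)) (at t within {s..e})"
    "c \<in> CA t \<Longrightarrow> ((\<lambda>r. K r c) has_vector_derivative R c t (J t c) - \<Gamma> c t (vel c t) (K t c)) (at t within {s..e})"
  using assms unfolding jacobi_system_def by blast+

lemma jacobi_system_subset:
  assumes J: "jacobi_system s e J K" and sub: "{s'..e'} \<subseteq> {s..e}"
  shows "jacobi_system s' e' J K"
  unfolding jacobi_system_def
proof (intro ballI conjI)
  fix t c assume t: "t \<in> {s'..e'}"
  hence t': "t \<in> {s..e}"
    using sub by blast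
  show "J t \<in> TS t" "K t \<in> TS t"
    by (rule jacobi_systemD[OF J t'])+
  assume c: "c \<in> CA t"
  show "((\<lambda>r. J r c) has_vector_derivative K t c - \<Gamma> c t (vel c t) (J t c)) (at t within {s'..e'})"
    "((\<lambda>r. K r c) has_vector_derivative R c t (J t c) - \<Gamma> c t (vel c t) (K t c)) (at t within {s'..e'})"
    by (rule has_vector_derivative_within_subset[OF jacobi_systemD(3)[OF J t' c] sub])
      (rule has_vector_derivative_within_subset[OF jacobi_systemD(4)[OF J t' c] sub])
qed

lemma jacobi_system_lincomb:
  assumes I: "{s..e} \<subseteq> {a..b}" and J: "jacobi_system s e J K" and J': "jacobi_system s e J' K'"
  shows "jacobi_system s e (\<lambda>t c. x *\<^sub>R J t c + y *\<^sub>R J' t c) (\<lambda>t c. x *\<^sub>R K t c + y *\<^sub>R K' t c)"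
  unfolding jacobi_system_def
proof (intro ballI conjI)
  fix t c assume t: "t \<in> {s..e}"
  have TS: "(\<lambda>c. x *\<^sub>R v c + y *\<^sub>R w c) \<in> TS t" if "v \<in> TS t" "w \<in> TS t" for v w
  proof (rule TS_I)
    fix c c' assume c: "c \<in> CA t" "c' \<in> CA t"
    show "x *\<^sub>R v c' + y *\<^sub>R w c' = jac c c' t (x *\<^sub>R v c + y *\<^sub>R w c)"
      by (simp add: TS_change[OF that(1) c] TS_change[OF that(2) c] linear_add[OF jac_linear[OF c]]
          linear_scale[OF jac_linear[OF c]])
  qed (simp add: TS_0[OF that(1)] TS_0[OF that(2)])
  show "(\<lambda>c. x *\<^sub>R J t c + y *\<^sub>R J' t c) \<in> TS t" "(\<lambda>c. x *\<^sub>R K t c + y *\<^sub>R K' t c) \<in> TS t"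
    by (intro TS jacobi_systemD[OF J t] jacobi_systemD[OF J' t])+
  assume c: "c \<in> CA t"
  have xS: "snd c (\<gamma> t) \<in> snd c ` fst c"
    using CA_D(2)[OF c] by blast
  note m = metric[OF CA_D(1)[OF c]]
  note s = smooth_metric.\<Gamma>_simps[OF m xS] linear_add[OF smooth_metric.curvature_linear[OF m xS]]
    linear_scale[OF smooth_metric.curvature_linear[OF m xS]]
  have "((\<lambda>r. x *\<^sub>R J r c + y *\<^sub>R J' r c) has_vector_derivative
      x *\<^sub>R (K t c - \<Gamma> c t (vel c t) (J t c)) + y *\<^sub>R (K' t c - \<Gamma> c t (vel c t) (J' t c))) (at t within {s..e})"
    by (intro has_vector_derivative_add jacobi_systemD(3)[OF J t c]
        jacobi_systemD(3)[OF J' t c] bounded_linear.has_vector_derivative[OF bounded_linear_scaleR_right])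
  thus "((\<lambda>r. x *\<^sub>R J r c + y *\<^sub>R J' r c) has_vector_derivative
      (x *\<^sub>R K t c + y *\<^sub>R K' t c) - \<Gamma> c t (vel c t) (x *\<^sub>R J t c + y *\<^sub>R J' t c)) (at t within {s..e})"
    by (simp add: s algebra_simps)
  have "((\<lambda>r. x *\<^sub>R K r c + y *\<^sub>R K' r c) has_vector_derivative
      x *\<^sub>R (R c t (J t c) - \<Gamma> c t (vel c t) (K t c)) + y *\<^sub>R (R c t (J' t c) - \<Gamma> c t (vel c t) (K' t c))) (at t within {s..e})"
    by (intro has_vector_derivative_add jacobi_systemD(4)[OF J t c]
        jacobi_systemD(4)[OF J' t c] bounded_linear.has_vector_derivative[OF bounded_linear_scaleR_right])
  thus "((\<lambda>r. x *\<^sub>R K r c + y *\<^sub>R K' r c) has_vector_derivative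
      R c t (x *\<^sub>R J t c + y *\<^sub>R J' t c) - \<Gamma> c t (vel c t) (x *\<^sub>R K t c + y *\<^sub>R K' t c)) (at t within {s..e})"
    by (simp add: s algebra_simps)
qed

end

lemma has_vector_derivative_join:
  fixes f h :: "real \<Rightarrow> 'a::real_normed_vector"
  assumes "s \<le> m" "m \<le> e" "t \<in> {s..e}" and eq: "f m = h m" "f' m = h' m"
    and f: "t \<in> {s..m} \<Longrightarrow> (f has_vector_derivative f' t) (at t within {s..m})"
    and h: "t \<in> {m..e} \<Longrightarrow> (h has_vector_derivative h' t) (at t within {m..e})"
  shows "((\<lambda>t. if t \<le> m then f t else h t) has_vector_derivative (if t \<le> m then f' t else h' t)) (at t within {s..e})"
proof -
  have c: "closure {s..m} \<inter> closure {m..e} = {m}"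
    using assms(1,2) by auto
  have u: "insert m {s..m} = {s..m}" "insert m {m..e} = {m..e}"
    using assms(1,2) by auto
  have "((\<lambda>t. if t \<in> {s..m} then f t else h t) has_vector_derivative (if t \<in> {s..m} then f' t else h' t))
      (at t within {s..e})"
    by (rule has_vector_derivative_If_within_closures[where T = "{m..e}"])
      (use assms in \<open>auto simp: c u\<close>)
  hence "((\<lambda>t. if t \<in> {s..m} then f t else h t) has_vector_derivative (if t \<le> m then f' t else h' t))
      (at t within {s..e})"
    using assms(3) by simp
  thus ?thesis
    by (rule has_vector_derivative_transform[OF assms(3), rotated]) simp
qed

context geodesic_setting
begin

section \<open>Existence and uniqueness of Jacobi fields\<close>

definition jacobi_matrix :: "('m, 'e) chart \<Rightarrow> real \<Rightarrow> 'e \<times> 'e \<Rightarrow> 'e \<times> 'e" where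
  "jacobi_matrix c t x = (snd x - \<Gamma> c t (vel c t) (fst x), R c t (fst x) - \<Gamma> c t (vel c t) (snd x))"

lemma jacobi_matrix_linear:
  assumes c: "c \<in> CA t"
  shows "linear (jacobi_matrix c t)"
proof -
  have xS: "snd c (\<gamma> t) \<in> snd c ` fst c"
    using CA_D(2)[OF c] by blast
  note m = metric[OF CA_D(1)[OF c]]
  note s = smooth_metric.\<Gamma>_simps[OF m xS] linear_add[OF smooth_metric.curvature_linear[OF m xS]]
    linear_scale[OF smooth_metric.curvature_linear[OF m xS]]
  show ?thesis
    by (intro linearI) (simp_all add: jacobi_matrix_def s algebra_simps)
qed

lemma jacobi_matrix_continuous:
  assumes I: "I \<subseteq> {a..b}" and c: "c \<in> A" "\<And>t. t \<in> I \<Longrightarrow> c \<in> CA t"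
  shows "continuous_on I (\<lambda>t. jacobi_matrix c t x)"
proof -
  note m = metric[OF c(1)]
  note pc = position_continuous[OF I c(2)] and vc = velocity_continuous[OF I c(2)]
  have sub: "(\<lambda>t. snd c (\<gamma> t)) ` I \<subseteq> snd c ` fst c"
    using c(2) by (auto dest: CA_D)
  have G: "continuous_on I (\<lambda>t. \<Gamma> c t (vel c t) u)" for u
    by (rule continuous_on_bilinear_family[OF smooth_metric.\<Gamma>_bilinear[OF m] smooth_metric.\<Gamma>_continuous[OF m]
          pc sub vc continuous_on_const])
  have "continuous_on I (\<lambda>t. R c t u)" for u
    by (rule continuous_on_bilinear_family[where F = "\<lambda>y v w. curvature (g c) y v u w",
          OF smooth_metric.curvature_bilinear[OF m] smooth_metric.curvature_continuous[OF m] pc sub vc vc])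
  thus ?thesis
    unfolding jacobi_matrix_def by (intro continuous_intros G)
qed

lemma jacobi_system_chart:
  assumes J: "jacobi_system s e J K" and t: "t \<in> {s..e}" and c: "c \<in> CA t"
  shows "((\<lambda>t. (J t c, K t c)) has_vector_derivative jacobi_matrix c t (J t c, K t c)) (at t within {s..e})"
  using has_derivative_Pair[OF jacobi_systemD(3)[OF J t c, unfolded has_vector_derivative_def]
      jacobi_systemD(4)[OF J t c, unfolded has_vector_derivative_def]]
  by (simp add: has_vector_derivative_def jacobi_matrix_def)

text \<open>It is enough to solve the system in one chart, since velocity, curvature and covariant
  derivative all transform by the Jacobian of the coordinate change.\<close>

lemma jacobi_systemI_chart:
  assumes I: "{s..e} \<subseteq> {a..b}" and c: "\<And>t. t \<in> {s..e} \<Longrightarrow> c \<in> CA t"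
    and y: "\<And>t. t \<in> {s..e} \<Longrightarrow> (y has_vector_derivative jacobi_matrix c t (y t)) (at t within {s..e})"
  shows "jacobi_system s e (\<lambda>t. tvec c t (fst (y t))) (\<lambda>t. tvec c t (snd (y t)))"
  unfolding jacobi_system_def
proof (intro ballI conjI tvec_TS)
  fix t assume t: "t \<in> {s..e}"
  show ct: "c \<in> CA t" "c \<in> CA t"
    using c[OF t] by auto
  have tab: "t \<in> {a..b}"
    using t I by blast
  fix c' assume c': "c' \<in> CA t"
  have y1: "((\<lambda>t. fst (y t)) has_vector_derivative snd (y t) - \<Gamma> c t (vel c t) (fst (y t))) (at t within {s..e})"
    using has_derivative_fst[OF y[OF t, unfolded has_vector_derivative_def]]
    by (simp add: has_vector_derivative_def jacobi_matrix_def)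
  have y2: "((\<lambda>t. snd (y t)) has_vector_derivative R c t (fst (y t)) - \<Gamma> c t (vel c t) (snd (y t))) (at t within {s..e})"
    using has_derivative_snd[OF y[OF t, unfolded has_vector_derivative_def]]
    by (simp add: has_vector_derivative_def jacobi_matrix_def)
  have tv: "tvec c r u c' = jac c c' r u" if "c' \<in> CA r" for r u
    using that by (simp add: tvec_def)
  show "((\<lambda>r. tvec c r (fst (y r)) c') has_vector_derivative
      tvec c t (snd (y t)) c' - \<Gamma> c' t (vel c' t) (tvec c t (fst (y t)) c')) (at t within {s..e})"
    using derivative_change(2)[OF t I ct(1) c' y1, of "\<lambda>r. tvec c r (fst (y r)) c'"]
    by (simp add: tv c' velocity_change[OF tab ct(1) c'])
  show "((\<lambda>r. tvec c r (snd (y r)) c') has_vector_derivative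
      R c' t (tvec c t (fst (y t)) c') - \<Gamma> c' t (vel c' t) (tvec c t (snd (y t)) c')) (at t within {s..e})"
    using derivative_change(2)[OF t I ct(1) c' y2, of "\<lambda>r. tvec c r (snd (y r)) c'"]
      curvature_change[OF tab ct(1) c']
    by (simp add: tv c' velocity_change[OF tab ct(1) c'])
qed

text \<open>Existence and uniqueness for initial data at the left end. In this form the property
  passes to concatenated intervals, so it spreads from short intervals to \<open>[a, b]\<close> by
  bisection.\<close>

definition solvable :: "real \<Rightarrow> real \<Rightarrow> bool" where
  "solvable s e \<longleftrightarrow>
     (\<forall>p\<in>TS s. \<forall>q\<in>TS s. \<exists>J K. jacobi_system s e J K \<and> J s = p \<and> K s = q) \<and>
     (\<forall>J K. jacobi_system s e J K \<and> J s = (\<lambda>_. 0) \<and> K s = (\<lambda>_. 0) \<longrightarrow>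
        (\<forall>t\<in>{s..e}. J t = (\<lambda>_. 0) \<and> K t = (\<lambda>_. 0)))"

lemma solvable_local:
  assumes x: "x \<in> {a..b}"
  shows "\<exists>d>0. \<forall>s e. s \<le> x \<and> x \<le> e \<and> e - s < d \<longrightarrow> a \<le> s \<and> e \<le> b \<longrightarrow> solvable s e"
proof -
  obtain c where c: "c \<in> CA x"
    using CA_nonempty[OF x] by blast
  obtain d0 where d0: "d0 > 0" "\<And>s. s \<in> {a..b} \<Longrightarrow> \<bar>s - x\<bar> < d0 \<Longrightarrow> c \<in> CA s"
    using CA_near[OF x c] by blast
  \<comment> \<open>Half of \<open>d0\<close> leaves a compact interval on which \<open>c\<close> is
    still a chart, so the coefficients of the system are bounded there.\<close>
  define I where "I = {max a (x - d0 / 2)..min b (x + d0 / 2)}"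
  have I: "I \<subseteq> {a..b}" "\<And>t. t \<in> I \<Longrightarrow> c \<in> CA t"
    using d0 by (auto simp: I_def abs_if)
  have "continuous_on I (\<lambda>t. \<Sum>i\<in>Basis. norm (jacobi_matrix c t i))"
    by (intro continuous_on_sum continuous_on_norm jacobi_matrix_continuous I CA_D(1)[OF c])
  hence "bounded ((\<lambda>t. \<Sum>i\<in>Basis. norm (jacobi_matrix c t i)) ` I)"
    unfolding I_def by (intro compact_imp_bounded compact_continuous_image compact_Icc)
  then obtain C0 where C0: "\<forall>t\<in>I. \<bar>\<Sum>i\<in>Basis. norm (jacobi_matrix c t i)\<bar> \<le> C0"
    unfolding bounded_iff by auto
  define C where "C = max C0 0"
  have C: "C \<ge> 0"
    by (simp add: C_def)
  have bound: "norm (jacobi_matrix c t v) \<le> C * norm v" if t: "t \<in> I" for t v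
  proof -
    have "norm (jacobi_matrix c t v) \<le> (\<Sum>i\<in>Basis. norm (jacobi_matrix c t i)) * norm v"
      by (rule linear_norm_le[OF jacobi_matrix_linear[OF I(2)[OF t]]])
    also have "\<dots> \<le> C * norm v"
      using bspec[OF C0 t] by (intro mult_right_mono) (auto simp: C_def)
    finally show ?thesis .
  qed
  \<comment> \<open>\<open>d0 / 2\<close> keeps \<open>{s..e}\<close> inside \<open>I\<close>, and
    \<open>1 / (2 * (C + 1))\<close> yields the bound \<open>C * (e - s) \<le> 1 / 2\<close> of the
    contraction argument, also when \<open>C = 0\<close>.\<close>
  define d where "d = min (d0 / 2) (1 / (2 * (C + 1)))"
  have d: "d > 0"
    using d0(1) C by (simp add: d_def)
  have "solvable s e" if se: "s \<le> x" "x \<le> e" "e - s < d" "a \<le> s" "e \<le> b" for s e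
  proof -
    have sub: "{s..e} \<subseteq> I" "{s..e} \<subseteq> {a..b}"
      using se by (auto simp: I_def d_def)
    have s: "s \<in> {s..e}"
      using se by simp
    have "e - s \<le> 1 / (2 * (C + 1))"
      using se(3) by (simp add: d_def)
    hence "C * (e - s) \<le> C * (1 / (2 * (C + 1)))"
      using C by (intro mult_left_mono)
    also have "\<dots> \<le> 1 / 2"
      using C by (simp add: field_simps)
    finally have small: "C * (e - s) \<le> 1 / 2" .
    have cI: "c \<in> CA t" if "t \<in> {s..e}" for t
      using I(2) sub(1) that by blast
    have bound': "norm (jacobi_matrix c t v) \<le> C * norm v" if "t \<in> {s..e}" for t v
      using bound sub(1) that by blast
    show ?thesis
      unfolding solvable_def
    proof (intro conjI ballI allI impI)
      fix p q assume pq: "p \<in> TS s" "q \<in> TS s"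
      have "s \<le> e"
        using se by simp
      then obtain y where y: "y s = (p c, q c)"
          "\<And>t. t \<in> {s..e} \<Longrightarrow> (y has_vector_derivative jacobi_matrix c t (y t)) (at t within {s..e})"
        using linear_ode_existence[of s e "jacobi_matrix c" C "(p c, q c)", OF _ jacobi_matrix_linear[OF cI]
            jacobi_matrix_continuous[OF sub(2) CA_D(1)[OF c] cI] bound' C small] by blast
      have "jacobi_system s e (\<lambda>t. tvec c t (fst (y t))) (\<lambda>t. tvec c t (snd (y t)))"
        by (rule jacobi_systemI_chart[OF sub(2) cI y(2)])
      moreover have "tvec c s (fst (y s)) = p" "tvec c s (snd (y s)) = q"
        using TS_eq_tvec[OF pq(1) cI[OF s]] TS_eq_tvec[OF pq(2) cI[OF s]] by (simp_all add: y(1))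
      ultimately show "\<exists>J K. jacobi_system s e J K \<and> J s = p \<and> K s = q"
        by (intro exI conjI)
    next
      fix J K t
      assume J: "jacobi_system s e J K \<and> J s = (\<lambda>_. 0) \<and> K s = (\<lambda>_. 0)" and t: "t \<in> {s..e}"
      have "(J t c, K t c) = 0"
      proof (rule linear_ode_uniqueness[where M = "jacobi_matrix c" and y = "\<lambda>t. (J t c, K t c)", OF bound' C small _ _ t])
        show "(J s c, K s c) = 0"
          using J by (simp add: zero_prod_def)
        show "((\<lambda>t. (J t c, K t c)) has_vector_derivative jacobi_matrix c r (J r c, K r c)) (at r within {s..e})"
          if "r \<in> {s..e}" for r
          by (rule jacobi_system_chart[OF conjunct1[OF J] that cI[OF that]])
      qed
      hence 0: "J t c = 0" "K t c = 0"
        by (simp_all add: zero_prod_def)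
      show "J t = (\<lambda>_. 0)"
        using TS_eq_tvec[OF jacobi_systemD(1)[OF conjunct1[OF J] t] cI[OF t]] by (simp add: 0 tvec_0[OF cI[OF t]])
      show "K t = (\<lambda>_. 0)"
        using TS_eq_tvec[OF jacobi_systemD(2)[OF conjunct1[OF J] t] cI[OF t]] by (simp add: 0 tvec_0[OF cI[OF t]])
    qed
  qed
  with d show ?thesis
    by blast
qed

lemma jacobi_system_join:
  assumes J: "jacobi_system s m J K" and J': "jacobi_system m e J' K'" and eq: "J m = J' m" "K m = K' m"
    and sme: "s \<le> m" "m \<le> e"
  shows "jacobi_system s e (\<lambda>t. if t \<le> m then J t else J' t) (\<lambda>t. if t \<le> m then K t else K' t)"
  unfolding jacobi_system_def
proof (intro ballI conjI)
  fix t assume t: "t \<in> {s..e}"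
  show "(if t \<le> m then J t else J' t) \<in> TS t" "(if t \<le> m then K t else K' t) \<in> TS t"
    using jacobi_systemD(1,2)[OF J, of t] jacobi_systemD(1,2)[OF J', of t] t by auto
  fix c assume c: "c \<in> CA t"
  have "((\<lambda>r. if r \<le> m then J r c else J' r c) has_vector_derivative
      (if t \<le> m then K t c - \<Gamma> c t (vel c t) (J t c) else K' t c - \<Gamma> c t (vel c t) (J' t c))) (at t within {s..e})"
    by (rule has_vector_derivative_join[OF sme t]) (simp_all add: eq jacobi_systemD(3)[OF J _ c] jacobi_systemD(3)[OF J' _ c])
  thus "((\<lambda>r. (if r \<le> m then J r else J' r) c) has_vector_derivative
      (if t \<le> m then K t else K' t) c - \<Gamma> c t (vel c t) ((if t \<le> m then J t else J' t) c)) (at t within {s..e})"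
    by (simp add: if_distrib[of "\<lambda>f. f c"] cong: if_cong split: if_splits)
  have "((\<lambda>r. if r \<le> m then K r c else K' r c) has_vector_derivative
      (if t \<le> m then R c t (J t c) - \<Gamma> c t (vel c t) (K t c) else R c t (J' t c) - \<Gamma> c t (vel c t) (K' t c))) (at t within {s..e})"
    by (rule has_vector_derivative_join[OF sme t]) (simp_all add: eq jacobi_systemD(4)[OF J _ c] jacobi_systemD(4)[OF J' _ c])
  thus "((\<lambda>r. (if r \<le> m then K r else K' r) c) has_vector_derivative
      R c t ((if t \<le> m then J t else J' t) c) - \<Gamma> c t (vel c t) ((if t \<le> m then K t else K' t) c)) (at t within {s..e})"
    by (simp add: if_distrib[of "\<lambda>f. f c"] cong: if_cong split: if_splits)
qed

lemma solvable_trans: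
  assumes 1: "solvable s m" and 2: "solvable m e" and sme: "s \<le> m" "m \<le> e"
  shows "solvable s e"
  unfolding solvable_def
proof (intro conjI ballI allI impI)
  fix p q assume "p \<in> TS s" "q \<in> TS s"
  then obtain J K where J: "jacobi_system s m J K" "J s = p" "K s = q"
    using 1 unfolding solvable_def by blast
  have "m \<in> {s..m}"
    using sme by simp
  from jacobi_systemD(1,2)[OF J(1) this] obtain J' K' where J': "jacobi_system m e J' K'" "J' m = J m" "K' m = K m"
    using 2 unfolding solvable_def by blast
  from jacobi_system_join[OF J(1) J'(1) J'(2,3)[symmetric] sme]
  show "\<exists>J K. jacobi_system s e J K \<and> J s = p \<and> K s = q"
    using J(2,3) sme(1)
    by (intro exI[of _ "\<lambda>t. if t \<le> m then J t else J' t"] exI[of _ "\<lambda>t. if t \<le> m then K t else K' t"] conjI) simp_all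
next
  fix J K t
  assume J: "jacobi_system s e J K \<and> J s = (\<lambda>_. 0) \<and> K s = (\<lambda>_. 0)" and t: "t \<in> {s..e}"
  have J1: "jacobi_system s m J K" and J2: "jacobi_system m e J K"
    using J sme by (auto intro: jacobi_system_subset)
  have z1: "J t = (\<lambda>_. 0) \<and> K t = (\<lambda>_. 0)" if "t \<in> {s..m}" for t
    using 1 J1 J that unfolding solvable_def by blast
  have z2: "J t = (\<lambda>_. 0) \<and> K t = (\<lambda>_. 0)" if "t \<in> {m..e}" for t
  proof -
    have "m \<in> {s..m}"
      using sme by simp
    from z1[OF this] show ?thesis
      using 2 J2 that unfolding solvable_def by blast
  qed
  show "J t = (\<lambda>_. 0)" "K t = (\<lambda>_. 0)"
    using z1[of t] z2[of t] t by (cases "t \<le> m"; simp)+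
qed

lemma solvable: "solvable a b"
proof -
  have "a \<le> b"
    using ab by simp
  hence "a \<le> a \<and> b \<le> b \<longrightarrow> solvable a b"
  proof (induction rule: Bolzano[where P = "\<lambda>x y. a \<le> x \<and> y \<le> b \<longrightarrow> solvable x y"])
    case (trans x y z)
    thus ?case
      using solvable_trans[of x y z] by linarith
  next
    case (local x)
    hence "x \<in> {a..b}"
      by simp
    from solvable_local[OF this] show ?case .
  qed
  thus ?thesis
    by simp
qed

lemma jacobi_system_exists:
  assumes c: "c \<in> CA a"
  obtains J K where "jacobi_system a b J K" "J a c = v" "K a c = w"
proof -
  obtain J K where "jacobi_system a b J K" "J a = tvec c a v" "K a = tvec c a w"
    using bspec[OF bspec[OF conjunct1[OF solvable[unfolded solvable_def]] tvec_TS[OF c]] tvec_TS[OF c]]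
    by blast
  with that show thesis
    using tvec_self[OF c] by simp
qed

lemma jacobi_system_unique:
  assumes J: "jacobi_system a b J K" and c: "c \<in> CA a" "J a c = 0" "K a c = 0" and t: "t \<in> {a..b}"
  shows "J t c' = 0"
proof -
  have a: "a \<in> {a..b}"
    using ab by simp
  have 0: "J a = (\<lambda>_. 0)" "K a = (\<lambda>_. 0)"
    using TS_eq_tvec[OF jacobi_systemD(1)[OF J a] c(1)] TS_eq_tvec[OF jacobi_systemD(2)[OF J a] c(1)]
    by (simp_all add: c(2,3) tvec_0[OF c(1)])
  have "\<forall>t\<in>{a..b}. J t = (\<lambda>_. 0) \<and> K t = (\<lambda>_. 0)"
    using conjunct2[OF solvable[unfolded solvable_def], THEN spec, THEN spec, THEN mp, OF conjI[OF J conjI[OF 0]]] .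
  from bspec[OF this t] show ?thesis
    by simp
qed

section \<open>Jacobi fields and solutions of the first-order system\<close>

lemma covariant_derivative_eq:
  assumes t: "t \<in> {a..b}" and c: "c \<in> CA t"
    and J: "((\<lambda>r. J r c) has_vector_derivative k - \<Gamma> c t (vel c t) (J t c)) (at t within {a..b})"
  shows "covariant_derivative A g a b \<gamma> J t c = k"
  using vector_derivative_within_closed_interval[OF ab t J] c by (simp add: covariant_derivative_def)

lemma jacobi_system_covariant_derivative:
  assumes J: "jacobi_system a b J K" and t: "t \<in> {a..b}"
  shows "covariant_derivative A g a b \<gamma> J t = K t"
proof
  fix c
  show "covariant_derivative A g a b \<gamma> J t c = K t c"
  proof (cases "c \<in> CA t")
    case True
    show ?thesis
      by (rule covariant_derivative_eq[where J = J, OF t True jacobi_systemD(3)[OF J t True]])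
  next
    case False
    thus ?thesis
      using TS_0[OF jacobi_systemD(2)[OF J t] False] by (simp add: covariant_derivative_def)
  qed
qed

lemma jacobi_system_jacobi_field:
  assumes J: "jacobi_system a b J K"
  shows "jacobi_field A g a b \<gamma> J"
proof -
  let ?K = "covariant_derivative A g a b \<gamma> J"
  note K = jacobi_system_covariant_derivative[OF J]
  have dK: "((\<lambda>r. ?K r c) has_vector_derivative R c t (J t c) - \<Gamma> c t (vel c t) (?K t c)) (at t within {a..b})"
    if "t \<in> {a..b}" "c \<in> CA t" for t c
    unfolding K[OF that(1)]
    by (rule has_vector_derivative_transform[OF that(1) _ jacobi_systemD(4)[OF J that]]) (simp add: K)
  show ?thesis
    unfolding jacobi_field_def field_along_def differentiable_along_def
  proof (intro conjI ballI)
    fix t assume t: "t \<in> {a..b}"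
    show "J t \<in> TS t"
      by (rule jacobi_systemD(1)[OF J t])
    fix c assume c: "c \<in> CA t"
    show "(\<lambda>s. J s c) differentiable (at t within {a..b})" "(\<lambda>s. ?K s c) differentiable (at t within {a..b})"
      using jacobi_systemD(3)[OF J t c] dK[OF t c] by (auto intro: differentiableI_vector)
    show "covariant_derivative A g a b \<gamma> ?K t c - R c t (J t c) = 0"
      using covariant_derivative_eq[where J = ?K, OF t c dK[OF t c]] by simp
  qed
qed

text \<open>What has to be added to the definition of a Jacobi field is that the covariant
  derivative is a tangent vector, that is, consistent across charts;
  \<open>derivative_change\<close> supplies this.\<close>

lemma jacobi_field_jacobi_system:
  assumes J: "jacobi_field A g a b \<gamma> J"
  shows "jacobi_system a b J (covariant_derivative A g a b \<gamma> J)"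
proof -
  let ?K = "covariant_derivative A g a b \<gamma> J"
  have JTS: "J t \<in> TS t" if "t \<in> {a..b}" for t
    using J that unfolding jacobi_field_def field_along_def by blast
  have dJ: "((\<lambda>r. J r c) has_vector_derivative ?K t c - \<Gamma> c t (vel c t) (J t c)) (at t within {a..b})"
    if "t \<in> {a..b}" "c \<in> CA t" for t c
  proof -
    have "(\<lambda>r. J r c) differentiable (at t within {a..b})"
      using J that unfolding jacobi_field_def differentiable_along_def by blast
    thus ?thesis
      using that(2) by (simp add: covariant_derivative_def vector_derivative_works)
  qed
  have dK: "((\<lambda>r. ?K r c) has_vector_derivative R c t (J t c) - \<Gamma> c t (vel c t) (?K t c)) (at t within {a..b})"
    if "t \<in> {a..b}" "c \<in> CA t" for t c
  proof -
    have "(\<lambda>r. ?K r c) differentiable (at t within {a..b})"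
      using J that unfolding jacobi_field_def differentiable_along_def by blast
    hence "((\<lambda>r. ?K r c) has_vector_derivative
        covariant_derivative A g a b \<gamma> ?K t c - \<Gamma> c t (vel c t) (?K t c)) (at t within {a..b})"
      using that(2) by (simp add: covariant_derivative_def[of A g a b \<gamma> ?K] vector_derivative_works)
    moreover have "covariant_derivative A g a b \<gamma> ?K t c - R c t (J t c) = 0"
      using J that unfolding jacobi_field_def by blast
    ultimately show ?thesis
      by simp
  qed
  have "?K t \<in> TS t" if t: "t \<in> {a..b}" for t
  proof (rule TS_I)
    fix c c' assume c: "c \<in> CA t" "c' \<in> CA t"
    have "((\<lambda>r. J r c') has_vector_derivative jac c c' t (?K t c) - \<Gamma> c' t (jac c c' t (vel c t)) (J t c')) (at t within {a..b})"
      using derivative_change(2)[OF t order_refl c dJ[OF t c(1)], of "\<lambda>r. J r c'"] TS_change[OF JTS] by blast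
    from covariant_derivative_eq[where J = J, OF t c(2) this[folded velocity_change[OF t c]]]
    show "?K t c' = jac c c' t (?K t c)" .
  qed (simp add: covariant_derivative_def)
  with JTS dJ dK show ?thesis
    unfolding jacobi_system_def by blast
qed

text \<open>The pair symmetry of the curvature makes \<open>g(DJ, J') - g(J, DJ')\<close> constant along \<open>\<gamma>\<close>.\<close>

lemma wronskian_constant:
  assumes J: "jacobi_system a b J K" and J': "jacobi_system a b J' K'"
    and t: "t \<in> {a..b}" "s \<in> {a..b}" and c: "c \<in> CA t" "c' \<in> CA s"
  shows "g c (snd c (\<gamma> t)) (K t c) (J' t c) - g c (snd c (\<gamma> t)) (J t c) (K' t c) =
    g c' (snd c' (\<gamma> s)) (K s c') (J' s c') - g c' (snd c' (\<gamma> s)) (J s c') (K' s c')"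
proof -
  define w where "w c t = g c (snd c (\<gamma> t)) (K t c) (J' t c) - g c (snd c (\<gamma> t)) (J t c) (K' t c)" for c t
  have inv: "w c t = w c' t" if "t \<in> {a..b}" "c \<in> CA t" "c' \<in> CA t" for t c c'
    using jacobi_systemD(1,2)[OF J that(1)] jacobi_systemD(1,2)[OF J' that(1)] that(2,3)
    by (simp add: w_def TS_change[of _ t c c'] metric_invariant[of c t c'])
  \<comment> \<open>The Wronskian does not depend on the chart, so choosing any chart at each
    instant gives one function on \<open>[a, b]\<close>, which near \<open>t\<close> equals the
    expression in a fixed chart.\<close>
  define W where "W t = w (SOME c. c \<in> CA t) t" for t
  have W: "W t = w c t" if "t \<in> {a..b}" "c \<in> CA t" for t c
    unfolding W_def using that by (intro inv someI[of "\<lambda>c. c \<in> CA t" c])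
  have "(W has_derivative (\<lambda>h. 0)) (at t within {a..b})" if t: "t \<in> {a..b}" for t
  proof -
    obtain c where c: "c \<in> CA t"
      using CA_nonempty[OF t] by blast
    interpret C: smooth_metric "snd c ` fst c" "g c"
      by (rule metric[OF CA_D(1)[OF c]])
    let ?x = "snd c (\<gamma> t)"
    have xS: "?x \<in> snd c ` fst c"
      using CA_D(2)[OF c] by blast
    have G: "((\<lambda>r. g c (snd c (\<gamma> r)) (p r) (q r)) has_derivative
        (\<lambda>h. C.dG ?x (h *\<^sub>R vel c t) (p t) (q t) + g c ?x (p' h) (q t) + g c ?x (p t) (q' h))) (at t within {a..b})"
      if "(p has_derivative p') (at t within {a..b})" "(q has_derivative q') (at t within {a..b})" for p q p' q'
      by (rule has_derivative_bilinear_family[where F = "g c" and F' = "C.dG ?x" and \<gamma> = "\<lambda>t. snd c (\<gamma> t)",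
          OF C.open_S xS t _ C.G_deriv[OF xS] C.dG_bilinear[OF xS]
            position_deriv[OF t order_refl c, unfolded has_vector_derivative_def] that]) (rule C.bil)
    note D = jacobi_systemD(3)[OF J t c, unfolded has_vector_derivative_def]
      jacobi_systemD(4)[OF J t c, unfolded has_vector_derivative_def]
      jacobi_systemD(3)[OF J' t c, unfolded has_vector_derivative_def]
      jacobi_systemD(4)[OF J' t c, unfolded has_vector_derivative_def]
    have s: "C.dG ?x (h *\<^sub>R d) u v = h * C.dG ?x d u v" for h d u v
      using linear_scale[OF C.dG_linear[OF xS]] by simp
    \<comment> \<open>Metric compatibility removes the Christoffel terms, the two copies of the
      metric on \<open>K\<close> and \<open>K'\<close> cancel, and the curvature terms cancel by
      self-adjointness.\<close>
    have "((\<lambda>t. w c t) has_derivative (\<lambda>h. 0)) (at t within {a..b})"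
      unfolding w_def
      by (rule has_derivative_eq_rhs[OF has_derivative_diff[OF G[OF D(2,3)] G[OF D(1,4)]]])
        (simp add: fun_eq_iff C.compatible[OF xS] C.\<Gamma>_simps[OF xS] C.G_simps[OF xS] C.curvature_jacobi_sym[OF xS, of _ "J t c" "J' t c"] algebra_simps)
    thus ?thesis
    proof (rule has_derivative_transform_eventually)
      show "\<forall>\<^sub>F x in at t within {a..b}. w c x = W x"
        using CA_eventually[OF t order_refl c] by eventually_elim (rule W[symmetric]; blast)
    qed (use W[OF t c] t in auto)
  qed
  from has_derivative_zero_constant[OF convex_real_interval(5) this]
  obtain k where "\<forall>x\<in>{a..b}. W x = k"
    by blast
  hence "W t = W s"
    using t by simp
  thus ?thesis
    using W[OF t(1) c(1)] W[OF t(2) c(2)] by (simp add: w_def)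
qed

text \<open>The value at \<open>t\<close> of a Jacobi field depends linearly on its initial data,
  and \<open>l t\<close> is the kernel of this map. Without conjugate instants
  \<open>w \<mapsto> J (0, w) t\<close> is invertible, so \<open>B t v\<close> is the unique
  \<open>w\<close> with \<open>J (0, w) t = - J (v, 0) t\<close>; continuity and the limit at
  \<open>a\<close> follow from this equation.\<close>

lemma jacobi_lagrangian_graph:
  assumes c: "c \<in> CA a" and G: "G = g c (snd c (\<gamma> a))" and l: "l = jacobi_lagrangian A g a b \<gamma> c"
    and nonconj: "\<And>t. t \<in> {a<..b} \<Longrightarrow> l t \<inter> point_lagrangian = {0}"
  obtains B where
    "\<And>t. t \<in> {a<..b} \<Longrightarrow> linear (B t)"
    "\<And>t. t \<in> {a<..b} \<Longrightarrow> l t = {(v, w). w = B t v}"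
    "\<And>t v w. t \<in> {a<..b} \<Longrightarrow> G (B t v) w = G v (B t w)"
    "\<And>v. continuous_on {a<..b} (\<lambda>t. B t v)"
    "\<And>v. ((\<lambda>t. (t - a) *\<^sub>R B t v) \<longlongrightarrow> - v) (at_right a)"
proof -
  have a: "a \<in> {a..b}"
    using ab by simp
  have "\<exists>J K. jacobi_system a b J K \<and> J a c = fst x \<and> K a c = snd x" for x
    using jacobi_system_exists[OF c] by metis
  then obtain J K where JK: "\<And>x. jacobi_system a b (J x) (K x)" "\<And>x. J x a c = fst x" "\<And>x. K x a c = snd x"
    by metis
  have unique: "J' t c' = J x t c'"
    if "jacobi_system a b J' K'" "J' a c = fst x" "K' a c = snd x" "t \<in> {a..b}" for J' K' x t c'
    using jacobi_system_unique[OF jacobi_system_lincomb[OF order_refl that(1) JK(1), of 1 "-1" x] c _ _ that(4), of c']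
    by (simp add: that(2,3) JK(2,3))
  have lincomb: "J (p *\<^sub>R x + q *\<^sub>R y) t c' = p *\<^sub>R J x t c' + q *\<^sub>R J y t c'" if "t \<in> {a..b}" for p q x y t c'
    by (rule unique[OF jacobi_system_lincomb[OF order_refl JK(1) JK(1)] _ _ that, symmetric]) (simp_all add: JK(2,3))
  have lin: "linear (\<lambda>x. J x t c')" if "t \<in> {a..b}" for t c'
    using lincomb[OF that, of 1 _ 1] lincomb[OF that, of _ _ 0 0] by (intro linearI) simp_all
  have l_iff: "x \<in> l t \<longleftrightarrow> J x t c' = 0" if t: "t \<in> {a..b}" and c': "c' \<in> CA t" for x t c'
  proof
    assume "x \<in> l t"
    then obtain J' where J': "jacobi_field A g a b \<gamma> J'" "J' a c = fst x"
        "covariant_derivative A g a b \<gamma> J' a c = snd x" "J' t c' = 0"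
      using c' unfolding l jacobi_lagrangian_def by force
    from unique[OF jacobi_field_jacobi_system[OF J'(1)] J'(2,3) t, of c'] J'(4)
    show "J x t c' = 0"
      by simp
  next
    assume 0: "J x t c' = 0"
    have "J x t c'' = 0" if "c'' \<in> CA t" for c''
      using TS_change[OF jacobi_systemD(1)[OF JK(1) t] c' that] 0 by (simp add: linear_0[OF jac_linear[OF c' that]])
    moreover have "jacobi_field A g a b \<gamma> (J x)"
      by (rule jacobi_system_jacobi_field[OF JK(1)])
    moreover have "covariant_derivative A g a b \<gamma> (J x) a c = snd x"
      using jacobi_system_covariant_derivative[OF JK(1) a] JK(3) by simp
    ultimately show "x \<in> l t"
      unfolding l jacobi_lagrangian_def using JK(2) by (cases x) auto
  qed
  have split: "J (v, w) t c' = J (v, 0) t c' + J (0, w) t c'" if "t \<in> {a..b}" for v w t c'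
    using lincomb[OF that, of 1 "(v, 0)" 1 "(0, w)"] by simp
  have linD: "linear (\<lambda>w. J (0, w) t c')" if "t \<in> {a..b}" for t c'
    using linear_compose[OF _ lin[OF that], of "Pair 0" c'] by (simp add: o_def linear_iff)
  have injD: "inj (\<lambda>w. J (0, w) t c')" if t: "t \<in> {a<..b}" and c': "c' \<in> CA t" for t c'
  proof (subst linear_injective_0[OF linD], safe)
    have t': "t \<in> {a..b}"
      using t by simp
    thus "t \<in> {a..b}" .
    fix w assume "J (0, w) t c' = 0"
    hence "(0, w) \<in> l t \<inter> point_lagrangian"
      using l_iff[OF t' c'] by (simp add: point_lagrangian_def)
    thus "w = 0"
      using nonconj[OF t] by (simp add: zero_prod_def)
  qed
  define B where "B t v = (SOME w. (v, w) \<in> l t)" for t v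
  have B: "(v, B t v) \<in> l t" if t: "t \<in> {a<..b}" for t v
  proof -
    have t': "t \<in> {a..b}"
      using t by simp
    obtain c' where c': "c' \<in> CA t"
      using CA_nonempty[OF t'] by blast
    obtain w where "- J (v, 0) t c' = J (0, w) t c'"
      using linear_inj_imp_surj[OF linD[OF t'] injD[OF t c'], THEN surjD] by blast
    hence "J (v, w) t c' = 0"
      using split[OF t', of v w c'] by (simp flip: \<open>- J (v, 0) t c' = J (0, w) t c'\<close>)
    hence "(v, w) \<in> l t"
      by (simp only: l_iff[OF t' c'])
    thus ?thesis
      unfolding B_def by (rule someI)
  qed
  have JB: "J (0, B t v) t c' = - J (v, 0) t c'" if t: "t \<in> {a<..b}" and c': "c' \<in> CA t" for t v c'
  proof -
    have t': "t \<in> {a..b}"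
      using t by simp
    have "J (v, B t v) t c' = 0"
      using B[OF t] l_iff[OF t' c'] by blast
    thus ?thesis
      using split[OF t', of v "B t v" c'] by (simp add: eq_neg_iff_add_eq_0 add.commute)
  qed
  have l_eq: "l t = {(v, w). w = B t v}" if t: "t \<in> {a<..b}" for t
  proof -
    have t': "t \<in> {a..b}"
      using t by simp
    obtain c' where c': "c' \<in> CA t"
      using CA_nonempty[OF t'] by blast
    have "w = B t v" if "(v, w) \<in> l t" for v w
    proof -
      have "J (v, w) t c' = 0" "J (v, B t v) t c' = 0"
        using l_iff[OF t' c'] B[OF t] that by blast+
      hence "J (0, w) t c' = J (0, B t v) t c'"
        using split[OF t', of v w c'] split[OF t', of v "B t v" c'] by (simp add: add_eq_0_iff)
      thus ?thesis
        by (rule Fun.injD[OF injD[OF t c']])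
    qed
    thus ?thesis
      using B[OF t] by auto
  qed
  have linB: "linear (B t)" if t: "t \<in> {a<..b}" for t
  proof -
    have t': "t \<in> {a..b}"
      using t by simp
    obtain c' where c': "c' \<in> CA t"
      using CA_nonempty[OF t'] by blast
    have mem: "x \<in> l t \<longleftrightarrow> snd x = B t (fst x)" for x
      by (cases x) (simp add: l_eq[OF t])
    have "p *\<^sub>R x + q *\<^sub>R y \<in> l t" if "x \<in> l t" "y \<in> l t" for p q x y
      using that lincomb[OF t', of p x q y c'] by (simp add: l_iff[OF t' c'])
    from this[of "(_, B t _)" "(_, B t _)"] have 1: "B t (p *\<^sub>R u + q *\<^sub>R v) = p *\<^sub>R B t u + q *\<^sub>R B t v" for p q u v
      by (simp add: mem)
    show ?thesis
      using 1[of 1 _ 1] 1[of _ _ 0 0] by (intro linearI) simp_all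
  qed
  have symG: "G u v = G v u" for u v
    unfolding G using smooth_metric.sym[OF metric[OF CA_D(1)[OF c]]] CA_D(2)[OF c] by blast
  have symB: "G (B t v) w = G v (B t w)" if t: "t \<in> {a<..b}" for t v w
  proof -
    have t': "t \<in> {a..b}"
      using t by simp
    obtain c' where c': "c' \<in> CA t"
      using CA_nonempty[OF t'] by blast
    have 0: "J (v, B t v) t c' = 0" "J (w, B t w) t c' = 0"
      using B[OF t] l_iff[OF t' c'] by blast+
    interpret C: smooth_metric "snd c' ` fst c'" "g c'"
      by (rule metric[OF CA_D(1)[OF c']])
    have "snd c' (\<gamma> t) \<in> snd c' ` fst c'"
      using CA_D(2)[OF c'] by blast
    \<comment> \<open>Both Jacobi fields vanish at \<open>t\<close>, hence so does their Wronskian;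
      at \<open>a\<close> it is the difference of the two sides.\<close>
    with wronskian_constant[OF JK(1)[of "(v, B t v)"] JK(1)[of "(w, B t w)"] a t' c c']
    show ?thesis
      by (simp add: JK(2,3) 0 G C.G_simps)
  qed
  have contB: "continuous_on {a<..b} (\<lambda>t. B t v)" for v
    unfolding continuous_on_def
  proof
    fix t assume t: "t \<in> {a<..b}"
    hence t': "t \<in> {a..b}"
      by simp
    obtain c' where c': "c' \<in> CA t"
      using CA_nonempty[OF t'] by blast
    have sub: "{a<..b} \<subseteq> {a..b}"
      by auto
    note ev = CA_eventually[OF t sub c']
    have limJ: "((\<lambda>r. J x r c') \<longlongrightarrow> J x t c') (at t within {a<..b})" for x
      using has_vector_derivative_continuous[OF has_vector_derivative_within_subset[OF jacobi_systemD(3)[OF JK(1) t' c'] sub]]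
      by (simp add: continuous_within)
    have evD: "\<forall>\<^sub>F r in at t within {a<..b}. linear (\<lambda>w. J (0, w) r c')"
      using ev by eventually_elim (intro linD; simp)
    have "\<forall>\<^sub>F r in at t within {a<..b}. - J (v, 0) r c' = J (0, B r v) r c'"
      using ev by eventually_elim (simp add: JB)
    from Lim_transform_eventually[OF tendsto_minus[OF limJ] this]
    have "((\<lambda>r. J (0, B r v) r c') \<longlongrightarrow> J (0, B t v) t c') (at t within {a<..b})"
      by (simp add: JB[OF t c'])
    thus "((\<lambda>r. B r v) \<longlongrightarrow> B t v) (at t within {a<..b})"
      using tendsto_linear_preimage[where D = "\<lambda>r w. J (0, w) r c'" and x = "\<lambda>r. B r v" and ?D0.0 = "\<lambda>w. J (0, w) t c'",
          OF evD linD[OF t'] injD[OF t c'] limJ] by blast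
  qed
  have limB: "((\<lambda>t. (t - a) *\<^sub>R B t v) \<longlongrightarrow> - v) (at_right a)" for v
  proof -
    have at: "at a within {a..b} = at_right a"
      by (rule at_within_Icc_at_right[OF ab])
    interpret C: smooth_metric "snd c ` fst c" "g c"
      by (rule metric[OF CA_D(1)[OF c]])
    have xS: "snd c (\<gamma> a) \<in> snd c ` fst c"
      using CA_D(2)[OF c] by blast
    \<comment> \<open>\<open>J (0, w)\<close> vanishes at \<open>a\<close> with derivative
      \<open>w\<close>, so division by \<open>t - a\<close> turns the degenerating maps into a
      family with limit the identity.\<close>
    let ?D = "\<lambda>t w. J (0, w) t c /\<^sub>R (t - a)"
    have limD: "((\<lambda>t. ?D t w) \<longlongrightarrow> w) (at_right a)" for w
      using has_vector_derivative_quotient[OF jacobi_systemD(3)[OF JK(1) a c, of "(0, w)"]]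
      by (simp add: JK(2,3) at C.\<Gamma>_simps[OF xS])
    have "((\<lambda>t. J (v, 0) t c) \<longlongrightarrow> J (v, 0) a c) (at_right a)"
      using has_vector_derivative_continuous[OF jacobi_systemD(3)[OF JK(1) a c, of "(v, 0)"]]
      by (simp add: continuous_within at)
    hence lim: "((\<lambda>t. - J (v, 0) t c) \<longlongrightarrow> - v) (at_right a)"
      by (intro tendsto_minus) (simp add: JK(2))
    have ev: "\<forall>\<^sub>F t in at_right a. t \<in> {a<..b} \<and> c \<in> CA t"
      using CA_eventually[OF a order_refl c] unfolding at
      by (rule eventually_elim2[OF _ eventually_at_right_less]) simp
    have evD: "\<forall>\<^sub>F t in at_right a. linear (?D t)"
      using ev by eventually_elim (intro linear_compose_scale_right linD; simp)
    have "\<forall>\<^sub>F t in at_right a. - J (v, 0) t c = ?D t ((t - a) *\<^sub>R B t v)"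
      using ev
    proof eventually_elim
      case (elim t)
      hence "t \<in> {a..b}" "t - a \<noteq> 0"
        by auto
      thus ?case
        using linear_scale[OF linD[of t c], of "t - a" "B t v"] JB[of t c v] elim by simp
    qed
    from Lim_transform_eventually[OF lim this]
    show ?thesis
      using tendsto_linear_preimage[where D = ?D and x = "\<lambda>t. (t - a) *\<^sub>R B t v" and ?D0.0 = "\<lambda>w. w",
          OF evD linear_ident inj_on_id2 limD] by blast
  qed
  show thesis
    using that[of B] linB l_eq symB contB limB by blast
qed

end

text \<open>A basis of \<open>T\<close> determines the extension. The second fundamental operator is
  prescribed on \<open>T\<close>, whereas the linear algebra works with a map that is linear on the
  whole space.\<close>

lemma linear_extension:
  fixes S :: "'e::euclidean_space \<Rightarrow> 'e"
  assumes T: "subspace T" and add: "\<And>v w. v \<in> T \<Longrightarrow> w \<in> T \<Longrightarrow> S (v + w) = S v + S w"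
    and scale: "\<And>r v. v \<in> T \<Longrightarrow> S (r *\<^sub>R v) = r *\<^sub>R S v"
  obtains S' where "linear S'" "\<And>v. v \<in> T \<Longrightarrow> S' v = S v"
proof -
  obtain Bs where Bs: "Bs \<subseteq> T" "independent Bs" "T \<subseteq> span Bs" "card Bs = dim T"
    by (rule basis_exists[of T])
  obtain S' where S': "linear S'" "\<forall>v\<in>Bs. S' v = S v"
    using linear_independent_extend[OF Bs(2), of S] by blast
  have "S 0 = 0"
    using scale[of 0 0] subspace_0[OF T] by simp
  hence "subspace {v \<in> T. S' v = S v}"
    using subspace_0[OF T] subspace_add[OF T] subspace_scale[OF T]
    by (intro subspaceI) (simp_all add: linear_0[OF S'(1)] linear_add[OF S'(1)] linear_scale[OF S'(1)] add scale)
  hence "span Bs \<subseteq> {v \<in> T. S' v = S v}"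
    using Bs(1) S'(2) by (intro span_minimal) auto
  with Bs(3) that[OF S'(1)] show thesis
    by blast
qed

theorem corollary4p9:
  fixes X :: "'m topology"
    and A :: "('m, 'e::euclidean_space) chart set"
    and g :: "('m, 'e) metric"
    and a b \<epsilon> :: real
    and \<gamma> :: "real \<Rightarrow> 'm"
    and P :: "'m set"
    and k :: nat
    and c :: "('m, 'e) chart"
    and \<nu> :: 'e
    and T :: "'e set"
    and G :: "'e \<Rightarrow> 'e \<Rightarrow> real"
    and S :: "'e \<Rightarrow> 'e"
    and \<omega> :: "'e \<times> 'e \<Rightarrow> 'e \<times> 'e \<Rightarrow> real"
    and l :: "real \<Rightarrow> ('e \<times> 'e) set"
    and LP :: "('e \<times> 'e) set"
    and \<mu> :: "real \<Rightarrow> real \<Rightarrow> (real \<Rightarrow> ('e \<times> 'e) set) \<Rightarrow> int"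
  assumes M: "semi_riemannian_manifold X A g"
    and \<gamma>: "geodesic X A g a b \<gamma>"
    and P: "embedded_submanifold X A k P" "connectedin X P" "\<gamma> a \<in> P"
    and c: "c \<in> charts_at A (\<gamma> a)"
    and \<nu>: "\<nu> = velocity A a b \<gamma> a c"
    and T: "T = submanifold_tangent c P (\<gamma> a)"
    and G: "G = metric_at g c (\<gamma> a)"
    and normal: "\<nu> \<in> orthogonal_space G T"
    and nondeg: "nondegenerate_on T G"
    and S: "second_fundamental_operator g c P (\<gamma> a) \<nu> S"
    and \<omega>: "\<omega> = jacobi_symplectic_form G"
    and l: "l = jacobi_lagrangian A g a b \<gamma> c"
    and LP: "LP = submanifold_lagrangian G T S"
    and \<mu>: "is_maslov_index \<omega> LP \<mu>"
    and \<epsilon>: "0 < \<epsilon>" "\<epsilon> < b - a"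
    and no_instants: "\<forall>t\<in>{a<..a + \<epsilon>}. \<not> conjugate_instant a b l t \<and> \<not> focal_instant a b l LP t"
    and index: "\<mu> (a + \<epsilon>) b l < - int (n_minus T G) \<or> \<mu> (a + \<epsilon>) b l > int k"
  shows "\<exists>t\<in>{a + \<epsilon>..b}. conjugate_instant a b l t"
proof (rule ccontr)
  assume no_conj: "\<not> ?thesis"
  have ab: "a < b" "a < a + \<epsilon>" "a + \<epsilon> < b"
    using \<epsilon> by auto
  interpret geodesic_setting X A g a b \<gamma>
    by unfold_locales (rule M \<gamma> ab(1))+
  have cA: "c \<in> A" "\<gamma> a \<in> fst c"
    using c by (auto simp: charts_at_def)
  interpret C: smooth_metric "snd c ` fst c" "g c"
    by (rule metric[OF cA(1)])
  have xS: "snd c (\<gamma> a) \<in> snd c ` fst c"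
    using cA(2) by blast
  have G': "G = g c (snd c (\<gamma> a))"
    by (simp add: G metric_at_def fun_eq_iff)
  have Tk: "subspace T" "dim T = k"
    using submanifold_tangent_dim[OF _ P(1,3) c] M unfolding T semi_riemannian_manifold_def by blast+
  have S1: "\<And>v. v \<in> T \<Longrightarrow> S v \<in> T" "\<And>v w. v \<in> T \<Longrightarrow> w \<in> T \<Longrightarrow> S (v + w) = S v + S w"
    "\<And>r v. v \<in> T \<Longrightarrow> S (r *\<^sub>R v) = r *\<^sub>R S v" "\<And>v w. v \<in> T \<Longrightarrow> w \<in> T \<Longrightarrow> G (S v) w = G v (S w)"
    using S unfolding second_fundamental_operator_def Let_def T[symmetric] G[symmetric] by blast+
  obtain S' where S': "linear S'" "\<And>v. v \<in> T \<Longrightarrow> S' v = S v"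
    using linear_extension[OF Tk(1) S1(2,3)] by blast
  \<comment> \<open>\<open>LP\<close> evaluates the operator at points of \<open>T\<close>, so the
    globally linear extension describes the same Lagrangian.\<close>
  have LP': "LP = submanifold_lagrangian G T S'"
    unfolding LP submanifold_lagrangian_def using S'(2) by auto
  \<comment> \<open>Instants up to \<open>a + \<epsilon>\<close> are excluded by hypothesis, later
    ones by the negated conclusion.\<close>
  have nonconj: "l t \<inter> point_lagrangian = {0}" if "t \<in> {a<..b}" for t
  proof -
    have "\<not> conjugate_instant a b l t"
      using no_conj no_instants that by (cases "t \<le> a + \<epsilon>") auto
    thus ?thesis
      using that by (simp add: conjugate_instant_def)
  qed
  obtain B where B:
    "\<And>t. t \<in> {a<..b} \<Longrightarrow> linear (B t)"
    "\<And>t. t \<in> {a<..b} \<Longrightarrow> l t = {(v, w). w = B t v}"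
    "\<And>t v w. t \<in> {a<..b} \<Longrightarrow> G (B t v) w = G v (B t w)"
    "\<And>v. continuous_on {a<..b} (\<lambda>t. B t v)"
    "\<And>v. ((\<lambda>t. (t - a) *\<^sub>R B t v) \<longlongrightarrow> - v) (at_right a)"
    using jacobi_lagrangian_graph[OF c G' l nonconj] by blast
  have nofocal: "l t \<inter> submanifold_lagrangian G T S' = {0}" if "t \<in> {a<..a + \<epsilon>}" for t
  proof -
    have "t \<in> {a<..b}"
      using that \<epsilon> by simp
    thus ?thesis
      using bspec[OF no_instants that] by (simp add: focal_instant_def LP')
  qed
  have G_facts: "bilinear G" "\<And>u v. G u v = G v u" "\<And>u. (\<And>w. G u w = 0) \<Longrightarrow> u = 0"
    unfolding G' by (rule C.bil[OF xS], rule C.sym[OF xS], rule C.nd[OF xS])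
  have S'_facts: "\<And>v. v \<in> T \<Longrightarrow> S' v \<in> T" "\<And>v w. v \<in> T \<Longrightarrow> w \<in> T \<Longrightarrow> G (S' v) w = G v (S' w)"
    using S1(1,4) S'(2) by simp_all
  have \<mu>': "is_maslov_index (jacobi_symplectic_form G) (submanifold_lagrangian G T S') \<mu>"
    using \<mu> unfolding \<omega> LP' .
  have "- int (n_minus T G) \<le> \<mu> (a + \<epsilon>) b l" "\<mu> (a + \<epsilon>) b l \<le> int (dim T)"
    by (rule maslov_index_bounds[of G T S' a "a + \<epsilon>" b B l \<mu>]; fact)+
  with index Tk(2) show False
    by linarith
qed

end
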